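(* Let $I$ be a (proper) monomial ideal of $S=K[x_1,\ldots,x_n]$ over a field $K$ with at least $n$ elements. If $d=\dim(S/I)$ and $\lambda_1,\ldots,\lambda_n$ are distinct elements of $K$, then the polynomials $$f_i:=\sum_{j=1}^n\lambda_j^{i-1}x_j\quad\text{for } i=1,\ldots,d$$ form a linear system of parameters for $S/I$. Furthermore, $S/I$ is a Cohen--Macaulay ring if and only if $\{f_1,\ldots,f_d\}$ is a regular sequence on $S/I$.
   Context: $S$ has the standard grading and $\mathfrak{m}=(x_1,\ldots,x_n)$. Homogeneous polynomials $f_1,\ldots,f_d\in S$ form a system of parameters for $S/I$ if $d=\dim(S/I)$ and $\mathrm{rad}(I,f_1,\ldots,f_d)=\mathfrak{m}$; it is linear if the $f_i$ are linear forms. The convention $\lambda^0=1$ is used for all $\lambda\in K$ (including $\lambda=0$). A sequence $f_1,\ldots,f_d$ of forms is a regular sequence on $S/I$ if $((I,f_1,\ldots,f_i):f_{i+1})=(I,f_1,\ldots,f_i)$ for $i=0,\ldots,d-1$ (for $i=0$ this means $(I:f_1)=I$). *)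

theory Defs
  imports
    "HOL-Algebra.Algebra"
    "HOL-Algebra.Algebraic_Closure_Type"
    "HOL-Library.Poly_Mapping"
    "HOL-Library.Extended_Nat"
    "HOL-Library.Cardinality"
begin

section \<open>Commutative algebra over \<open>HOL-Algebra\<close> rings\<close>

definition radical :: "('a, 'b) ring_scheme \<Rightarrow> 'a set \<Rightarrow> 'a set" where
  "radical R J = {x \<in> carrier R. \<exists>k::nat. x [^]\<^bsub>R\<^esub> k \<in> J}"

definition colon_ideal :: "('a, 'b) ring_scheme \<Rightarrow> 'a set \<Rightarrow> 'a \<Rightarrow> 'a set" where
  "colon_ideal R J f = {g \<in> carrier R. g \<otimes>\<^bsub>R\<^esub> f \<in> J}"

text \<open>
  Krull dimension: the supremum of the lengths of strict chains
  \<open>P 0 \<subset> P 1 \<subset> \<dots> \<subset> P l\<close> of prime ideals.  The zero ring, which has no prime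
  ideals, gets the value 0.
\<close>

definition krull_dim :: "('a, 'b) ring_scheme \<Rightarrow> enat" where
  "krull_dim R = Sup {enat l | l. \<exists>P. (\<forall>i\<le>l. primeideal (P i) R) \<and> (\<forall>i<l. P i \<subset> P (Suc i))}"

text \<open>
  \<open>xs = [f\<^sub>1, \<dots>, f\<^sub>r]\<close> is a regular sequence on \<open>R / J\<close> in the sense that
  \<open>((J, f\<^sub>1, \<dots>, f\<^sub>i) : f\<^sub>i\<^sub>+\<^sub>1) = (J, f\<^sub>1, \<dots>, f\<^sub>i)\<close> for \<open>0 \<le> i < r\<close>.
  The condition \<open>(J, f\<^sub>1, \<dots>, f\<^sub>r) \<noteq> R\<close> is not part of the definition; it is automatic
  where the definition is used below, since there \<open>J\<close> and \<open>xs\<close> lie in a maximal ideal.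
\<close>

definition regular_seq :: "('a, 'b) ring_scheme \<Rightarrow> 'a set \<Rightarrow> 'a list \<Rightarrow> bool" where
  "regular_seq R J xs \<longleftrightarrow> set xs \<subseteq> carrier R \<and>
     (\<forall>i<length xs.
        colon_ideal R (Idl\<^bsub>R\<^esub> (J \<union> set (take i xs))) (xs ! i) = Idl\<^bsub>R\<^esub> (J \<union> set (take i xs)))"

text \<open>
  The fraction \<open>a / s\<close> in the localization of \<open>R\<close> at a prime \<open>P\<close>, as the class of all
  \<open>(b, t)\<close> with \<open>u (a t - b s) = 0\<close> for some \<open>u\<close> outside \<open>P\<close>.
\<close>

definition frac_at :: "('a, 'b) ring_scheme \<Rightarrow> 'a set \<Rightarrow> 'a \<Rightarrow> 'a \<Rightarrow> ('a \<times> 'a) set" where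
  "frac_at R P a s =
     {(b, t). b \<in> carrier R \<and> t \<in> carrier R - P \<and>
        (\<exists>u\<in>carrier R - P. u \<otimes>\<^bsub>R\<^esub> (a \<otimes>\<^bsub>R\<^esub> t) = u \<otimes>\<^bsub>R\<^esub> (b \<otimes>\<^bsub>R\<^esub> s))}"

text \<open>
  As for multiplication in \<^const>\<open>FactRing\<close>, sums and products of classes are unions over
  all representatives; the sets united are all equal (lemmas \<open>frac_at_mult\<close>, \<open>frac_at_add\<close>).
\<close>

definition localization :: "('a, 'b) ring_scheme \<Rightarrow> 'a set \<Rightarrow> ('a \<times> 'a) set ring" where
  "localization R P =
     \<lparr> carrier = {frac_at R P a s | a s. a \<in> carrier R \<and> s \<in> carrier R - P},
       monoid.mult = (\<lambda>F G. \<Union>{frac_at R P (a \<otimes>\<^bsub>R\<^esub> b) (s \<otimes>\<^bsub>R\<^esub> t) | a s b t. (a, s) \<in> F \<and> (b, t) \<in> G}),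
       one = frac_at R P \<one>\<^bsub>R\<^esub> \<one>\<^bsub>R\<^esub>,
       ring.zero = frac_at R P \<zero>\<^bsub>R\<^esub> \<one>\<^bsub>R\<^esub>,
       add = (\<lambda>F G. \<Union>{frac_at R P (a \<otimes>\<^bsub>R\<^esub> t \<oplus>\<^bsub>R\<^esub> b \<otimes>\<^bsub>R\<^esub> s) (s \<otimes>\<^bsub>R\<^esub> t) | a s b t.
                (a, s) \<in> F \<and> (b, t) \<in> G}) \<rparr>"

lemma (in primeideal) frac_at_eq_iff:
  assumes "a \<in> carrier R" "s \<in> carrier R - I" "b \<in> carrier R" "t \<in> carrier R - I"
  shows "frac_at R I a s = frac_at R I b t \<longleftrightarrow>
    (\<exists>u\<in>carrier R - I. u \<otimes> (a \<otimes> t) = u \<otimes> (b \<otimes> s))"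
proof
  have *: "\<one> \<in> carrier R - I"
    using I_notcarr one_imp_carrier by blast
  have cl: "x \<otimes> y \<in> carrier R - I" if "x \<in> carrier R - I" "y \<in> carrier R - I" for x y
    using that I_prime by blast
  {
    assume eq: "frac_at R I a s = frac_at R I b t"
    have "(b, t) \<in> frac_at R I b t"
      using assms * by (auto simp: frac_at_def)
    then have "(b, t) \<in> frac_at R I a s"
      by (simp only: eq)
    then show "\<exists>u\<in>carrier R - I. u \<otimes> (a \<otimes> t) = u \<otimes> (b \<otimes> s)"
      by (simp add: frac_at_def)
  }
  have sub: "frac_at R I a' s' \<subseteq> frac_at R I b' t'"
    if a': "a' \<in> carrier R" "s' \<in> carrier R - I" "b' \<in> carrier R" "t' \<in> carrier R - I"
      and u: "u \<in> carrier R - I" "u \<otimes> (a' \<otimes> t') = u \<otimes> (b' \<otimes> s')" for a' s' b' t' u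
  proof
    fix z assume "z \<in> frac_at R I a' s'"
    then obtain c r v where z: "z = (c, r)" "c \<in> carrier R" "r \<in> carrier R - I"
        "v \<in> carrier R - I" "v \<otimes> (a' \<otimes> r) = v \<otimes> (c \<otimes> s')"
      by (auto simp: frac_at_def)
    have "(u \<otimes> v \<otimes> s') \<otimes> (b' \<otimes> r) = (v \<otimes> r) \<otimes> (u \<otimes> (b' \<otimes> s'))"
      using a' u(1) z by (simp add: m_ac)
    also have "\<dots> = (u \<otimes> t') \<otimes> (v \<otimes> (a' \<otimes> r))"
      unfolding u(2)[symmetric] using a' u(1) z(2-4) by (simp add: m_ac)
    also have "\<dots> = (u \<otimes> v \<otimes> s') \<otimes> (c \<otimes> t')"
      unfolding z(5) using a' u(1) z(2-4) by (simp add: m_ac)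
    finally show "z \<in> frac_at R I b' t'"
      using a' u(1) z cl[OF cl[OF u(1) z(4)] a'(2)] by (auto simp: frac_at_def)
  qed
  assume "\<exists>u\<in>carrier R - I. u \<otimes> (a \<otimes> t) = u \<otimes> (b \<otimes> s)"
  then show "frac_at R I a s = frac_at R I b t"
    using sub[OF assms] sub[OF assms(3,4,1,2)] by (metis subset_antisym)
qed

lemma (in primeideal) frac_at_mem_iff:
  assumes "a \<in> carrier R" "s \<in> carrier R - I"
  shows "(b, t) \<in> frac_at R I a s \<longleftrightarrow>
    b \<in> carrier R \<and> t \<in> carrier R - I \<and> frac_at R I b t = frac_at R I a s"
  using frac_at_eq_iff[OF assms, of b t] by (auto simp: frac_at_def)

lemma (in primeideal) frac_at_mult:
  assumes "a \<in> carrier R" "s \<in> carrier R - I" "b \<in> carrier R" "t \<in> carrier R - I"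
  shows "frac_at R I a s \<otimes>\<^bsub>localization R I\<^esub> frac_at R I b t = frac_at R I (a \<otimes> b) (s \<otimes> t)"
proof -
  have cl: "x \<otimes> y \<in> carrier R - I" if "x \<in> carrier R - I" "y \<in> carrier R - I" for x y
    using that I_prime by blast
  have *: "frac_at R I (a' \<otimes> b') (s' \<otimes> t') = frac_at R I (a \<otimes> b) (s \<otimes> t)"
    if "(a', s') \<in> frac_at R I a s" "(b', t') \<in> frac_at R I b t" for a' s' b' t'
  proof -
    note reps = that
    obtain u v where
        u: "a' \<in> carrier R" "s' \<in> carrier R - I" "u \<in> carrier R - I"
           "u \<otimes> (a \<otimes> s') = u \<otimes> (a' \<otimes> s)"
      and v: "b' \<in> carrier R" "t' \<in> carrier R - I" "v \<in> carrier R - I"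
           "v \<otimes> (b \<otimes> t') = v \<otimes> (b' \<otimes> t)"
      using reps unfolding frac_at_def by blast
    have "(u \<otimes> v) \<otimes> ((a \<otimes> b) \<otimes> (s' \<otimes> t')) = (u \<otimes> (a \<otimes> s')) \<otimes> (v \<otimes> (b \<otimes> t'))"
      using assms u(1-3) v(1-3) by (simp add: m_ac)
    also have "\<dots> = (u \<otimes> v) \<otimes> ((a' \<otimes> b') \<otimes> (s \<otimes> t))"
      unfolding u(4) v(4) using assms u(1-3) v(1-3) by (simp add: m_ac)
    finally have "frac_at R I (a \<otimes> b) (s \<otimes> t) = frac_at R I (a' \<otimes> b') (s' \<otimes> t')"
      using assms u v cl by (subst frac_at_eq_iff) auto
    then show ?thesis by simp
  qed
  have "(a, s) \<in> frac_at R I a s" "(b, t) \<in> frac_at R I b t"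
    using assms by (simp_all add: frac_at_mem_iff)
  then have "{frac_at R I (a' \<otimes> b') (s' \<otimes> t') | a' s' b' t'.
      (a', s') \<in> frac_at R I a s \<and> (b', t') \<in> frac_at R I b t} = {frac_at R I (a \<otimes> b) (s \<otimes> t)}"
    using * by blast
  then show ?thesis by (simp add: localization_def)
qed

lemma (in primeideal) frac_at_add:
  assumes "a \<in> carrier R" "s \<in> carrier R - I" "b \<in> carrier R" "t \<in> carrier R - I"
  shows "frac_at R I a s \<oplus>\<^bsub>localization R I\<^esub> frac_at R I b t =
    frac_at R I (a \<otimes> t \<oplus> b \<otimes> s) (s \<otimes> t)"
proof -
  have cl: "x \<otimes> y \<in> carrier R - I" if "x \<in> carrier R - I" "y \<in> carrier R - I" for x y
    using that I_prime by blast
  have *: "frac_at R I (a' \<otimes> t' \<oplus> b' \<otimes> s') (s' \<otimes> t') = frac_at R I (a \<otimes> t \<oplus> b \<otimes> s) (s \<otimes> t)"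
    if "(a', s') \<in> frac_at R I a s" "(b', t') \<in> frac_at R I b t" for a' s' b' t'
  proof -
    note reps = that
    obtain u v where
        u: "a' \<in> carrier R" "s' \<in> carrier R - I" "u \<in> carrier R - I"
           "u \<otimes> (a \<otimes> s') = u \<otimes> (a' \<otimes> s)"
      and v: "b' \<in> carrier R" "t' \<in> carrier R - I" "v \<in> carrier R - I"
           "v \<otimes> (b \<otimes> t') = v \<otimes> (b' \<otimes> t)"
      using reps unfolding frac_at_def by blast
    have "(u \<otimes> v) \<otimes> ((a \<otimes> t \<oplus> b \<otimes> s) \<otimes> (s' \<otimes> t')) =
        (u \<otimes> (a \<otimes> s')) \<otimes> (v \<otimes> t \<otimes> t') \<oplus> (v \<otimes> (b \<otimes> t')) \<otimes> (u \<otimes> s \<otimes> s')"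
      using assms u(1-3) v(1-3) by (simp add: l_distr r_distr m_ac)
    also have "\<dots> = (u \<otimes> v) \<otimes> ((a' \<otimes> t' \<oplus> b' \<otimes> s') \<otimes> (s \<otimes> t))"
      unfolding u(4) v(4) using assms u(1-3) v(1-3) by (simp add: l_distr r_distr m_ac)
    finally have "frac_at R I (a \<otimes> t \<oplus> b \<otimes> s) (s \<otimes> t) = frac_at R I (a' \<otimes> t' \<oplus> b' \<otimes> s') (s' \<otimes> t')"
      using assms u v cl by (subst frac_at_eq_iff) auto
    then show ?thesis by simp
  qed
  have "(a, s) \<in> frac_at R I a s" "(b, t) \<in> frac_at R I b t"
    using assms by (simp_all add: frac_at_mem_iff)
  then have "{frac_at R I (a' \<otimes> t' \<oplus> b' \<otimes> s') (s' \<otimes> t') | a' s' b' t'.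
      (a', s') \<in> frac_at R I a s \<and> (b', t') \<in> frac_at R I b t} =
      {frac_at R I (a \<otimes> t \<oplus> b \<otimes> s) (s \<otimes> t)}"
    using * by blast
  then show ?thesis by (simp add: localization_def)
qed

text \<open>For a local ring \<open>A\<close>; the ideal \<open>\<mm>\<close> is then unique.\<close>

definition local_depth :: "('a, 'b) ring_scheme \<Rightarrow> enat" where
  "local_depth A =
     Sup {enat (length xs) | xs. \<exists>\<mm>. maximalideal \<mm> A \<and> set xs \<subseteq> \<mm> \<and> regular_seq A {\<zero>\<^bsub>A\<^esub>} xs}"

definition cohen_macaulay :: "('a, 'b) ring_scheme \<Rightarrow> bool" where
  "cohen_macaulay R \<longleftrightarrow> cring R \<and> noetherian_ring R \<and>
     (\<forall>M. maximalideal M R \<longrightarrow>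
        local_depth (localization R M) = krull_dim (localization R M))"


section \<open>The polynomial ring\<close>

text \<open>
  \<open>('n, 'k) mpoly\<close> is \<open>K[x\<^sub>1, \<dots>, x\<^sub>n]\<close> with \<open>n = CARD('n)\<close>: finitely supported
  functions from exponent vectors to coefficients, with the convolution product.
\<close>

type_synonym ('n, 'k) mpoly = "('n \<Rightarrow>\<^sub>0 nat) \<Rightarrow>\<^sub>0 'k"

abbreviation poly_S :: "('n::finite, 'k::field) mpoly ring" where
  "poly_S \<equiv> ring_of_type_algebra"

definition monomial :: "('n \<Rightarrow>\<^sub>0 nat) \<Rightarrow> ('n, 'k::field) mpoly" where
  "monomial m = Poly_Mapping.single m 1"

definition var :: "'n \<Rightarrow> ('n, 'k::field) mpoly" where
  "var j = monomial (Poly_Mapping.single j 1)"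

definition const :: "'k \<Rightarrow> ('n, 'k::field) mpoly" where
  "const c = Poly_Mapping.single 0 c"

definition homogeneous :: "nat \<Rightarrow> ('n::finite, 'k::field) mpoly \<Rightarrow> bool" where
  "homogeneous e p \<longleftrightarrow> (\<forall>m\<in>Poly_Mapping.keys p. (\<Sum>j\<in>UNIV. Poly_Mapping.lookup m j) = e)"

definition irrelevant_ideal :: "('n::finite, 'k::field) mpoly set" where
  "irrelevant_ideal = Idl\<^bsub>poly_S\<^esub> (range var)"

definition monomial_ideal :: "('n::finite, 'k::field) mpoly set \<Rightarrow> bool" where
  "monomial_ideal I \<longleftrightarrow> (\<exists>E. I = Idl\<^bsub>poly_S\<^esub> (monomial ` E))"

definition system_of_parameters ::
  "('n::finite, 'k::field) mpoly set \<Rightarrow> ('n, 'k) mpoly list \<Rightarrow> bool" where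
  "system_of_parameters I fs \<longleftrightarrow>
     (\<forall>f\<in>set fs. \<exists>e. homogeneous e f) \<and>
     krull_dim (poly_S Quot I) = enat (length fs) \<and>
     radical poly_S (Idl\<^bsub>poly_S\<^esub> (I \<union> set fs)) = irrelevant_ideal"

definition linear_system_of_parameters ::
  "('n::finite, 'k::field) mpoly set \<Rightarrow> ('n, 'k) mpoly list \<Rightarrow> bool" where
  "linear_system_of_parameters I fs \<longleftrightarrow>
     system_of_parameters I fs \<and> (\<forall>f\<in>set fs. homogeneous 1 f)"

definition vandermonde_form :: "('n::finite \<Rightarrow> 'k::field) \<Rightarrow> nat \<Rightarrow> ('n, 'k) mpoly" where
  "vandermonde_form lam i = (\<Sum>j\<in>UNIV. const (lam j ^ (i - 1)) * var j)"

end

theory Submission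
  imports Defs
begin

text \<open>
  The minimal primes of \<open>I\<close> are generated by the variables outside the faces \<open>F\<close> of a simplicial
  complex, and the Vandermonde matrix shows that modulo each of them \<open>f\<^sub>1, \<dots>, f\<^sub>d\<close> generate the
  irrelevant ideal as soon as \<open>\<bar>F\<bar> \<le> d\<close>.  Lengths of prime chains are bounded by a growth count: if
  \<open>D\<close> forms generate an irrelevant-primary ideal modulo a homogeneous ideal \<open>J\<close>, then polynomials of
  degree at most \<open>t\<close> span a space of dimension \<open>O(t\<^sup>D)\<close> modulo \<open>J\<close>, so any \<open>D + 1\<close> elements are
  algebraically dependent modulo \<open>J\<close>, and the lexicographically smallest monomial of a relation
  contradicts a prime chain of length \<open>D + 1\<close>.

  If the localization at the irrelevant ideal has depth \<open>d\<close>, then every homogeneous system of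
  parameters is regular: a zero divisor would lie in an associated prime, whose coheight is at least
  the depth, against the growth bound; and the depth drops by exactly one modulo a regular element.
  Conversely let \<open>f\<^sub>1, \<dots>, f\<^sub>d\<close> be regular.  By Zariski's lemma every maximal ideal contains monic
  polynomials \<open>p\<^sub>i(f\<^sub>i)\<close>; their leading forms, powers of the \<open>f\<^sub>i\<close>, form a homogeneous system of
  parameters and are therefore regular, hence so are the \<open>p\<^sub>i(f\<^sub>i)\<close>.  So the depth at every maximal
  ideal is at least \<open>d\<close>, which bounds the dimension from above.
\<close>

text \<open>That the depth does not depend on the regular sequence chosen rests on comparing socles
  (\<open>socle_exchange\<close>), the elementwise form of Hom(k, A/x) = Ext^1(k, A) = Hom(k, A/y)
  for regular \<open>x\<close> and \<open>y\<close>, with \<open>k\<close> the residue field. The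
  ideals of residue rings and localizations are all handled as ideals of one ring type, a module
  over itself; \<open>fraction_ring\<close> translates to ring records once, at the end. The
  obstacle in the converse direction is that the Cohen-Macaulay condition concerns all maximal
  ideals, while homogeneous arguments reach only the irrelevant one. As \<open>K\<close> need not be
  algebraically closed, a maximal ideal need not belong to a point, so translating the coordinates
  does not help; monic polynomials in the single forms do, since their top components are pure
  powers of the forms. \<open>K\<close> may also be finite, so regular elements come from prime
  avoidance in the whole ring and need be neither linear nor homogeneous. The depth theory is
  therefore developed for arbitrary ideals, and homogeneous ideals enter it through the fact that
  they are already saturated at the irrelevant ideal (\<open>sat_hideal\<close>).\<close>

interpretation idl: Modules.module "(*) :: 'a::comm_ring_1 \<Rightarrow> 'a \<Rightarrow> 'a"
  by unfold_locales (auto simp: algebra_simps)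

text \<open>With multiplication as scaling, this rule would bracket products to the left, against
  \<open>mult.assoc\<close> and \<open>algebra_simps\<close>.\<close>

declare idl.scale_scale [simp del]

section \<open>Ideals and primes of a Noetherian ring type\<close>

definition prime_set :: "'a::comm_ring_1 set \<Rightarrow> bool" where
  "prime_set P \<longleftrightarrow> idl.subspace P \<and> 1 \<notin> P \<and> (\<forall>a b. a * b \<in> P \<longrightarrow> a \<in> P \<or> b \<in> P)"

definition noeth :: "'a::comm_ring_1 itself \<Rightarrow> bool" where
  "noeth _ \<longleftrightarrow> (\<forall>J :: 'a set. idl.subspace J \<longrightarrow> (\<exists>G. finite G \<and> J = idl.span G))"

definition prime_chain :: "(nat \<Rightarrow> 'a::comm_ring_1 set) \<Rightarrow> nat \<Rightarrow> bool" where
  "prime_chain P l \<longleftrightarrow> (\<forall>i\<le>l. prime_set (P i)) \<and> (\<forall>i<l. P i \<subset> P (Suc i))"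

text \<open>Nonzerodivisors modulo \<open>J\<close>; the condition is vacuous for the unit ideal, in
  agreement with \<open>regular_seq\<close>, which does not ask for properness either.\<close>

definition reg :: "'a::comm_ring_1 set \<Rightarrow> 'a \<Rightarrow> bool" where
  "reg J x \<longleftrightarrow> (\<forall>s. x * s \<in> J \<longrightarrow> s \<in> J)"

lemma prime_setD:
  assumes "prime_set P"
  shows "idl.subspace P" "1 \<notin> P" "a * b \<in> P \<Longrightarrow> a \<in> P \<or> b \<in> P"
  using assms by (auto simp: prime_set_def)

lemma ideal_mult: "idl.subspace J \<Longrightarrow> x \<in> J \<Longrightarrow> c * x \<in> J"
  "idl.subspace J \<Longrightarrow> x \<in> J \<Longrightarrow> x * c \<in> J"
  for J :: "'a::comm_ring_1 set"
  using idl.subspace_scale[of J x c] by (auto simp: mult.commute)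

lemma prime_mult_notin: "prime_set P \<Longrightarrow> a \<notin> P \<Longrightarrow> b \<notin> P \<Longrightarrow> a * b \<notin> P"
  by (auto simp: prime_set_def)

lemma prime_power: "prime_set P \<Longrightarrow> a ^ k \<in> P \<Longrightarrow> a \<in> P"
  by (induction k) (auto simp: prime_set_def)

lemma prime_prod:
  assumes "prime_set P" "finite A" "(\<Prod>a\<in>A. f a) \<in> P" shows "\<exists>a\<in>A. f a \<in> P"
  using assms(2,3,1)
proof (induction A rule: finite_induct)
  case (insert x F)
  then have "f x * prod f F \<in> P" by simp
  then show ?case using insert prime_setD(3)[of P "f x" "prod f F"] by auto
qed (auto simp: prime_set_def)

lemma span_insert_iff:
  "idl.subspace J \<Longrightarrow> s \<in> idl.span (insert x J) \<longleftrightarrow> (\<exists>c. s - c * x \<in> J)"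
  by (metis idl.span_breakdown_eq idl.span_eq_iff)

text \<open>The union of a chain is an ideal with finitely many generators, and one member of the
  chain already contains all of them; so the union is that member and Zorn's lemma applies.\<close>

lemma noeth_maximal:
  assumes "noeth TYPE('a::comm_ring_1)" and ne: "\<J> \<noteq> {}"
    and id: "\<And>J. J \<in> \<J> \<Longrightarrow> idl.subspace (J :: 'a set)"
  shows "\<exists>M\<in>\<J>. \<forall>G\<in>\<J>. M \<subseteq> G \<longrightarrow> G = M"
proof (rule subset_Zorn_nonempty[OF ne])
  fix C assume C: "C \<noteq> {}" "subset.chain \<J> C"
  have ch: "A \<subseteq> B \<or> B \<subseteq> A" if "A \<in> C" "B \<in> C" for A B
    using C(2) that by (auto simp: subset.chain_def)
  have CJ: "C \<subseteq> \<J>" using C(2) by (auto simp: subset.chain_def)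
  have "idl.subspace (\<Union>C)"
  proof (rule idl.subspaceI)
    show "0 \<in> \<Union>C" using C(1) CJ id idl.subspace_0 by blast
  next
    fix x y assume "x \<in> \<Union>C" "y \<in> \<Union>C"
    then obtain A B where "A \<in> C" "B \<in> C" "x \<in> A" "y \<in> B" by blast
    moreover from this ch have "A \<subseteq> B \<or> B \<subseteq> A" by blast
    ultimately show "x + y \<in> \<Union>C"
      by (meson CJ UnionI id idl.subspace_add subsetD)
  next
    fix c x assume "x \<in> \<Union>C"
    then show "c * x \<in> \<Union>C" by (meson CJ UnionE UnionI id idl.subspace_scale subsetD)
  qed
  then obtain G where G: "finite G" "\<Union>C = idl.span G"
    using assms(1) unfolding noeth_def by blast
  have "G \<subseteq> \<Union>C" using G(2) idl.span_superset by blast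
  from G(1) this have "\<exists>A\<in>C. G \<subseteq> A"
  proof (induction G rule: finite_induct)
    case empty then show ?case using C(1) by blast
  next
    case (insert x G)
    then obtain A B where "A \<in> C" "G \<subseteq> A" "B \<in> C" "x \<in> B" by blast
    then show ?case using ch[of A B] by blast
  qed
  then obtain A where A: "A \<in> C" "G \<subseteq> A" by blast
  then have "\<Union>C \<subseteq> A" using G(2) id CJ idl.span_minimal by blast
  then have "\<Union>C = A" using A by blast
  then show "\<Union>C \<in> \<J>" using A CJ by auto
qed

text \<open>An ideal maximal among those above \<open>J\<close> that miss \<open>T\<close> is prime:
  if \<open>a\<close> and \<open>b\<close> lie outside, both enlarged ideals meet \<open>T\<close>,
  and the product of the two elements found there would lie in \<open>P\<close> as soon as
  \<open>a * b\<close> does.\<close>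

lemma prime_avoiding_mult_set:
  assumes "noeth TYPE('a::comm_ring_1)" and J: "idl.subspace (J :: 'a set)"
    and T: "1 \<in> T" "\<And>a b. a \<in> T \<Longrightarrow> b \<in> T \<Longrightarrow> a * b \<in> T" and disj: "J \<inter> T = {}"
  obtains P where "prime_set P" "J \<subseteq> P" "P \<inter> T = {}"
proof -
  let ?\<J> = "{P. idl.subspace P \<and> J \<subseteq> P \<and> P \<inter> T = {}}"
  have "\<exists>P\<in>?\<J>. \<forall>G\<in>?\<J>. P \<subseteq> G \<longrightarrow> G = P"
    by (rule noeth_maximal[OF assms(1)]) (use J disj in auto)
  then obtain P where P0: "P \<in> ?\<J>" and mx0: "\<forall>G\<in>?\<J>. P \<subseteq> G \<longrightarrow> G = P" by (elim bexE)
  from P0 have P: "idl.subspace P" "J \<subseteq> P" "P \<inter> T = {}" by auto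
  have mx: "G = P" if "idl.subspace G" "G \<inter> T = {}" "P \<subseteq> G" for G
    using mx0 that P(2) by auto
  have hit: "\<exists>t c. t \<in> T \<and> t - c * a \<in> P" if "a \<notin> P" for a
  proof (rule ccontr)
    assume *: "\<nexists>t c. t \<in> T \<and> t - c * a \<in> P"
    have "idl.span (insert a P) \<inter> T = {}"
      using * span_insert_iff[OF P(1)] by blast
    then have "idl.span (insert a P) = P"
      by (intro mx) (use * span_insert_iff[OF P(1)] idl.span_superset[of "insert a P"] in auto)
    then show False using that idl.span_base by blast
  qed
  have "prime_set P" unfolding prime_set_def
  proof (intro conjI allI impI)
    show "idl.subspace P" by fact
    show "1 \<notin> P" using P(3) T(1) by blast
    fix a b assume ab: "a * b \<in> P"
    show "a \<in> P \<or> b \<in> P"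
    proof (rule ccontr)
      assume "\<not> (a \<in> P \<or> b \<in> P)"
      then obtain t c t' c' where t: "t \<in> T" "t - c * a \<in> P" "t' \<in> T" "t' - c' * b \<in> P"
        using hit by meson
      have "t * t' = t * (t' - c' * b) + c' * b * (t - c * a) + c * c' * (a * b)"
        by (simp add: algebra_simps)
      also have "\<dots> \<in> P" by (intro idl.subspace_add idl.subspace_scale P t ab)
      finally show False using T(2) t P(3) by blast
    qed
  qed
  then show ?thesis using that P by blast
qed

text \<open>Otherwise some prime above \<open>J\<close> misses all powers of \<open>x\<close>.
  Radicals are computed through this lemma throughout, so only primes have to be inspected.\<close>

lemma radical_via_primes:
  assumes "noeth TYPE('a::comm_ring_1)" and J: "idl.subspace (J :: 'a set)"
    and "\<And>P. prime_set P \<Longrightarrow> J \<subseteq> P \<Longrightarrow> x \<in> P"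
  shows "\<exists>k. x ^ k \<in> J"
proof (rule ccontr)
  assume *: "\<nexists>k. x ^ k \<in> J"
  obtain P where "prime_set P" "J \<subseteq> P" "P \<inter> range (\<lambda>k. x ^ k) = {}"
  proof (rule prime_avoiding_mult_set[OF assms(1) J, of "range (\<lambda>k. x ^ k)"])
    show "1 \<in> range (\<lambda>k. x ^ k)" by (metis power_0 rangeI)
    show "a * b \<in> range (\<lambda>k. x ^ k)" if "a \<in> range (\<lambda>k. x ^ k)" "b \<in> range (\<lambda>k. x ^ k)" for a b
      using that by (auto simp flip: power_add)
    show "J \<inter> range (\<lambda>k. x ^ k) = {}" using * by blast
  qed
  moreover from this assms(3) have "x \<in> P" by blast
  ultimately show False by (metis disjoint_iff power_one_right rangeI)
qed

lemma prime_avoidance: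
  assumes fin: "finite \<P>" and pr: "\<And>P. P \<in> \<P> \<Longrightarrow> prime_set P"
    and M: "idl.subspace (M :: 'a::comm_ring_1 set)" and n: "\<And>P. P \<in> \<P> \<Longrightarrow> \<not> M \<subseteq> P"
  shows "\<exists>z\<in>M. \<forall>P\<in>\<P>. z \<notin> P"
proof -
  have step: "\<exists>z\<in>M. \<forall>P\<in>\<Q>. z \<notin> P"
    if "finite \<Q>" "\<Q> \<subseteq> \<P>" "\<And>P Q. P \<in> \<Q> \<Longrightarrow> Q \<in> \<Q> \<Longrightarrow> P \<subseteq> Q \<Longrightarrow> P = Q" for \<Q>
    using that
  proof (induction \<Q> rule: finite_induct)
    case empty
    then show ?case using idl.subspace_0[OF M] by blast
  next
    case (insert Q \<Q>)
    obtain z where z: "z \<in> M" "\<forall>P\<in>\<Q>. z \<notin> P" using insert by blast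
    show ?case
    proof (cases "z \<in> Q")
      case False then show ?thesis using z by blast
    next
      case zQ: True
      have "\<exists>c. c \<in> P \<and> c \<notin> Q" if "P \<in> \<Q>" for P
        using insert.prems(2)[of P Q] insert.hyps that by blast
      then obtain c where c: "\<And>P. P \<in> \<Q> \<Longrightarrow> c P \<in> P \<and> c P \<notin> Q" by metis
      obtain m where m: "m \<in> M" "m \<notin> Q" using n[of Q] insert.prems(1) by blast
      \<comment> \<open>\<open>w\<close> lies in \<open>M\<close> and in every prime of
        \<open>\<Q>\<close>, but not in \<open>Q\<close>; adding it repairs \<open>z\<close> at
        \<open>Q\<close> and changes nothing at the other primes.\<close>
      define w where "w = m * (\<Prod>P\<in>\<Q>. c P)"
      have Qp: "prime_set Q" using pr insert.prems by blast
      have wQ: "w \<notin> Q"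
        unfolding w_def using prime_mult_notin[OF Qp m(2)] prime_prod[OF Qp insert.hyps(1), of c] c by blast
      have wM: "w \<in> M" unfolding w_def using ideal_mult(2)[OF M m(1)] .
      have "z + w \<notin> P" if "P \<in> \<Q>" for P
      proof -
        have P: "prime_set P" using that pr insert.prems by blast
        have "(\<Prod>P\<in>\<Q>. c P) = c P * (\<Prod>P\<in>\<Q> - {P}. c P)"
          using that insert.hyps(1) by (rule prod.remove[rotated])
        then have "w \<in> P"
          unfolding w_def using c[OF that] ideal_mult[OF prime_setD(1)[OF P]] by metis
        then show ?thesis using z(2) that idl.subspace_diff[OF prime_setD(1)[OF P], of "z + w" w] by auto
      qed
      moreover have "z + w \<notin> Q"
        using wQ zQ idl.subspace_diff[OF prime_setD(1)[OF Qp], of "z + w" z] by auto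
      moreover have "z + w \<in> M" using z wM M idl.subspace_add by blast
      ultimately show ?thesis by blast
    qed
  qed
  \<comment> \<open>The induction needs an antichain in order to find the elements \<open>c\<close>.
    Avoiding the maximal members avoids all the others.\<close>
  let ?Q = "{P \<in> \<P>. \<forall>Q\<in>\<P>. P \<subseteq> Q \<longrightarrow> Q = P}"
  have "\<exists>z\<in>M. \<forall>P\<in>?Q. z \<notin> P" by (rule step) (use fin in auto)
  moreover have "\<exists>Q\<in>?Q. P \<subseteq> Q" if inP: "P \<in> \<P>" for P
  proof -
    obtain Q where "Q \<in> \<P>" "P \<subseteq> Q" "\<forall>R\<in>\<P>. Q \<subseteq> R \<longrightarrow> R = Q"
      using finite_has_maximal2[OF fin inP] by metis
    then show ?thesis by blast
  qed
  ultimately show ?thesis by blast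
qed


section \<open>Localized ideals and depth\<close>

text \<open>
  The ideals of the localization at \<open>M\<close> are represented by their contractions, the ideals equal to
  their saturation.  In this encoding \<open>ext M J x\<close> is the ideal \<open>J + (x)\<close> of the localization, and
  \<open>dep M e J\<close> says that its quotient by \<open>J\<close> has depth at least \<open>e\<close>.
\<close>

definition sat :: "'a::comm_ring_1 set \<Rightarrow> 'a set \<Rightarrow> 'a set" where
  "sat M J = {s. \<exists>u. u \<notin> M \<and> u * s \<in> J}"

definition ext :: "'a::comm_ring_1 set \<Rightarrow> 'a set \<Rightarrow> 'a \<Rightarrow> 'a set" where
  "ext M J x = sat M (idl.span (insert x J))"

primrec dep :: "'a::comm_ring_1 set \<Rightarrow> nat \<Rightarrow> 'a set \<Rightarrow> bool" where
  "dep M 0 J = True"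
| "dep M (Suc e) J = (\<exists>x\<in>M. reg J x \<and> dep M e (ext M J x))"

locale at_prime =
  fixes M :: "'a::comm_ring_1 set"
  assumes noeth: "noeth TYPE('a)" and prime_M: "prime_set M"
begin

definition sid :: "'a set \<Rightarrow> bool" where
  "sid J \<longleftrightarrow> idl.subspace J \<and> (\<forall>u s. u \<notin> M \<longrightarrow> u * s \<in> J \<longrightarrow> s \<in> J)"

lemma one_notin: "1 \<notin> M" and ideal_M: "idl.subspace M"
  using prime_M by (auto simp: prime_set_def)

lemma notin_mult: "u \<notin> M \<Longrightarrow> v \<notin> M \<Longrightarrow> u * v \<notin> M"
  using prime_M by (rule prime_mult_notin)

text \<open>In the localization, a unit minus an element of the maximal ideal is a unit.\<close>

lemma notin_diff: "u \<notin> M \<Longrightarrow> x \<in> M \<Longrightarrow> u - c * x \<notin> M"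
  using idl.subspace_add[OF ideal_M, of "u - c * x" "c * x"] ideal_mult[OF ideal_M] by auto

lemma sidD: "sid J \<Longrightarrow> idl.subspace J" "sid J \<Longrightarrow> u \<notin> M \<Longrightarrow> u * s \<in> J \<Longrightarrow> s \<in> J"
  by (auto simp: sid_def)

lemma sat_superset: "J \<subseteq> sat M J"
  unfolding sat_def using one_notin by force

lemma ideal_sat:
  assumes J: "idl.subspace J" shows "idl.subspace (sat M J)"
proof (rule idl.subspaceI)
  show "0 \<in> sat M J" using sat_superset J idl.subspace_0 by blast
next
  fix x y assume "x \<in> sat M J" "y \<in> sat M J"
  then obtain u v where uv: "u \<notin> M" "v \<notin> M" "u * x \<in> J" "v * y \<in> J" by (auto simp: sat_def)
  have "(u * v) * (x + y) = v * (u * x) + u * (v * y)" by (simp add: algebra_simps)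
  also have "\<dots> \<in> J" by (intro idl.subspace_add idl.subspace_scale J uv)
  finally show "x + y \<in> sat M J" using notin_mult[OF uv(1,2)] by (auto simp: sat_def)
next
  fix c x assume "x \<in> sat M J"
  then obtain u where u: "u \<notin> M" "u * x \<in> J" by (auto simp: sat_def)
  then have "u * (c * x) \<in> J" using idl.subspace_scale[OF J u(2), of c] by (simp add: algebra_simps)
  then show "c * x \<in> sat M J" using u by (auto simp: sat_def)
qed

lemma sid_sat: assumes "idl.subspace J" shows "sid (sat M J)"
  unfolding sid_def
proof (intro conjI allI impI ideal_sat[OF assms])
  fix u s assume "u \<notin> M" "u * s \<in> sat M J"
  then obtain v where "v \<notin> M" "v * (u * s) \<in> J" by (auto simp: sat_def)
  then show "s \<in> sat M J" using notin_mult[of v u] \<open>u \<notin> M\<close>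
    unfolding sat_def by (auto simp: mult.assoc intro!: exI[of _ "v * u"])
qed

lemma sat_sid: "sid J \<Longrightarrow> sat M J = J"
  using sat_superset[of J] by (auto simp: sat_def sid_def)

lemma sat_mono: "J \<subseteq> K \<Longrightarrow> sat M J \<subseteq> sat M K"
  by (auto simp: sat_def)

lemma sid_ext: "sid (ext M J x)"
  unfolding ext_def by (rule sid_sat) simp

lemma ext_iff:
  "idl.subspace J \<Longrightarrow> s \<in> ext M J x \<longleftrightarrow> (\<exists>u c. u \<notin> M \<and> u * s - c * x \<in> J)"
  unfolding ext_def sat_def by (simp add: span_insert_iff)

lemma ext_superset: "J \<subseteq> ext M J x" "x \<in> ext M J x"
  unfolding ext_def using sat_superset[of "idl.span (insert x J)"] idl.span_superset[of "insert x J"] by auto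

lemma ext_least:
  assumes "sid K" "J \<subseteq> K" "x \<in> K" shows "ext M J x \<subseteq> K"
proof -
  have "idl.span (insert x J) \<subseteq> K" by (rule idl.span_minimal) (use assms sidD in auto)
  then show ?thesis unfolding ext_def using sat_mono sat_sid[OF assms(1)] by blast
qed

lemma ext_commute:
  "ext M (ext M J x) y = ext M (ext M J y) x"
proof -
  have "ext M (ext M J x) y \<subseteq> ext M (ext M J y) x" for x y
    by (intro ext_least sid_ext) (use ext_superset in blast)+
  then show ?thesis by blast
qed

lemma sid_sub_M: assumes "sid J" "1 \<notin> J" shows "J \<subseteq> M"
proof
  fix a assume "a \<in> J" then show "a \<in> M" using sidD(2)[OF assms(1), of a 1] assms(2) by auto
qed

text \<open>Nakayama's lemma for a mere subset \<open>N\<close>. Among the elements of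
  \<open>N\<close> outside \<open>J\<close> take \<open>h\<close> with \<open>ext M J h\<close>
  maximal. Up to a unit \<open>h\<close> is \<open>x * h'\<close>, so maximality makes
  \<open>h'\<close> a multiple \<open>c * h\<close> up to a unit, and then a unit of the form
  \<open>v * u - c * x\<close> sends \<open>h\<close> into \<open>J\<close>.\<close>

lemma nakayama:
  assumes J: "sid J" and x: "x \<in> M"
    and N: "\<And>h. h \<in> N \<Longrightarrow> \<exists>u\<in>-M. \<exists>h'\<in>N. u * h - x * h' \<in> J"
  shows "N \<subseteq> J"
proof (rule ccontr)
  assume "\<not> N \<subseteq> J"
  have "\<exists>K\<in>(\<lambda>h. ext M J h) ` (N - J). \<forall>G\<in>(\<lambda>h. ext M J h) ` (N - J). K \<subseteq> G \<longrightarrow> G = K"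
    by (rule noeth_maximal[OF noeth]) (use \<open>\<not> N \<subseteq> J\<close> sidD(1)[OF sid_ext] in auto)
  then obtain h where h: "h \<in> N" "h \<notin> J"
    and mx: "\<And>h'. h' \<in> N \<Longrightarrow> h' \<notin> J \<Longrightarrow> ext M J h \<subseteq> ext M J h' \<Longrightarrow> ext M J h' = ext M J h"
    by blast
  note Jid = sidD(1)[OF J]
  obtain u h' where u: "u \<notin> M" "h' \<in> N" "u * h - x * h' \<in> J" using N[OF h(1)] by blast
  have "h' \<notin> J"
  proof
    assume "h' \<in> J"
    then have "u * h - x * h' + x * h' \<in> J" by (intro idl.subspace_add idl.subspace_scale Jid u)
    then show False using sidD(2)[OF J u(1)] h(2) by simp
  qed
  have "h \<in> ext M J h'" using u ext_iff[OF Jid] by blast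
  then have "ext M J h \<subseteq> ext M J h'" by (intro ext_least sid_ext ext_superset)
  then have "h' \<in> ext M J h" using mx[OF u(2) \<open>h' \<notin> J\<close>] ext_superset by blast
  then obtain v c where v: "v \<notin> M" "v * h' - c * h \<in> J" using ext_iff[OF Jid] by blast
  have "(v * u - c * x) * h = v * (u * h - x * h') + x * (v * h' - c * h)" by (simp add: algebra_simps)
  also have "\<dots> \<in> J" by (intro idl.subspace_add idl.subspace_scale Jid u v)
  finally show False using sidD(2)[OF J notin_diff[OF notin_mult[OF v(1) u(1)] x]] h(2) by blast
qed

text \<open>In a local ring a regular sequence of length two may be permuted. Every element that
  \<open>z\<close> kills modulo \<open>J\<close> is, up to a unit, \<open>x\<close> times another
  such element, so \<open>nakayama\<close> removes them all; the second claim is a direct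
  computation.\<close>

lemma reg_swap:
  assumes J: "sid J" and xz: "x \<in> M" "z \<in> M" and x: "reg J x" and z: "reg (ext M J x) z"
  shows "reg J z" "reg (ext M J z) x"
proof -
  note Jid = sidD(1)[OF J]
  have "{s. z * s \<in> J} \<subseteq> J"
  proof (rule nakayama[OF J xz(1)])
    fix h assume "h \<in> {s. z * s \<in> J}"
    then have zh: "z * h \<in> J" by simp
    then have "h \<in> ext M J x" using z ext_superset(1) unfolding reg_def by blast
    then obtain u h' where u: "u \<notin> M" "u * h - h' * x \<in> J" using ext_iff[OF Jid] by blast
    have "x * (z * h') = u * (z * h) - z * (u * h - h' * x)" by (simp add: algebra_simps)
    also have "\<dots> \<in> J" by (intro idl.subspace_diff idl.subspace_scale Jid u zh)
    finally have "z * h' \<in> J" using x by (auto simp: reg_def)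
    then show "\<exists>u\<in>-M. \<exists>h'\<in>{s. z * s \<in> J}. u * h - x * h' \<in> J"
      using u mult.commute[of h' x] by (intro bexI[of _ u] bexI[of _ h']) auto
  qed
  then show "reg J z" by (auto simp: reg_def)
  show "reg (ext M J z) x" unfolding reg_def
  proof (intro allI impI)
    fix h assume "x * h \<in> ext M J z"
    then obtain u k where u: "u \<notin> M" "u * (x * h) - k * z \<in> J" using ext_iff[OF Jid] by blast
    have "1 * (z * k) - (u * h) * x = - (u * (x * h) - k * z)" by (simp add: algebra_simps)
    also have "\<dots> \<in> J" by (intro idl.subspace_neg Jid u)
    finally have "z * k \<in> ext M J x" using ext_iff[OF Jid] one_notin by blast
    then have "k \<in> ext M J x" using z by (auto simp: reg_def)
    then obtain v k' where v: "v \<notin> M" "v * k - k' * x \<in> J" using ext_iff[OF Jid] by blast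
    have "x * (v * u * h - k' * z) = v * (u * (x * h) - k * z) + z * (v * k - k' * x)"
      by (simp add: algebra_simps)
    also have "\<dots> \<in> J" by (intro idl.subspace_add idl.subspace_scale Jid u v)
    finally have "v * u * h - k' * z \<in> J" using x by (auto simp: reg_def)
    then show "h \<in> ext M J z" using ext_iff[OF Jid] notin_mult[OF v(1) u(1)] by blast
  qed
qed

text \<open>The vanishing of Hom(R/M, R/J): no nonzero class modulo \<open>J\<close> is killed by
  all of \<open>M\<close>. For Noetherian local rings this is positivity of the depth.\<close>

definition socle_free :: "'a set \<Rightarrow> bool" where
  "socle_free J \<longleftrightarrow> (\<forall>s. (\<forall>r\<in>M. r * s \<in> J) \<longrightarrow> s \<in> J)"

text \<open>If \<open>M\<close> kills \<open>s\<close> modulo \<open>(J, x)\<close>, then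
  \<open>y * s\<close> equals some \<open>c * x\<close> modulo \<open>J\<close>, up to a unit. The
  map from \<open>s\<close> to \<open>c\<close> carries socle elements modulo \<open>x\<close> to
  socle elements modulo \<open>y\<close>, and it is injective because \<open>x\<close> and
  \<open>y\<close> are both regular.\<close>

lemma socle_exchange:
  assumes J: "sid J" and xy: "x \<in> M" "y \<in> M" "reg J x" "reg J y" and sf: "socle_free (ext M J y)"
  shows "socle_free (ext M J x)"
proof (rule ccontr)
  assume "\<not> socle_free (ext M J x)"
  then obtain s where s: "s \<notin> ext M J x" "\<And>r. r \<in> M \<Longrightarrow> r * s \<in> ext M J x"
    by (auto simp: socle_free_def)
  note Jid = sidD(1)[OF J]
  obtain u c where u: "u \<notin> M" "u * (y * s) - c * x \<in> J" using s(2)[OF xy(2)] ext_iff[OF Jid] by blast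
  have "c \<notin> ext M J y"
  proof
    assume "c \<in> ext M J y"
    then obtain v w where v: "v \<notin> M" "v * c - w * y \<in> J" using ext_iff[OF Jid] by blast
    have "y * (v * u * s - w * x) = v * (u * (y * s) - c * x) + x * (v * c - w * y)"
      by (simp add: algebra_simps)
    also have "\<dots> \<in> J" by (intro idl.subspace_add idl.subspace_scale Jid u v)
    finally have "v * u * s - w * x \<in> J" using xy(4) by (auto simp: reg_def)
    then show False using s(1) ext_iff[OF Jid] notin_mult[OF v(1) u(1)] by blast
  qed
  moreover have "r * c \<in> ext M J y" if r: "r \<in> M" for r
  proof -
    obtain u' v where v: "u' \<notin> M" "u' * (r * s) - v * x \<in> J" using s(2)[OF r] ext_iff[OF Jid] by blast
    have "x * (u' * (r * c) - (u * v) * y) =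
        u * y * (u' * (r * s) - v * x) - (u' * r) * (u * (y * s) - c * x)"
      by (simp add: algebra_simps)
    also have "\<dots> \<in> J" by (intro idl.subspace_diff idl.subspace_scale Jid u v)
    finally have "u' * (r * c) - (u * v) * y \<in> J" using xy(3) by (auto simp: reg_def)
    then show ?thesis using ext_iff[OF Jid] v(1) by blast
  qed
  ultimately show False using sf by (auto simp: socle_free_def)
qed

section \<open>Annihilators and associated primes\<close>

definition ann :: "'a set \<Rightarrow> 'a \<Rightarrow> 'a set" where
  "ann J s = {a. a * s \<in> J}"

lemma ideal_ann: "idl.subspace J \<Longrightarrow> idl.subspace (ann J s)"
  by (rule idl.subspaceI)
     (auto simp: ann_def distrib_right mult.assoc idl.subspace_0 idl.subspace_add ideal_mult)

text \<open>If \<open>b * s\<close> is not in \<open>J\<close>, its annihilator contains that of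
  \<open>s\<close> and hence equals it; so an \<open>a\<close> with \<open>a * b * s \<in> J\<close>
  already kills \<open>s\<close>.\<close>

lemma max_ann_prime:
  assumes J: "idl.subspace J" and s: "s \<notin> J"
    and mx: "\<And>t. t \<notin> J \<Longrightarrow> ann J s \<subseteq> ann J t \<Longrightarrow> ann J t = ann J s"
  shows "prime_set (ann J s)"
  unfolding prime_set_def
proof (intro conjI allI impI ideal_ann[OF J])
  show "1 \<notin> ann J s" using s by (simp add: ann_def)
  fix a b assume ab: "a * b \<in> ann J s"
  show "a \<in> ann J s \<or> b \<in> ann J s"
  proof (rule disjCI)
    assume "b \<notin> ann J s"
    then have bs: "b * s \<notin> J" by (simp add: ann_def)
    have "ann J s \<subseteq> ann J (b * s)"
      using ideal_mult(1)[OF J, of _ b] by (auto simp: ann_def mult.left_commute[of _ b s])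
    from mx[OF bs this] ab show "a \<in> ann J s" by (auto simp: ann_def algebra_simps)
  qed
qed

lemma exists_max_ann:
  assumes J: "idl.subspace J" and s: "s \<notin> J"
  obtains t where "t \<notin> J" "ann J s \<subseteq> ann J t"
    "\<And>t'. t' \<notin> J \<Longrightarrow> ann J t \<subseteq> ann J t' \<Longrightarrow> ann J t' = ann J t"
proof -
  let ?\<J> = "ann J ` {t. t \<notin> J \<and> ann J s \<subseteq> ann J t}"
  have "\<exists>K\<in>?\<J>. \<forall>G\<in>?\<J>. K \<subseteq> G \<longrightarrow> G = K"
    by (rule noeth_maximal[OF noeth]) (use s ideal_ann[OF J] in auto)
  then obtain t where t: "t \<notin> J" "ann J s \<subseteq> ann J t"
    and mx: "\<And>t'. t' \<notin> J \<and> ann J s \<subseteq> ann J t' \<Longrightarrow> ann J t \<subseteq> ann J t' \<Longrightarrow> ann J t' = ann J t"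
    by auto
  show ?thesis by (rule that[OF t]) (use mx t in blast)
qed

text \<open>\<open>T\<close> collects the elements with maximal annihilator, so every zero divisor
  lies in a prime \<open>ann J t\<close> with \<open>t \<in> T\<close>. Finitely many
  \<open>B \<subseteq> T\<close> generate the ideal of \<open>T\<close>, and they account for all
  these primes. Socle freeness says that none of the primes contains \<open>M\<close>.\<close>

lemma zero_divisors_finite_union:
  assumes J: "sid J" and sf: "socle_free J"
  obtains \<P> where "finite \<P>" "\<And>P. P \<in> \<P> \<Longrightarrow> prime_set P \<and> \<not> M \<subseteq> P"
    "\<And>z. \<forall>P\<in>\<P>. z \<notin> P \<Longrightarrow> reg J z"
proof -
  note Jid = sidD(1)[OF J]
  define T where "T = {t. t \<notin> J \<and> (\<forall>t'. t' \<notin> J \<longrightarrow> ann J t \<subseteq> ann J t' \<longrightarrow> ann J t' = ann J t)}"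
  have "idl.subspace (idl.span T)" by simp
  then obtain G where G: "finite G" "idl.span T = idl.span G"
    using noeth unfolding noeth_def by blast
  have "\<exists>Y. finite Y \<and> Y \<subseteq> T \<and> x \<in> idl.span Y" if "x \<in> G" for x
  proof -
    have "x \<in> idl.span T" using G(2) that idl.span_base by blast
    then obtain Y r where "finite Y" "Y \<subseteq> T" "x = (\<Sum>a\<in>Y. r a * a)"
      unfolding idl.span_explicit by blast
    moreover from this have "x \<in> idl.span Y"
      by (auto intro!: idl.span_sum intro: idl.span_scale idl.span_base)
    ultimately show ?thesis by blast
  qed
  then obtain Y where Y: "\<And>x. x \<in> G \<Longrightarrow> finite (Y x) \<and> Y x \<subseteq> T \<and> x \<in> idl.span (Y x)" by metis
  define B where "B = (\<Union>x\<in>G. Y x)"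
  have B: "finite B" "B \<subseteq> T" using G(1) Y by (auto simp: B_def)
  have "G \<subseteq> idl.span B" using Y idl.span_mono[of _ B] unfolding B_def by blast
  then have spanB: "idl.span T \<subseteq> idl.span B" using G(2) by (metis idl.span_minimal idl.subspace_span)
  have primeT: "prime_set (ann J t)" if "t \<in> T" for t
    using max_ann_prime[OF Jid, of t] that by (auto simp: T_def)
  have inB: "ann J t \<in> ann J ` B" if t: "t \<in> T" for t
  proof -
    have "t \<in> idl.span B" using spanB t idl.span_base by blast
    \<comment> \<open>Otherwise choose for each \<open>b\<close> an element killing \<open>b\<close>
      but not \<open>t\<close>; their product kills all of \<open>B\<close>, hence \<open>t\<close>,
      against primality of \<open>ann J t\<close>. Maximality of \<open>ann J b\<close> then turns
      the inclusion into equality.\<close>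
    have "\<exists>b\<in>B. ann J b \<subseteq> ann J t"
    proof (rule ccontr)
      assume "\<not> (\<exists>b\<in>B. ann J b \<subseteq> ann J t)"
      then have "\<forall>b\<in>B. \<exists>c. c \<in> ann J b \<and> c \<notin> ann J t" by blast
      then obtain c where c: "\<And>b. b \<in> B \<Longrightarrow> c b \<in> ann J b \<and> c b \<notin> ann J t" by metis
      let ?p = "\<Prod>b\<in>B. c b"
      have "B \<subseteq> {s. ?p * s \<in> J}"
      proof safe
        fix b assume b: "b \<in> B"
        have "?p * b = (\<Prod>b\<in>B - {b}. c b) * (c b * b)"
          using prod.remove[OF B(1) b, of c] by (simp add: algebra_simps)
        moreover have "c b * b \<in> J" using c[OF b] by (simp add: ann_def)
        ultimately show "?p * b \<in> J" using ideal_mult(1)[OF Jid] by metis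
      qed
      moreover have "idl.subspace {s. ?p * s \<in> J}"
        using ideal_ann[OF Jid, of ?p] by (simp add: ann_def mult.commute)
      ultimately have "?p \<in> ann J t" using \<open>t \<in> idl.span B\<close> idl.span_minimal by (auto simp: ann_def)
      then show False using prime_prod[OF primeT[OF t] B(1), of c] c by blast
    qed
    then obtain b where b: "b \<in> B" "ann J b \<subseteq> ann J t" by blast
    moreover have "ann J t = ann J b" using b t B(2) by (auto simp: T_def)
    ultimately show ?thesis by blast
  qed
  show ?thesis
  proof (rule that[of "ann J ` B"])
    show "finite (ann J ` B)" using B by simp
    show "prime_set P \<and> \<not> M \<subseteq> P" if P: "P \<in> ann J ` B" for P
    proof -
      obtain b where b: "b \<in> B" "P = ann J b" using P by blast
      then have "b \<notin> J" using B(2) by (auto simp: T_def)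
      then have "\<not> M \<subseteq> P" using sf b(2) unfolding socle_free_def ann_def by blast
      then show ?thesis using primeT b B(2) by blast
    qed
    show "reg J z" if z: "\<forall>P\<in>ann J ` B. z \<notin> P" for z
      unfolding reg_def
    proof (intro allI impI, rule ccontr)
      fix s assume s: "z * s \<in> J" "s \<notin> J"
      obtain t where "t \<notin> J" and t: "ann J s \<subseteq> ann J t"
        and "\<And>t'. t' \<notin> J \<Longrightarrow> ann J t \<subseteq> ann J t' \<Longrightarrow> ann J t' = ann J t"
        using exists_max_ann[OF Jid s(2)] by metis
      then have "t \<in> T" unfolding T_def by simp
      have "z \<in> ann J t" using s t by (auto simp: ann_def)
      then show False using inB[OF \<open>t \<in> T\<close>] z by blast
    qed
  qed
qed

lemma common_regular:
  assumes "sid J" "socle_free J" "sid K" "socle_free K"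
  obtains z where "z \<in> M" "reg J z" "reg K z"
proof -
  obtain \<P> where P: "finite \<P>" "\<And>P. P \<in> \<P> \<Longrightarrow> prime_set P \<and> \<not> M \<subseteq> P"
    "\<And>z. \<forall>P\<in>\<P>. z \<notin> P \<Longrightarrow> reg J z" using zero_divisors_finite_union[OF assms(1,2)] by blast
  obtain \<Q> where Q: "finite \<Q>" "\<And>P. P \<in> \<Q> \<Longrightarrow> prime_set P \<and> \<not> M \<subseteq> P"
    "\<And>z. \<forall>P\<in>\<Q>. z \<notin> P \<Longrightarrow> reg K z" using zero_divisors_finite_union[OF assms(3,4)] by blast
  have "\<exists>z\<in>M. \<forall>P\<in>\<P> \<union> \<Q>. z \<notin> P"
    by (rule prime_avoidance) (use P Q ideal_M in auto)
  then show ?thesis using that P Q by blast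
qed

lemma reg_socle_free: "x \<in> M \<Longrightarrow> reg J x \<Longrightarrow> socle_free J"
  by (auto simp: reg_def socle_free_def)

lemma dep_socle_free: "dep M (Suc e) J \<Longrightarrow> socle_free J"
  using reg_socle_free by auto

text \<open>This makes \<open>dep\<close> independent of the first element: any regular
  \<open>x\<close> in \<open>M\<close> may start a sequence, not only the one provided by the
  definition.\<close>

lemma dep_ext:
  assumes "sid J" "dep M (Suc e) J" "x \<in> M" "reg J x"
  shows "dep M e (ext M J x)"
  using assms
proof (induction e arbitrary: J x)
  case 0
  then show ?case by simp
next
  case (Suc e)
  obtain h where h: "h \<in> M" "reg J h" "dep M (Suc e) (ext M J h)" using Suc.prems(2) by auto
  have "socle_free (ext M J h)" using h(3) dep_socle_free by blast
  moreover from this have "socle_free (ext M J x)"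
    using socle_exchange[OF Suc.prems(1,3) h(1) Suc.prems(4) h(2)] by blast
  \<comment> \<open>\<open>z\<close> links the given first element \<open>h\<close> with
    \<open>x\<close>: by \<open>reg_swap\<close> each of them can be placed after \<open>z\<close>,
    and modulo \<open>(J, z)\<close> they are compared by the induction hypothesis, at a depth lower
    by one.\<close>
  ultimately obtain z where z: "z \<in> M" "reg (ext M J h) z" "reg (ext M J x) z"
    using common_regular sid_ext by metis
  have 1: "dep M e (ext M (ext M J h) z)" using Suc.IH[OF sid_ext h(3) z(1,2)] .
  note sz = reg_swap[OF Suc.prems(1) h(1) z(1) h(2) z(2)]
  have 2: "dep M (Suc e) (ext M J z)"
    using 1 sz(2) h(1) ext_commute[of J h z] by auto
  note sx = reg_swap[OF Suc.prems(1,3) z(1) Suc.prems(4) z(3)]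
  have "dep M e (ext M (ext M J z) x)" using Suc.IH[OF sid_ext 2 Suc.prems(3) sx(2)] .
  then show ?case using z(1,3) ext_commute[of J x z] by auto
qed

section \<open>Depth and chains of primes\<close>

lemma dep_mono: "dep M (e + k) J \<Longrightarrow> dep M e J"
  by (induction e arbitrary: J) auto

lemma chain_cons:
  assumes "prime_chain Q e" "prime_set P" "P \<subset> Q 0"
  shows "prime_chain (case_nat P Q) (Suc e)"
  using assms by (auto simp: prime_chain_def split: nat.splits)

text \<open>Depth bounds the coheight of associated primes from below. Enlarge the annihilator of
  \<open>s\<close> to a prime \<open>P\<close>. Some \<open>h\<close> outside \<open>(J, x)\<close>
  is killed by \<open>P\<close> modulo \<open>J\<close>, so modulo \<open>(J, x)\<close> it is
  killed by \<open>P\<close> and \<open>x\<close>, and induction gives a chain above both. As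
  \<open>x\<close> is regular it is not in \<open>P\<close>, which therefore fits strictly below.
  The set \<open>A\<close> lets the induction carry \<open>P\<close> and \<open>x\<close>
  along.\<close>

lemma dep_assoc_chain:
  assumes "sid J" "dep M e J" "s \<notin> J" "\<And>a. a \<in> A \<Longrightarrow> a * s \<in> J"
  shows "\<exists>Q. prime_chain Q e \<and> A \<union> J \<subseteq> Q 0 \<and> Q e \<subseteq> M"
  using assms
proof (induction e arbitrary: J s A)
  case (0 J s A)
  obtain t where t: "t \<notin> J" "ann J s \<subseteq> ann J t" "prime_set (ann J t)"
    using exists_max_ann[OF sidD(1)[OF 0(1)] 0(3)] max_ann_prime[OF sidD(1)[OF 0(1)]] by metis
  have "ann J t \<subseteq> M" using sidD(2)[OF 0(1)] t(1) by (auto simp: ann_def)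
  moreover have "A \<union> J \<subseteq> ann J t"
    using t(2) 0(4) ideal_mult(2)[OF sidD(1)[OF 0(1)]] by (auto simp: ann_def)
  ultimately show ?case using t(3) by (intro exI[of _ "\<lambda>_. ann J t"]) (auto simp: prime_chain_def)
next
  case (Suc e J s A)
  note Jid = sidD(1)[OF Suc.prems(1)]
  obtain x where x: "x \<in> M" "reg J x" "dep M e (ext M J x)" using Suc.prems(2) by auto
  obtain t where t: "t \<notin> J" "ann J s \<subseteq> ann J t" "prime_set (ann J t)"
    using exists_max_ann[OF Jid Suc.prems(3)] max_ann_prime[OF Jid] by metis
  define P where "P = ann J t"
  define N where "N = {h. \<forall>p\<in>P. p * h \<in> J}"
  \<comment> \<open>If all of \<open>N\<close> were divisible by \<open>x\<close> modulo
    \<open>J\<close>, up to units, the quotients would again be killed by \<open>P\<close> because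
    \<open>x\<close> is regular; then \<open>nakayama\<close> would put \<open>t \<in> N\<close>
    into \<open>J\<close>.\<close>
  have "\<not> N \<subseteq> ext M J x"
  proof
    assume N: "N \<subseteq> ext M J x"
    have "N \<subseteq> J"
    proof (rule nakayama[OF Suc.prems(1) x(1)])
      fix h assume h: "h \<in> N"
      then obtain u h' where u: "u \<notin> M" "u * h - h' * x \<in> J" using N ext_iff[OF Jid] by blast
      have "h' \<in> N" unfolding N_def
      proof safe
        fix p assume p: "p \<in> P"
        have "x * (p * h') = u * (p * h) - p * (u * h - h' * x)" by (simp add: algebra_simps)
        also have "\<dots> \<in> J"
          using idl.subspace_diff[OF Jid ideal_mult(1)[OF Jid, of "p * h" u] ideal_mult(1)[OF Jid u(2), of p]]
            h p by (auto simp: N_def)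
        finally show "p * h' \<in> J" using x(2) by (auto simp: reg_def)
      qed
      then show "\<exists>u\<in>-M. \<exists>h'\<in>N. u * h - x * h' \<in> J"
        using u mult.commute[of h' x] by (intro bexI[of _ u] bexI[of _ h']) auto
    qed
    moreover have "t \<in> N" by (auto simp: N_def P_def ann_def)
    ultimately show False using t(1) by blast
  qed
  then obtain h where h: "h \<in> N" "h \<notin> ext M J x" by blast
  have "a * h \<in> ext M J x" if "a \<in> insert x P" for a
    using that h(1) ext_superset(1)[of J x] ideal_mult(2)[OF sidD(1)[OF sid_ext] ext_superset(2)]
    by (auto simp: N_def)
  from Suc.IH[OF sid_ext x(3) h(2) this] obtain Q where
    Q: "prime_chain Q e" "insert x P \<union> ext M J x \<subseteq> Q 0" "Q e \<subseteq> M" by blast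
  have "x \<notin> P" using x(2) t(1) by (auto simp: P_def ann_def reg_def)
  then have "prime_chain (case_nat P Q) (Suc e)" using chain_cons[OF Q(1)] t(3) Q(2) unfolding P_def by blast
  moreover have "A \<union> J \<subseteq> P"
    using t(2) Suc.prems(4) ideal_mult(2)[OF Jid] by (auto simp: P_def ann_def)
  ultimately show ?case using Q(3) by (intro exI[of _ "case_nat P Q"]) auto
qed

lemma sid_reg_proper:
  assumes "sid J" "1 \<notin> J" "x \<in> M" shows "1 \<notin> ext M J x"
proof
  assume "1 \<in> ext M J x"
  then obtain u c where u: "u \<notin> M" "u * 1 - c * x \<in> J" using ext_iff[OF sidD(1)[OF assms(1)]] by blast
  then have "u - c * x \<in> M" using sid_sub_M[OF assms(1,2)] by auto
  then show False using notin_diff[OF u(1) assms(3)] by blast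
qed

text \<open>Regularity of \<open>x\<close> keeps \<open>J\<close> disjoint from the products
  \<open>s * x ^ k\<close> with \<open>s\<close> outside \<open>Q\<close>. A prime above
  \<open>J\<close> that misses these products lies inside \<open>Q\<close> and does not contain
  \<open>x\<close>.\<close>

lemma reg_descend_prime:
  assumes J: "idl.subspace (J :: 'a set)" and x: "reg J x" and Q: "prime_set Q" "J \<subseteq> Q" "x \<in> Q"
  obtains P where "prime_set P" "J \<subseteq> P" "P \<subset> Q"
proof -
  define T where "T = {s * x ^ k | s k. s \<notin> Q}"
  have regp: "s \<in> J" if "s * x ^ k \<in> J" for s k
    using that
  proof (induction k)
    case (Suc k)
    have "x * (s * x ^ k) \<in> J" using Suc.prems by (simp add: algebra_simps)
    then show ?case using Suc.IH x by (auto simp: reg_def)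
  qed simp
  obtain P where P: "prime_set P" "J \<subseteq> P" "P \<inter> T = {}"
  proof (rule prime_avoiding_mult_set[OF noeth J, of T])
    have "1 = 1 * x ^ 0" by simp
    then show "1 \<in> T" unfolding T_def using prime_setD(2)[OF Q(1)] by blast
    show "a * b \<in> T" if ab: "a \<in> T" "b \<in> T" for a b
    proof -
      obtain s k s' k' where "a = s * x ^ k" "b = s' * x ^ k'" "s \<notin> Q" "s' \<notin> Q"
        using ab by (auto simp: T_def)
      then have "a * b = (s * s') * x ^ (k + k') \<and> s * s' \<notin> Q"
        using prime_mult_notin[OF Q(1)] by (auto simp: power_add algebra_simps)
      then show ?thesis unfolding T_def by blast
    qed
    show "J \<inter> T = {}" unfolding T_def using regp Q(2) by blast
  qed
  have "y = y * x ^ 0" "x = 1 * x ^ 1" for y by simp_all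
  then have "y \<in> T" if "y \<notin> Q" for y unfolding T_def using that by blast
  moreover have "x \<in> T" unfolding T_def using prime_setD(2)[OF Q(1)] \<open>x = 1 * x ^ 1\<close> by blast
  ultimately have "P \<subset> Q" using P(3) Q(3) by blast
  then show ?thesis using that P by blast
qed

text \<open>\<open>reg_descend_prime\<close> makes room for one more prime below the chain found
  modulo \<open>x\<close>. Properness matters: modulo the unit ideal every element is
  regular.\<close>

lemma dep_le_dim:
  assumes "sid J" "1 \<notin> J" "dep M e J"
  shows "\<exists>Q. prime_chain Q e \<and> J \<subseteq> Q 0 \<and> Q e \<subseteq> M"
  using assms
proof (induction e arbitrary: J)
  case 0
  then show ?case
    using sid_sub_M[OF 0(1,2)] prime_M by (intro exI[of _ "\<lambda>_. M"]) (auto simp: prime_chain_def)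
next
  case (Suc e)
  obtain x where x: "x \<in> M" "reg J x" "dep M e (ext M J x)" using Suc.prems(3) by auto
  obtain Q where Q: "prime_chain Q e" "ext M J x \<subseteq> Q 0" "Q e \<subseteq> M"
    using Suc.IH[OF sid_ext sid_reg_proper[OF Suc.prems(1,2) x(1)] x(3)] by blast
  have "prime_set (Q 0)" using Q(1) by (auto simp: prime_chain_def)
  moreover have "J \<subseteq> Q 0" "x \<in> Q 0" using Q(2) ext_superset(1)[of J x] ext_superset(2)[of x J] by auto
  ultimately obtain P where "prime_set P" "J \<subseteq> P" "P \<subset> Q 0"
    by (rule reg_descend_prime[OF sidD(1)[OF Suc.prems(1)] x(2)])
  then show ?case using Q chain_cons[OF Q(1)] by (intro exI[of _ "case_nat P Q"]) auto
qed

end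

section \<open>Polynomials: degrees and homogeneous components\<close>

abbreviation "lookup \<equiv> Poly_Mapping.lookup"
abbreviation "keys \<equiv> Poly_Mapping.keys"

definition mdeg :: "('n::finite \<Rightarrow>\<^sub>0 nat) \<Rightarrow> nat" where
  "mdeg m = (\<Sum>j\<in>UNIV. lookup m j)"

lemma mdeg_add: "mdeg (a + b) = mdeg a + mdeg b"
  by (simp add: mdeg_def lookup_add sum.distrib)

lemma mdeg_zero [simp]: "mdeg 0 = 0"
  by (simp add: mdeg_def)

lemma mdeg_eq_0: "mdeg m = 0 \<longleftrightarrow> m = 0"
  by (auto simp: mdeg_def poly_mapping_eq_iff fun_eq_iff)

lemma mdeg_single [simp]: "mdeg (Poly_Mapping.single j k) = k"
  by (simp add: mdeg_def lookup_single when_def)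

lemma lookup_le_mdeg: "lookup m j \<le> mdeg m"
  unfolding mdeg_def by (rule member_le_sum) auto

lemma const_simps [simp]: "const 0 = 0" "const 1 = 1"
  by (simp_all add: const_def)

lemma const_add: "const (a + b) = const a + const b"
  by (simp add: const_def single_add)

lemma const_diff: "const (a - b) = const a - const b"
  by (simp add: const_def single_diff)

lemma const_mult: "const (a * b) = const a * const b"
  by (simp add: const_def mult_single)

lemma const_power: "const (a ^ k) = const a ^ k"
  by (induction k) (simp_all add: const_mult)

lemma const_inverse: "c \<noteq> 0 \<Longrightarrow> const (inverse c) * const c = 1"
  by (simp flip: const_mult)

lemma const_eq_0: "const c = 0 \<longleftrightarrow> c = 0"
  by (metis const_def lookup_single_eq lookup_zero single_zero)

lemma const_monomial: "const c * monomial m = Poly_Mapping.single m c"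
  by (simp add: const_def monomial_def mult_single)

lemma monomial_add: "monomial (a + b) = monomial a * monomial b"
  by (simp add: monomial_def mult_single)

lemma monomial_0 [simp]: "monomial 0 = 1"
  by (simp add: monomial_def)

lemma keys_monomial [simp]: "keys (monomial m :: ('n, 'k::field) mpoly) = {m}"
  by (simp add: monomial_def)

lemma poly_expand: "p = (\<Sum>m\<in>keys p. const (lookup p m) * monomial m)"
  for p :: "('n, 'k::field) mpoly"
  by (rule poly_mapping_eqI)
     (simp add: lookup_sum const_monomial lookup_single when_def in_keys_iff)

lemma prime_const: "prime_set P \<Longrightarrow> const c \<in> P \<Longrightarrow> c = 0"
  by (metis const_inverse ideal_mult(1) prime_setD(1,2))

lemma monomial_var_split:
  assumes "lookup m j > 0"
  shows "monomial m = (monomial (m - Poly_Mapping.single j 1) * var j :: ('n, 'k::field) mpoly)"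
proof -
  have "m = (m - Poly_Mapping.single j 1) + Poly_Mapping.single j 1"
    by (rule poly_mapping_eqI) (use assms in \<open>auto simp: lookup_add lookup_minus lookup_single when_def\<close>)
  then show ?thesis unfolding var_def by (metis monomial_add)
qed

lemma monomial_in_prime:
  assumes P: "prime_set P" and m: "monomial m \<in> P"
  shows "\<exists>j\<in>keys m. var j \<in> (P :: ('n::finite, 'k::field) mpoly set)"
  using m
proof (induction "mdeg m" arbitrary: m rule: less_induct)
  case (less m)
  show ?case
  proof (cases "m = 0")
    case True
    then show ?thesis using less.prems prime_setD(2)[OF P] by simp
  next
    case False
    then obtain j where j: "lookup m j > 0"
      by (metis bot_nat_0.not_eq_extremum lookup_zero poly_mapping_eqI)
    define m' where "m' = m - Poly_Mapping.single j 1"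
    have mm: "m = m' + Poly_Mapping.single j 1" unfolding m'_def
      by (rule poly_mapping_eqI) (use j in \<open>auto simp: lookup_add lookup_minus lookup_single when_def\<close>)
    have "mdeg m' < mdeg m" by (simp add: mm mdeg_add)
    moreover have "monomial m' \<in> P \<or> var j \<in> P"
      using less.prems monomial_var_split[OF j] prime_setD(3)[OF P] by (metis m'_def)
    moreover have "keys m' \<subseteq> keys m" by (auto simp: in_keys_iff mm lookup_add)
    ultimately show ?thesis using less.hyps[of m'] j by (auto simp: in_keys_iff)
  qed
qed

definition hcomp :: "nat \<Rightarrow> ('n::finite, 'k::field) mpoly \<Rightarrow> ('n, 'k) mpoly" where
  "hcomp t p = Poly_Mapping.mapp (\<lambda>m c. c when mdeg m = t) p"

text \<open>Degree strictly below \<open>t\<close>: with the strict bound, \<open>t = 0\<close>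
  singles out the zero polynomial and serves as the base of inductions on the degree.\<close>

definition dlt :: "nat \<Rightarrow> ('n::finite, 'k::field) mpoly \<Rightarrow> bool" where
  "dlt t p \<longleftrightarrow> (\<forall>m\<in>keys p. mdeg m < t)"

lemma lookup_hcomp: "lookup (hcomp t p) m = (if mdeg m = t then lookup p m else 0)"
  by (simp add: hcomp_def lookup_mapp when_def in_keys_iff)

lemma homogeneous_iff: "homogeneous e p \<longleftrightarrow> (\<forall>m\<in>keys p. mdeg m = e)"
  by (simp add: homogeneous_def mdeg_def)

lemma hcomp_add: "hcomp t (p + q) = hcomp t p + hcomp t q"
  by (rule poly_mapping_eqI) (simp add: lookup_hcomp lookup_add)

lemma hcomp_diff: "hcomp t (p - q) = hcomp t p - hcomp t q"
  by (rule poly_mapping_eqI) (simp add: lookup_hcomp lookup_minus)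

lemma hcomp_zero [simp]: "hcomp t 0 = 0"
  by (rule poly_mapping_eqI) (simp add: lookup_hcomp)

lemma hcomp_sum: "hcomp t (sum f A) = (\<Sum>a\<in>A. hcomp t (f a))"
  by (induction A rule: infinite_finite_induct) (auto simp: hcomp_add)

lemma homogeneous_hcomp: "homogeneous t (hcomp t p)"
  by (auto simp: homogeneous_iff in_keys_iff lookup_hcomp split: if_splits)

lemma hcomp_homogeneous: "homogeneous e p \<Longrightarrow> hcomp t p = (if t = e then p else 0)"
  by (rule poly_mapping_eqI) (auto simp: homogeneous_iff in_keys_iff lookup_hcomp)

lemma homogeneous_mult: "homogeneous a p \<Longrightarrow> homogeneous b q \<Longrightarrow> homogeneous (a + b) (p * q)"
  using keys_mult[of p q] by (fastforce simp: homogeneous_iff mdeg_add)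

lemma homogeneous_one: "homogeneous 0 1"
  by (simp add: homogeneous_iff)

lemma homogeneous_power: "homogeneous e p \<Longrightarrow> homogeneous (k * e) (p ^ k)"
  by (induction k) (auto simp: homogeneous_one homogeneous_mult)

lemma homogeneous_monomial: "homogeneous (mdeg m) (monomial m)"
  by (simp add: homogeneous_iff)

lemma homogeneous_var: "homogeneous 1 (var j)"
  by (metis homogeneous_monomial mdeg_single var_def)

lemma homogeneous_const: "homogeneous 0 (const c)"
  by (auto simp: homogeneous_iff const_def)

lemma homogeneous_add: "homogeneous e p \<Longrightarrow> homogeneous e q \<Longrightarrow> homogeneous e (p + q)"
  using keys_add[of p q] by (fastforce simp: homogeneous_iff)

lemma homogeneous_sum: "(\<And>a. a \<in> A \<Longrightarrow> homogeneous e (f a)) \<Longrightarrow> homogeneous e (sum f A)"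
proof (induction A rule: infinite_finite_induct)
  case (insert x F)
  then show ?case using homogeneous_add[of e "f x" "sum f F"] by simp
qed (simp_all add: homogeneous_iff)

lemma dlt_exists: "\<exists>t. dlt t p"
proof -
  have "finite (mdeg ` keys p)" by simp
  then obtain t where "\<forall>x\<in>mdeg ` keys p. x < t" using finite_nat_set_iff_bounded by blast
  then show ?thesis by (auto simp: dlt_def)
qed

lemma dlt_mono: "dlt s p \<Longrightarrow> s \<le> t \<Longrightarrow> dlt t p"
  by (auto simp: dlt_def)

lemma dlt_zero [simp]: "dlt t 0"
  by (simp add: dlt_def)

lemma dlt_0_iff: "dlt 0 p \<longleftrightarrow> p = 0"
  by (auto simp: dlt_def)

lemma dlt_add: "dlt t p \<Longrightarrow> dlt t q \<Longrightarrow> dlt t (p + q)"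
  using keys_add[of p q] by (fastforce simp: dlt_def)

lemma dlt_uminus: "dlt t p \<Longrightarrow> dlt t (- p)"
  by (auto simp: dlt_def in_keys_iff)

lemma dlt_diff: "dlt t p \<Longrightarrow> dlt t q \<Longrightarrow> dlt t (p - q)"
  using dlt_add[OF _ dlt_uminus, of t p q] by simp

lemma dlt_sum: "(\<And>a. a \<in> A \<Longrightarrow> dlt t (f a)) \<Longrightarrow> dlt t (sum f A)"
  by (induction A rule: infinite_finite_induct) (auto simp: dlt_add)

lemma dlt_mult: "dlt (Suc s) p \<Longrightarrow> dlt t q \<Longrightarrow> dlt (s + t) (p * q)"
  using keys_mult[of p q] by (fastforce simp: dlt_def mdeg_add)

lemma dlt_homogeneous: "homogeneous e p \<Longrightarrow> dlt (Suc e) p"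
  by (auto simp: homogeneous_iff dlt_def)

lemma dlt_Suc_iff: "dlt (Suc t) p \<and> hcomp t p = 0 \<longleftrightarrow> dlt t p"
proof
  assume *: "dlt (Suc t) p \<and> hcomp t p = 0"
  show "dlt t p" unfolding dlt_def
  proof
    fix m assume m: "m \<in> keys p"
    then have "lookup (hcomp t p) m = 0" "lookup p m \<noteq> 0" "mdeg m < Suc t"
      using * by (auto simp: dlt_def in_keys_iff)
    then show "mdeg m < t" by (auto simp: lookup_hcomp split: if_splits)
  qed
next
  assume "dlt t p"
  then show "dlt (Suc t) p \<and> hcomp t p = 0"
    by (auto simp: dlt_def lookup_hcomp in_keys_iff intro!: poly_mapping_eqI)
qed

lemma hcomp_dlt: "dlt s p \<Longrightarrow> s \<le> t \<Longrightarrow> hcomp t p = 0"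
  using dlt_Suc_iff dlt_mono by metis

lemma sum_hcomp:
  assumes "dlt t p" shows "p = (\<Sum>s<t. hcomp s p)"
  by (rule poly_mapping_eqI) (use assms in \<open>auto simp: lookup_sum lookup_hcomp dlt_def in_keys_iff\<close>)

lemma hcomp_mult_homogeneous:
  assumes "homogeneous e x"
  shows "hcomp t (p * x) = (if e \<le> t then hcomp (t - e) p * x else 0)"
proof -
  obtain N where N: "dlt N p" using dlt_exists by blast
  \<comment> \<open>The bound also exceeds \<open>t\<close>, so that the index \<open>t - e\<close>
    occurs in the sum.\<close>
  define N' where "N' = max N (Suc t)"
  have "dlt N' p" using dlt_mono[OF N, of N'] by (simp add: N'_def)
  then have "p * x = (\<Sum>s<N'. hcomp s p * x)" using sum_hcomp[of N' p] by (metis sum_distrib_right)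
  then have "hcomp t (p * x) = (\<Sum>s<N'. hcomp t (hcomp s p * x))" by (simp add: hcomp_sum)
  also have "\<dots> = (\<Sum>s<N'. if t = s + e then hcomp s p * x else 0)"
    by (intro sum.cong refl hcomp_homogeneous homogeneous_mult homogeneous_hcomp assms)
  also have "\<dots> = (\<Sum>s<N'. if s = t - e then if e \<le> t then hcomp s p * x else 0 else 0)"
    by (intro sum.cong) auto
  also have "\<dots> = (if e \<le> t then hcomp (t - e) p * x else 0)" by (auto simp: N'_def)
  finally show ?thesis .
qed

lemma hcomp_mult: "hcomp t (p * q) = (\<Sum>i\<le>t. hcomp i p * hcomp (t - i) q)"
proof -
  obtain N where N: "dlt N p" using dlt_exists by blast
  define N' where "N' = max N (Suc t)"
  have "dlt N' p" using dlt_mono[OF N, of N'] by (simp add: N'_def)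
  then have "p * q = (\<Sum>s<N'. hcomp s p * q)" using sum_hcomp[of N' p] by (metis sum_distrib_right)
  then have "hcomp t (p * q) = (\<Sum>s<N'. hcomp t (q * hcomp s p))" by (simp add: hcomp_sum mult.commute)
  also have "\<dots> = (\<Sum>s<N'. if s \<le> t then hcomp (t - s) q * hcomp s p else 0)"
    by (intro sum.cong refl hcomp_mult_homogeneous homogeneous_hcomp)
  also have "\<dots> = (\<Sum>s\<le>t. hcomp (t - s) q * hcomp s p)"
    by (intro sum.mono_neutral_cong_right) (auto simp: N'_def)
  finally show ?thesis by (simp add: mult.commute)
qed

section \<open>Homogeneous ideals and the irrelevant ideal\<close>

definition hideal :: "('n::finite, 'k::field) mpoly set \<Rightarrow> bool" where
  "hideal J \<longleftrightarrow> idl.subspace J \<and> (\<forall>p\<in>J. \<forall>t. hcomp t p \<in> J)"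

lemma hideal_insert:
  assumes J: "hideal J" and x: "homogeneous e x"
  shows "hideal (idl.span (insert x J))"
  unfolding hideal_def
proof (intro conjI ballI allI)
  have Jid: "idl.subspace J" using J by (simp add: hideal_def)
  fix p t assume "p \<in> idl.span (insert x J)"
  then obtain c where "p - c * x \<in> J" using span_insert_iff[OF Jid] by blast
  then have "hcomp t p - hcomp t (c * x) \<in> J" using J by (auto simp: hideal_def hcomp_diff[symmetric])
  then have "hcomp t p - (if e \<le> t then hcomp (t - e) c else 0) * x \<in> J"
    by (simp add: hcomp_mult_homogeneous[OF x] split: if_splits)
  then show "hcomp t p \<in> idl.span (insert x J)" using span_insert_iff[OF Jid] by blast
qed simp

lemma hideal_span:
  assumes "\<And>x. x \<in> A \<Longrightarrow> \<exists>e. homogeneous e x"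
  shows "hideal (idl.span A)"
  unfolding hideal_def
proof (intro conjI ballI allI)
  fix p t assume "p \<in> idl.span A"
  then show "hcomp t p \<in> idl.span A"
  proof (induction rule: idl.span_induct_alt)
    case base
    then show ?case by (simp add: idl.span_zero)
  next
    case (step c x y)
    obtain e where "homogeneous e x" using assms step.hyps by blast
    then have "hcomp t (c * x) \<in> idl.span A"
      by (auto simp: hcomp_mult_homogeneous idl.span_zero intro: idl.span_scale idl.span_base step.hyps)
    then show ?case using step.IH by (simp add: hcomp_add idl.span_add)
  qed
qed simp

text \<open>Given by the vanishing of the constant term, from which primality and maximality are
  immediate; \<open>mm_eq_span\<close> identifies it with the irrelevant ideal.\<close>

definition mm :: "('n::finite, 'k::field) mpoly set" where
  "mm = {p. lookup p 0 = 0}"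

lemma hcomp_0: "hcomp 0 p = const (lookup p 0)"
  by (rule poly_mapping_eqI) (auto simp: lookup_hcomp const_def lookup_single when_def mdeg_eq_0)

lemma lookup_mult_0: "lookup (p * q) 0 = lookup p 0 * lookup q 0"
  for p q :: "('n::finite, 'k::field) mpoly"
proof -
  have "(const (lookup (p * q) 0) :: ('n, 'k) mpoly) = const (lookup p 0 * lookup q 0)"
    using hcomp_mult[of 0 p q] by (simp add: hcomp_0 const_mult)
  then have "(const (lookup (p * q) 0 - lookup p 0 * lookup q 0) :: ('n, 'k) mpoly) = 0" by (simp add: const_diff)
  then show ?thesis by (simp add: const_eq_0)
qed

lemma prime_mm: "prime_set (mm :: ('n::finite, 'k::field) mpoly set)"
  unfolding prime_set_def mm_def
  by (auto simp: lookup_mult_0 lookup_add lookup_one intro!: idl.subspaceI)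

lemma mm_eq_span: "mm = idl.span (range var)"
proof
  show "idl.span (range var) \<subseteq> (mm :: ('n::finite, 'k::field) mpoly set)"
  proof (rule idl.span_minimal)
    show "range var \<subseteq> (mm :: ('n::finite, 'k::field) mpoly set)"
    proof clarify
      fix j :: 'n
      have "Poly_Mapping.single j (1::nat) \<noteq> 0" by (metis lookup_single_eq lookup_zero one_neq_zero)
      then show "var j \<in> mm" by (simp add: mm_def var_def monomial_def lookup_single when_def)
    qed
  qed (rule prime_setD(1)[OF prime_mm])
  show "(mm :: ('n::finite, 'k::field) mpoly set) \<subseteq> idl.span (range var)"
  proof
    fix p :: "('n::finite, 'k::field) mpoly" assume p: "p \<in> mm"
    have "const (lookup p m) * monomial m \<in> idl.span (range var)" if "m \<in> keys p" for m
    proof -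
      have "m \<noteq> 0" using that p by (auto simp: mm_def in_keys_iff)
      then obtain j where "lookup m j > 0" by (metis bot_nat_0.not_eq_extremum lookup_zero poly_mapping_eqI)
      then have "monomial m = (monomial (m - Poly_Mapping.single j 1) * var j :: ('n, 'k) mpoly)"
        by (rule monomial_var_split)
      then show ?thesis by (metis idl.span_base idl.span_scale rangeI)
    qed
    then have "(\<Sum>m\<in>keys p. const (lookup p m) * monomial m) \<in> idl.span (range var)"
      by (rule idl.span_sum)
    then show "p \<in> idl.span (range var)" using poly_expand[of p] by simp
  qed
qed

lemma var_in_mm: "var j \<in> mm"
  by (simp add: mm_eq_span idl.span_base)

lemma homogeneous_in_mm: "homogeneous e p \<Longrightarrow> e > 0 \<Longrightarrow> p \<in> mm"
  for p :: "('n::finite, 'k::field) mpoly"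
proof -
  assume h: "homogeneous e p" "e > 0"
  have "0 \<notin> keys p" using h unfolding homogeneous_iff by fastforce
  then show "p \<in> mm" by (simp add: mm_def in_keys_iff)
qed

text \<open>A denominator \<open>u\<close> has a nonzero constant term, so the components of
  \<open>s\<close> can be recovered from those of \<open>u * s\<close> in increasing degree. Hence
  at \<open>mm\<close> homogeneous ideals need no saturation.\<close>

lemma sat_hideal:
  assumes J: "hideal J" shows "sat mm J = J"
proof
  have Jid: "idl.subspace J" using J by (simp add: hideal_def)
  show "J \<subseteq> sat mm J" unfolding sat_def using prime_setD(2)[OF prime_mm] by force
  show "sat mm J \<subseteq> J"
  proof
    fix s assume "s \<in> sat mm J"
    then obtain u where u: "u \<notin> mm" "u * s \<in> J" by (auto simp: sat_def)
    define c where "c = lookup u 0"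
    have c: "c \<noteq> 0" using u(1) by (auto simp: mm_def c_def)
    have "hcomp t s \<in> J" for t
    proof (induction t rule: less_induct)
      case (less t)
      have "hcomp t (u * s) \<in> J" using u(2) J by (auto simp: hideal_def)
      moreover have "hcomp t (u * s) = const c * hcomp t s + (\<Sum>i\<in>{1..t}. hcomp i u * hcomp (t - i) s)"
        by (simp add: hcomp_mult atMost_atLeast0 sum.atLeast_Suc_atMost hcomp_0 c_def)
      moreover have "(\<Sum>i\<in>{1..t}. hcomp i u * hcomp (t - i) s) \<in> J"
        by (intro idl.subspace_sum Jid ideal_mult(1) less.IH) auto
      ultimately have "const c * hcomp t s \<in> J"
        using idl.subspace_diff[OF Jid, of "hcomp t (u * s)" "\<Sum>i\<in>{1..t}. hcomp i u * hcomp (t - i) s"] by simp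
      then have "const (inverse c) * (const c * hcomp t s) \<in> J" by (rule ideal_mult(1)[OF Jid])
      then show ?case by (simp add: mult.assoc[symmetric] const_inverse[OF c])
    qed
    moreover obtain N where "dlt N s" using dlt_exists by blast
    ultimately show "s \<in> J" using sum_hcomp[of N s] idl.subspace_sum[OF Jid, of "{..<N}" "\<lambda>i. hcomp i s"] by simp
  qed
qed


section \<open>Regular sequences and leading forms\<close>

primrec rseq :: "'a::comm_ring_1 set \<Rightarrow> 'a list \<Rightarrow> bool" where
  "rseq J [] = True"
| "rseq J (x # xs) = (reg J x \<and> rseq (idl.span (insert x J)) xs)"

text \<open>\<open>J0\<close> is the ideal of leading forms (components of top degree) of the elements of \<open>J\<close>.\<close>

definition toprel :: "('n::finite, 'k::field) mpoly set \<Rightarrow> ('n, 'k) mpoly set \<Rightarrow> bool" where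
  "toprel J J0 \<longleftrightarrow> idl.subspace J \<and> hideal J0 \<and>
     (\<forall>t. \<forall>g\<in>J. dlt (Suc t) g \<longrightarrow> hcomp t g \<in> J0) \<and>
     (\<forall>t. \<forall>g0\<in>J0. \<exists>g\<in>J. dlt (Suc t) g \<and> hcomp t g = hcomp t g0)"

lemma toprel_refl: assumes "hideal J" shows "toprel J J"
  unfolding toprel_def
proof (intro conjI allI ballI impI)
  fix t g0 assume "g0 \<in> J"
  then show "\<exists>g\<in>J. dlt (Suc t) g \<and> hcomp t g = hcomp t g0"
    using assms by (intro bexI[of _ "hcomp t g0"])
      (auto simp: hideal_def dlt_homogeneous homogeneous_hcomp hcomp_homogeneous[OF homogeneous_hcomp])
qed (use assms in \<open>auto simp: hideal_def\<close>)

lemma hcomp_top_mult: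
  assumes x0: "homogeneous e x0" and x: "dlt e (x - x0)" and h: "dlt (Suc t) h"
  shows "hcomp (t + e) (h * x) = hcomp t h * x0" "dlt (Suc (t + e)) (h * x)"
proof -
  have hx: "h * x = h * x0 + h * (x - x0)" by (simp add: algebra_simps)
  have 1: "dlt (t + e) (h * (x - x0))" using h x by (rule dlt_mult)
  then have "hcomp (t + e) (h * (x - x0)) = 0" by (rule hcomp_dlt) simp
  then show "hcomp (t + e) (h * x) = hcomp t h * x0"
    by (subst hx) (simp add: hcomp_add hcomp_mult_homogeneous[OF x0])
  have "dlt (t + Suc e) (h * x0)" using h dlt_homogeneous[OF x0] by (rule dlt_mult)
  then have "dlt (Suc (t + e)) (h * x0)" by simp
  then show "dlt (Suc (t + e)) (h * x)"
    by (subst hx) (intro dlt_add dlt_mono[OF 1]; simp)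
qed

text \<open>\<open>x0\<close> is the component of top degree of \<open>x\<close>. If
  \<open>x * h\<close> is in \<open>J\<close>, the top component of \<open>h\<close> times
  \<open>x0\<close> lies in \<open>J0\<close>; regularity of \<open>x0\<close> puts that component
  into \<open>J0\<close>, and an element of \<open>J\<close> with the same top lowers the degree of
  \<open>h\<close>.\<close>

lemma toprel_step:
  assumes rel: "toprel J J0" and x0: "homogeneous e x0" and x: "dlt e (x - x0)" and r: "reg J0 x0"
  shows "reg J x" "toprel (idl.span (insert x J)) (idl.span (insert x0 J0))"
proof -
  have Jid: "idl.subspace J" and J0h: "hideal J0" and J0id: "idl.subspace J0"
    and top: "\<And>t g. g \<in> J \<Longrightarrow> dlt (Suc t) g \<Longrightarrow> hcomp t g \<in> J0"
    and lift: "\<And>t g0. g0 \<in> J0 \<Longrightarrow> \<exists>g\<in>J. dlt (Suc t) g \<and> hcomp t g = hcomp t g0"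
    using rel by (auto simp: toprel_def hideal_def)
  have lower: "\<exists>g\<in>J. dlt t (h - g)" if h: "dlt (Suc t) h" "hcomp t h \<in> J0" for t h
  proof -
    obtain g where "g \<in> J" "dlt (Suc t) g" "hcomp t g = hcomp t (hcomp t h)" using lift[OF h(2)] by blast
    then show ?thesis using h(1)
      by (intro bexI[of _ g]) (auto simp: dlt_Suc_iff[symmetric, of t] dlt_diff hcomp_diff
          hcomp_homogeneous[OF homogeneous_hcomp])
  qed
  have cancel: "hcomp t h \<in> J0" if "hcomp t h * x0 \<in> J0" for t h
    using that r by (auto simp: reg_def mult.commute)
  have "h \<in> J" if "dlt t h" "x * h \<in> J" for t h
    using that
  proof (induction t arbitrary: h)
    case 0 then show ?case by (simp add: dlt_0_iff idl.subspace_0[OF Jid])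
  next
    case (Suc t)
    note c = hcomp_top_mult[OF x0 x Suc.prems(1)]
    have "hcomp (t + e) (h * x) \<in> J0" using Suc.prems(2) c(2) by (intro top) (auto simp: mult.commute)
    then have "hcomp t h \<in> J0" using c(1) cancel by simp
    then obtain g where g: "g \<in> J" "dlt t (h - g)" using lower Suc.prems(1) by blast
    have "x * (h - g) \<in> J"
      using idl.subspace_diff[OF Jid Suc.prems(2) ideal_mult(1)[OF Jid g(1), of x]] by (simp add: algebra_simps)
    then have "h - g \<in> J" using Suc.IH g(2) by blast
    then show ?case using idl.subspace_add[OF Jid _ g(1), of "h - g"] by simp
  qed
  then show "reg J x" using dlt_exists by (metis reg_def)
  \<comment> \<open>Induction on the degree bound of the cofactor \<open>h\<close>. When the top of
    \<open>h * x\<close> lies above degree \<open>t\<close>, it cancels against the top of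
    \<open>a\<close>; so \<open>hcomp s h * x0\<close> is in \<open>J0\<close>, and subtracting some
    \<open>g \<in> J\<close> lowers the degree of the cofactor without changing the sum.\<close>
  have main: "hcomp t (a + h * x) \<in> idl.span (insert x0 J0)"
    if "dlt s h" "a \<in> J" "dlt (Suc t) (a + h * x)" for s t a h
    using that
  proof (induction s arbitrary: a h)
    case 0
    then have "hcomp t a \<in> J0" "h = 0" using top by (auto simp: dlt_0_iff)
    then show ?case by (auto intro: idl.span_base)
  next
    case (Suc s)
    note c = hcomp_top_mult[OF x0 x Suc.prems(1)]
    show ?case
    proof (cases "s + e \<le> t")
      case True
      have "dlt (Suc t) (h * x)" using dlt_mono[OF c(2)] True by simp
      then have "dlt (Suc t) a" using dlt_diff[OF Suc.prems(3)] by fastforce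
      then have 1: "hcomp t a \<in> J0" using top Suc.prems(2) by blast
      have "hcomp t (h * x) \<in> idl.span (insert x0 J0)"
      proof (cases "s + e = t")
        case True
        then show ?thesis using c(1) by (auto intro: idl.span_scale idl.span_base)
      next
        case False
        then have "hcomp t (h * x) = 0" using True by (intro hcomp_dlt[OF c(2)]) simp
        then show ?thesis by (simp add: idl.span_zero)
      qed
      then show ?thesis using 1 by (simp add: hcomp_add idl.span_add idl.span_base)
    next
      case False
      have "hcomp (s + e) (a + h * x) = 0" using False by (intro hcomp_dlt[OF Suc.prems(3)]) simp
      then have ca: "hcomp (s + e) a = - (hcomp s h * x0)" using c(1) by (simp add: hcomp_add eq_neg_iff_add_eq_0)
      have "dlt (Suc (s + e)) (a + h * x - h * x)"
        using False by (intro dlt_diff c(2) dlt_mono[OF Suc.prems(3)]) simp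
      then have "dlt (Suc (s + e)) a" by simp
      then have "hcomp (s + e) a \<in> J0" using top Suc.prems(2) by blast
      then have "hcomp s h * x0 \<in> J0" using idl.subspace_neg[OF J0id] ca by fastforce
      then obtain g where g: "g \<in> J" "dlt s (h - g)" using lower[OF Suc.prems(1)] cancel by blast
      have "a + g * x \<in> J" by (intro idl.subspace_add Jid Suc.prems ideal_mult(2) g)
      moreover have "a + h * x = a + g * x + (h - g) * x" by (simp add: algebra_simps)
      ultimately show ?thesis using Suc.IH[OF g(2), of "a + g * x"] Suc.prems(3) by metis
    qed
  qed
  show "toprel (idl.span (insert x J)) (idl.span (insert x0 J0))"
    unfolding toprel_def
  proof (intro conjI allI ballI impI)
    show "hideal (idl.span (insert x0 J0))" using J0h x0 by (rule hideal_insert)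
    show "hcomp t g \<in> idl.span (insert x0 J0)" if g: "g \<in> idl.span (insert x J)" "dlt (Suc t) g" for t g
    proof -
      obtain h where h: "g - h * x \<in> J" using g(1) span_insert_iff[OF Jid] by blast
      obtain s where "dlt s h" using dlt_exists by blast
      then show ?thesis using main[of s h "g - h * x" t] h g(2) by simp
    qed
    show "\<exists>g\<in>idl.span (insert x J). dlt (Suc t) g \<and> hcomp t g = hcomp t g0"
      if g0: "g0 \<in> idl.span (insert x0 J0)" for t g0
    proof -
      obtain h0 where h0: "g0 - h0 * x0 \<in> J0" using g0 span_insert_iff[OF J0id] by blast
      obtain a where a: "a \<in> J" "dlt (Suc t) a" "hcomp t a = hcomp t (g0 - h0 * x0)" using lift[OF h0] by blast
      show ?thesis
      proof (cases "e \<le> t")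
        case True
        define h where "h = hcomp (t - e) h0"
        have "dlt (Suc (t - e)) h" unfolding h_def by (rule dlt_homogeneous[OF homogeneous_hcomp])
        note c = hcomp_top_mult[OF x0 x this]
        have "hcomp (t - e) h = h" unfolding h_def by (simp add: hcomp_homogeneous[OF homogeneous_hcomp])
        then have "hcomp t (a + h * x) = hcomp t g0"
          using c(1) True a(3) by (simp add: hcomp_add hcomp_diff hcomp_mult_homogeneous[OF x0] h_def)
        moreover have "a + h * x \<in> idl.span (insert x J)"
          using a(1) by (intro idl.span_add idl.span_scale idl.span_base) auto
        ultimately show ?thesis using c(2) True a(2) by (intro bexI[of _ "a + h * x"]) (auto simp: dlt_add)
      next
        case False
        then have "hcomp t a = hcomp t g0" using a(3) by (simp add: hcomp_diff hcomp_mult_homogeneous[OF x0])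
        then show ?thesis using a by (intro bexI[of _ a]) (auto intro: idl.span_base)
      qed
    qed
  qed simp
qed

lemma rseq_leading_forms:
  assumes "toprel J J0" "rseq J0 xs0" "list_all2 (\<lambda>x x0. \<exists>e. homogeneous e x0 \<and> dlt e (x - x0)) xs xs0"
  shows "rseq J xs"
  using assms(3,1,2)
proof (induction xs xs0 arbitrary: J J0 rule: list_all2_induct)
  case (Cons x xs x0 xs0)
  then obtain e where "homogeneous e x0" "dlt e (x - x0)" by blast
  note st = toprel_step[OF Cons.prems(1) this]
  show ?case using st Cons by auto
qed simp

section \<open>Hilbert's basis theorem\<close>

definition vnum :: "'n::finite \<Rightarrow> nat" where
  "vnum = (SOME f. inj f)"

lemma inj_vnum: "inj (vnum :: 'n::finite \<Rightarrow> nat)"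
proof -
  have "\<exists>f :: 'n \<Rightarrow> nat. inj f" using finite_imp_inj_to_nat_seg[of "UNIV :: 'n set"] by blast
  then show ?thesis unfolding vnum_def by (rule someI_ex)
qed

text \<open>The index type \<open>'n\<close> carries no order; renumbering by naturals gives access
  to the linear order on \<open>nat \<Rightarrow>\<^sub>0 nat\<close>, which is compatible with
  addition.\<close>

definition mkey :: "('n::finite \<Rightarrow>\<^sub>0 nat) \<Rightarrow> (nat \<Rightarrow>\<^sub>0 nat)" where
  "mkey m = (\<Sum>j\<in>UNIV. Poly_Mapping.single (vnum j) (lookup m j))"

lemma mkey_add: "mkey (a + b) = mkey a + mkey b"
  by (simp add: mkey_def lookup_add single_add sum.distrib)

lemma lookup_mkey: "lookup (mkey m) (vnum j) = lookup m j"
  by (simp add: mkey_def lookup_sum lookup_single when_def inj_eq[OF inj_vnum])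

lemma mkey_inject: "mkey a = mkey b \<longleftrightarrow> a = b"
  by (metis lookup_mkey poly_mapping_eqI)

text \<open>Comparing degrees before keys leaves only finitely many exponents below a given one, so
  that \<open>mrank\<close> is a position in this order and inductions can run over natural
  numbers.\<close>

definition mless :: "('n::finite \<Rightarrow>\<^sub>0 nat) \<Rightarrow> ('n \<Rightarrow>\<^sub>0 nat) \<Rightarrow> bool" where
  "mless a b \<longleftrightarrow> mdeg a < mdeg b \<or> mdeg a = mdeg b \<and> mkey a < mkey b"

lemma mless_trans: "mless a b \<Longrightarrow> mless b c \<Longrightarrow> mless a c"
  by (auto simp: mless_def)

lemma mless_irrefl: "\<not> mless a a"
  by (simp add: mless_def)

lemma mless_total: "a = b \<or> mless a b \<or> mless b a"
  using mkey_inject[of a b] by (auto simp: mless_def)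

lemma mless_add: "mless a b \<Longrightarrow> mless (c + a) (c + b)"
  by (auto simp: mless_def mdeg_add mkey_add)

lemma finite_mdeg_le: "finite {m :: 'n::finite \<Rightarrow>\<^sub>0 nat. mdeg m \<le> t}"
proof (rule finite_imageD)
  show "inj_on lookup {m :: 'n::finite \<Rightarrow>\<^sub>0 nat. mdeg m \<le> t}"
    by (rule inj_onI, rule poly_mapping_eqI) simp
  have "lookup ` {m :: 'n \<Rightarrow>\<^sub>0 nat. mdeg m \<le> t} \<subseteq> PiE UNIV (\<lambda>_. {..t})"
  proof clarify
    fix m :: "'n \<Rightarrow>\<^sub>0 nat" assume "mdeg m \<le> t"
    then have "lookup m j \<le> t" for j using lookup_le_mdeg[of m j] by simp
    then show "lookup m \<in> PiE UNIV (\<lambda>_. {..t})" by (simp add: PiE_iff)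
  qed
  then show "finite (lookup ` {m :: 'n \<Rightarrow>\<^sub>0 nat. mdeg m \<le> t})"
    by (rule finite_subset) (simp add: finite_PiE)
qed

definition mrank :: "('n::finite \<Rightarrow>\<^sub>0 nat) \<Rightarrow> nat" where
  "mrank m = card {m'. mless m' m}"

lemma mrank_less: assumes "mless a b" shows "mrank a < mrank b"
  unfolding mrank_def
proof (rule psubset_card_mono)
  show "finite {m'. mless m' b}"
    by (rule finite_subset[OF _ finite_mdeg_le[of "mdeg b"]]) (auto simp: mless_def)
  show "{m'. mless m' a} \<subset> {m'. mless m' b}"
    using assms mless_trans mless_irrefl by blast
qed

lemma mrank_less_iff: "mrank a < mrank b \<longleftrightarrow> mless a b"
  using mless_total[of a b] mrank_less[of a b] mrank_less[of b a] by auto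

lemma mrank_inject: "mrank a = mrank b \<longleftrightarrow> a = b"
  using mless_total[of a b] mrank_less[of a b] mrank_less[of b a] by auto

lemma lookup_mult_sum:
  "lookup (p * q) k = (\<Sum>m\<in>keys p. \<Sum>m'\<in>keys q. if m + m' = k then lookup p m * lookup q m' else 0)"
  for p q :: "('n::finite, 'k::field) mpoly"
proof -
  have "p * q = (\<Sum>m\<in>keys p. const (lookup p m) * monomial m) * (\<Sum>m\<in>keys q. const (lookup q m) * monomial m)"
    using poly_expand[of p] poly_expand[of q] by simp
  also have "\<dots> = (\<Sum>m\<in>keys p. \<Sum>m'\<in>keys q. Poly_Mapping.single (m + m') (lookup p m * lookup q m'))"
    by (simp add: sum_product const_monomial mult_single)
  finally show ?thesis by (simp add: lookup_sum lookup_single when_def)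
qed

lemma exists_leading:
  assumes "p \<noteq> (0 :: ('n::finite, 'k::field) mpoly)"
  obtains a where "a \<in> keys p" "\<And>m. m \<in> keys p \<Longrightarrow> m = a \<or> mless m a"
proof -
  have "keys p \<noteq> {}" using assms by auto
  then have "Max (mrank ` keys p) \<in> mrank ` keys p" by (intro Max_in) auto
  then obtain a where a: "a \<in> keys p" "mrank a = Max (mrank ` keys p)" by force
  have "m = a \<or> mless m a" if "m \<in> keys p" for m
  proof -
    have "mrank m \<le> mrank a" using a(2) that by simp
    then show ?thesis using mrank_less_iff[of m a] mrank_inject[of m a] by auto
  qed
  then show ?thesis using that a(1) by blast
qed

text \<open>For the largest exponents \<open>a\<close> and \<open>b\<close>, the pair
  \<open>(a, b)\<close> alone contributes to the coefficient at \<open>a + b\<close>.\<close>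

lemma mpoly_no_zero_divisors:
  fixes p q :: "('n::finite, 'k::field) mpoly"
  assumes "p \<noteq> 0" "q \<noteq> 0" shows "p * q \<noteq> 0"
proof -
  obtain a where a: "a \<in> keys p" "\<And>m. m \<in> keys p \<Longrightarrow> m = a \<or> mless m a"
    using exists_leading[OF assms(1)] by blast
  obtain b where b: "b \<in> keys q" "\<And>m. m \<in> keys q \<Longrightarrow> m = b \<or> mless m b"
    using exists_leading[OF assms(2)] by blast
  have "m = a \<and> m' = b" if m: "m \<in> keys p" "m' \<in> keys q" "m + m' = a + b" for m m'
  proof -
    have 1: "m + m' = a + m' \<or> mless (m + m') (a + m')"
      using a(2)[OF m(1)] mless_add[of m a m'] by (auto simp: add.commute)
    have 2: "a + m' = a + b \<or> mless (a + m') (a + b)"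
      using b(2)[OF m(2)] mless_add[of m' b a] by auto
    have "\<not> mless (m + m') (a + m')"
      using 2 m(3) mless_trans[of "m + m'" "a + m'" "a + b"] mless_irrefl[of "a + b"] by auto
    then have "m = a" using 1 by simp
    then show ?thesis using m(3) by simp
  qed
  then have *: "(if m + m' = a + b then lookup p m * lookup q m' else 0) =
      (if m = a then if m' = b then lookup p a * lookup q b else 0 else 0)"
    if "m \<in> keys p" "m' \<in> keys q" for m m' using that by auto
  have "lookup (p * q) (a + b) =
    (\<Sum>m\<in>keys p. \<Sum>m'\<in>keys q. if m = a then if m' = b then lookup p a * lookup q b else 0 else 0)"
    unfolding lookup_mult_sum by (intro sum.cong refl *)
  also have "\<dots> = (\<Sum>m\<in>keys p. if m = a then \<Sum>m'\<in>keys q. if m' = b then lookup p a * lookup q b else 0 else 0)"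
    by (intro sum.cong) auto
  also have "\<dots> = lookup p a * lookup q b" using a(1) b(1) by simp
  also have "\<dots> \<noteq> 0" using a(1) b(1) by (simp add: in_keys_iff)
  finally show ?thesis by auto
qed

text \<open>Some subsequence is monotone; a decreasing one is constant once it has reached its
  minimum.\<close>

lemma nat_mono_subseq:
  fixes f :: "nat \<Rightarrow> nat"
  obtains r :: "nat \<Rightarrow> nat" where "strict_mono r" "\<And>i k. i \<le> k \<Longrightarrow> f (r i) \<le> f (r k)"
proof -
  obtain g where g: "strict_mono g" "monoseq (\<lambda>n. f (g n))" using seq_monosub by blast
  show ?thesis
  proof (cases "incseq (\<lambda>n. f (g n))")
    case True
    then show ?thesis using that[OF g(1)] by (auto simp: incseq_def)
  next
    case False
    then have dec: "f (g n) \<le> f (g m)" if "m \<le> n" for m n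
      using g(2) that by (auto simp: monoseq_iff decseq_def)
    obtain N where N: "\<And>n. f (g N) \<le> f (g n)"
      using ex_has_least_nat[of "\<lambda>_. True" 0 "\<lambda>n. f (g n)"] by auto
    have "strict_mono (\<lambda>n. g (N + n))" using g(1) by (auto simp: strict_mono_def)
    moreover have "f (g (N + i)) \<le> f (g (N + k))" for i k using dec[of N "N + i"] N[of "N + k"] by simp
    ultimately show ?thesis using that by blast
  qed
qed

lemma monomials_mono_subseq:
  fixes s :: "nat \<Rightarrow> ('n::finite \<Rightarrow>\<^sub>0 nat)"
  assumes "finite F"
  shows "\<exists>r :: nat \<Rightarrow> nat. strict_mono r \<and> (\<forall>j\<in>F. \<forall>i k. i \<le> k \<longrightarrow> lookup (s (r i)) j \<le> lookup (s (r k)) j)"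
  using assms
proof (induction F rule: finite_induct)
  case empty
  show ?case by (rule exI[of _ id]) (auto simp: strict_mono_def)
next
  case (insert x F)
  then obtain r :: "nat \<Rightarrow> nat" where r: "strict_mono r" "\<And>j i k. j \<in> F \<Longrightarrow> i \<le> k \<Longrightarrow> lookup (s (r i)) j \<le> lookup (s (r k)) j"
    by blast
  obtain r' :: "nat \<Rightarrow> nat" where r': "strict_mono r'" "\<And>i k. i \<le> k \<Longrightarrow> lookup (s (r (r' i))) x \<le> lookup (s (r (r' k))) x"
    using nat_mono_subseq[of "\<lambda>n. lookup (s (r n)) x"] by blast
  have "r' i \<le> r' k" if "i \<le> k" for i k using r'(1) that by (simp add: strict_mono_less_eq)
  then show ?case using r r' by (intro exI[of _ "r \<circ> r'"]) (auto simp: strict_mono_def)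
qed

text \<open>If no finite subset works, one can keep picking elements of \<open>L\<close> that lie
  above none of the earlier ones; a subsequence nondecreasing in every coordinate contradicts
  this.\<close>

lemma dickson:
  fixes L :: "('n::finite \<Rightarrow>\<^sub>0 nat) set"
  obtains L0 where "finite L0" "L0 \<subseteq> L" "\<And>m. m \<in> L \<Longrightarrow> \<exists>m0\<in>L0. \<exists>m1. m = m1 + m0"
proof (rule ccontr)
  assume *: "\<not> thesis"
  note witness = that
  have "\<exists>m\<in>L. \<forall>m0\<in>L0. \<forall>m1. m \<noteq> m1 + m0" if "finite L0" "L0 \<subseteq> L" for L0
    using * witness[of L0] that by blast
  then obtain pick where pick: "\<And>L0. finite L0 \<Longrightarrow> L0 \<subseteq> L \<Longrightarrow> pick L0 \<in> L"
    "\<And>L0 m0 m1. finite L0 \<Longrightarrow> L0 \<subseteq> L \<Longrightarrow> m0 \<in> L0 \<Longrightarrow> pick L0 \<noteq> m1 + m0" by metis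
  define A where "A = rec_nat {} (\<lambda>_ B. insert (pick B) B)"
  have A: "A 0 = {}" "A (Suc n) = insert (pick (A n)) (A n)" for n by (simp_all add: A_def)
  have fin: "finite (A n) \<and> A n \<subseteq> L" for n by (induction n) (auto simp: A pick)
  have in_A: "pick (A i) \<in> A (i + Suc d)" for i d by (induction d) (auto simp: A)
  have not_above: "pick (A k) \<noteq> m1 + pick (A i)" if "i < k" for i k m1
    using in_A[of i "k - Suc i"] that pick(2)[of "A k"] fin by auto
  obtain r :: "nat \<Rightarrow> nat" where r: "strict_mono r" "\<And>j i k. i \<le> k \<Longrightarrow> lookup (pick (A (r i))) j \<le> lookup (pick (A (r k))) j"
    using monomials_mono_subseq[of UNIV "\<lambda>n. pick (A n)"] by auto
  have "pick (A (r 1)) = (pick (A (r 1)) - pick (A (r 0))) + pick (A (r 0))"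
    by (rule poly_mapping_eqI) (simp add: lookup_add lookup_minus r(2))
  moreover have "r 0 < r 1" using r(1) by (simp add: strict_mono_def)
  ultimately show False using not_above by blast
qed

text \<open>Gordan's argument: choose elements of \<open>J\<close> whose leading exponents are the
  finitely many minimal ones from \<open>dickson\<close>. Subtracting a suitable multiple of one of
  them lowers the rank of the leading exponent of any \<open>p \<in> J\<close>.\<close>

theorem noeth_mpoly: "noeth TYPE(('n::finite, 'k::field) mpoly)"
  unfolding noeth_def
proof (intro allI impI)
  fix J :: "('n, 'k) mpoly set" assume J: "idl.subspace J"
  define lead where "lead g a \<longleftrightarrow> a \<in> keys g \<and> (\<forall>m\<in>keys g. m = a \<or> mless m a)" for g :: "('n, 'k) mpoly" and a
  define L where "L = {a. \<exists>g\<in>J. lead g a}"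
  obtain L0 where L0: "finite L0" "L0 \<subseteq> L" "\<And>m. m \<in> L \<Longrightarrow> \<exists>m0\<in>L0. \<exists>m1. m = m1 + m0"
    using dickson[of L] by blast
  have "\<forall>a\<in>L0. \<exists>g. g \<in> J \<and> lead g a" using L0(2) by (auto simp: L_def)
  then obtain g where g: "\<And>a. a \<in> L0 \<Longrightarrow> g a \<in> J \<and> lead (g a) a" by metis
  let ?G = "g ` L0"
  have sub: "idl.span ?G \<subseteq> J" using g J by (intro idl.span_minimal) auto
  have "p \<in> idl.span ?G" if "p \<in> J" "\<forall>m\<in>keys p. mrank m < r" for p r
    using that
  proof (induction r arbitrary: p)
    case 0
    then have "p = 0" by auto
    then show ?case by (simp add: idl.span_zero)
  next
    case (Suc r)
    show ?case
    proof (cases "\<exists>m\<in>keys p. mrank m = r")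
      case False
      then show ?thesis using Suc by (metis less_Suc_eq)
    next
      case True
      then obtain m where m: "m \<in> keys p" "mrank m = r" by blast
      have "lead p m" unfolding lead_def using m Suc.prems(2)
        by (metis less_Suc_eq mrank_less_iff mrank_inject)
      then have "m \<in> L" using Suc.prems(1) by (auto simp: L_def)
      then obtain m0 m1 where mm: "m0 \<in> L0" "m = m1 + m0" using L0(3) by blast
      define q where "q = g m0"
      have q: "q \<in> J" "q \<in> ?G" "lead q m0" using g[OF mm(1)] mm(1) by (auto simp: q_def)
      define c where "c = lookup p m / lookup q m0"
      define h where "h = Poly_Mapping.single m1 c * q"
      have q0: "lookup q m0 \<noteq> 0" using q(3) by (simp add: lead_def in_keys_iff)
      have "c \<noteq> 0" using m(1) q0 by (simp add: c_def in_keys_iff)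
      then have "lookup h m = (\<Sum>m'\<in>keys q. if m' = m0 then c * lookup q m' else 0)"
        unfolding h_def lookup_mult_sum by (simp add: mm(2))
      also have "\<dots> = c * lookup q m0" using q0 by (auto simp: in_keys_iff)
      also have "\<dots> = lookup p m" using q0 by (simp add: c_def)
      finally have hm: "lookup h m = lookup p m" .
      have hJ: "h \<in> J" "h \<in> idl.span ?G" unfolding h_def
        using q by (auto intro: ideal_mult(1)[OF J] idl.span_scale idl.span_base)
      have kh: "m' = m \<or> mless m' m" if m': "m' \<in> keys h" for m'
      proof -
        have "m' \<in> {a + b | a b. a \<in> keys (Poly_Mapping.single m1 c) \<and> b \<in> keys q}"
          using m' keys_mult[of "Poly_Mapping.single m1 c" q] unfolding h_def by blast
        then obtain b where "b \<in> keys q" "m' = m1 + b" using \<open>c \<noteq> 0\<close> by auto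
        then show ?thesis using q(3) mless_add mm(2) by (auto simp: lead_def)
      qed
      have "mrank m' < r" if m': "m' \<in> keys (p - h)" for m'
      proof -
        have "m' \<noteq> m" using m' hm by (auto simp: in_keys_iff lookup_minus)
        moreover have "m' \<in> keys p \<or> m' \<in> keys h" using m' by (auto simp: in_keys_iff lookup_minus)
        ultimately show ?thesis using kh \<open>lead p m\<close> m(2) mrank_less by (metis lead_def)
      qed
      then have "p - h \<in> idl.span ?G" using Suc.IH idl.subspace_diff[OF J Suc.prems(1) hJ(1)] by blast
      then show ?thesis using idl.span_add[OF _ hJ(2), of "p - h"] by simp
    qed
  qed
  moreover have "\<exists>r. \<forall>m\<in>keys p. mrank m < r" for p :: "('n, 'k) mpoly"
    using finite_nat_set_iff_bounded[of "mrank ` keys p"] by auto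
  ultimately have "J = idl.span ?G" using sub by blast
  then show "\<exists>G. finite G \<and> J = idl.span G" using L0(1) by blast
qed

section \<open>Growth and the length of prime chains\<close>

lemma homogeneous_linear_system:
  fixes M :: "'a \<Rightarrow> 'b \<Rightarrow> 'k::field"
  assumes "finite G" "finite A" "card G < card A"
  shows "\<exists>c. (\<exists>a\<in>A. c a \<noteq> 0) \<and> (\<forall>g\<in>G. (\<Sum>a\<in>A. c a * M a g) = 0)"
  using assms
proof (induction G arbitrary: A M rule: finite_induct)
  case empty
  then have "A \<noteq> {}" by auto
  then show ?case by (intro exI[of _ "\<lambda>_. 1"]) auto
next
  case (insert g0 G)
  show ?case
  proof (cases "\<forall>a\<in>A. M a g0 = 0")
    case True
    have "card G < card A" using insert by simp
    then obtain c where "\<exists>a\<in>A. c a \<noteq> 0" "\<forall>g\<in>G. (\<Sum>a\<in>A. c a * M a g) = 0"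
      using insert.IH insert.prems by blast
    then show ?thesis using True by (intro exI[of _ c]) auto
  next
    case False
    then obtain a0 where a0: "a0 \<in> A" "M a0 g0 \<noteq> 0" by blast
    define A' where "A' = A - {a0}"
    define M' where "M' a g = M a g - M a g0 / M a0 g0 * M a0 g" for a g
    have "card G < card A'" "finite A'" using insert a0 by (auto simp: A'_def card_Diff_singleton)
    then obtain c' where c': "\<exists>a\<in>A'. c' a \<noteq> 0" "\<And>g. g \<in> G \<Longrightarrow> (\<Sum>a\<in>A'. c' a * M' a g) = 0"
      using insert.IH[of A' M'] by blast
    \<comment> \<open>The value at \<open>a0\<close> solves the equation \<open>g0\<close>; the
      other equations were reduced by \<open>M'\<close> so that they hold for \<open>c\<close>
      exactly when they hold for \<open>c'\<close>.\<close>
    define c where "c a = (if a = a0 then - (\<Sum>a\<in>A'. c' a * (M a g0 / M a0 g0)) else c' a)" for a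
    have A: "A = insert a0 A'" "a0 \<notin> A'" using a0 by (auto simp: A'_def)
    have sum_eq: "(\<Sum>a\<in>A. c a * M a g) = (\<Sum>a\<in>A'. c' a * M' a g)" for g
    proof -
      have "(\<Sum>a\<in>A. c a * M a g) = c a0 * M a0 g + (\<Sum>a\<in>A'. c a * M a g)"
        using A \<open>finite A'\<close> by simp
      also have "(\<Sum>a\<in>A'. c a * M a g) = (\<Sum>a\<in>A'. c' a * M a g)"
        using A by (intro sum.cong) (auto simp: c_def)
      also have "c a0 * M a0 g = - (\<Sum>a\<in>A'. c' a * (M a g0 / M a0 g0) * M a0 g)"
        by (simp add: c_def sum_distrib_right)
      finally show ?thesis
        by (simp add: M'_def right_diff_distrib sum_subtractf mult.assoc)
    qed
    have "(\<Sum>a\<in>A. c a * M a g) = 0" if "g \<in> insert g0 G" for g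
      using that c'(2) a0(2) by (auto simp: sum_eq M'_def)
    moreover have "\<exists>a\<in>A. c a \<noteq> 0" using c'(1) A by (auto simp: c_def)
    ultimately show ?thesis by blast
  qed
qed

section \<open>Linear spans over the field modulo an ideal\<close>

definition kspan :: "('n::finite, 'k::field) mpoly set \<Rightarrow> ('n, 'k) mpoly set \<Rightarrow> ('n, 'k) mpoly set" where
  "kspan G J = {p. \<exists>r. p - (\<Sum>g\<in>G. const (r g) * g) \<in> J}"

lemma kspan_J: "p \<in> J \<Longrightarrow> p \<in> kspan G J"
  unfolding kspan_def by (auto intro!: exI[of _ "\<lambda>_. 0"])

lemma kspan_add:
  assumes J: "idl.subspace J" and "p \<in> kspan G J" "q \<in> kspan G J" shows "p + q \<in> kspan G J"
proof -
  obtain r s where "p - (\<Sum>g\<in>G. const (r g) * g) \<in> J" "q - (\<Sum>g\<in>G. const (s g) * g) \<in> J"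
    using assms by (auto simp: kspan_def)
  then have "(p - (\<Sum>g\<in>G. const (r g) * g)) + (q - (\<Sum>g\<in>G. const (s g) * g)) \<in> J"
    by (rule idl.subspace_add[OF J])
  also have "(p - (\<Sum>g\<in>G. const (r g) * g)) + (q - (\<Sum>g\<in>G. const (s g) * g)) =
      p + q - (\<Sum>g\<in>G. const (r g + s g) * g)"
    by (simp add: const_add distrib_right sum.distrib)
  finally show ?thesis unfolding kspan_def by (intro CollectI exI[of _ "\<lambda>g. r g + s g"])
qed

lemma kspan_const:
  assumes J: "idl.subspace J" and "p \<in> kspan G J" shows "const c * p \<in> kspan G J"
proof -
  obtain r where "p - (\<Sum>g\<in>G. const (r g) * g) \<in> J" using assms by (auto simp: kspan_def)
  then have "const c * (p - (\<Sum>g\<in>G. const (r g) * g)) \<in> J" by (rule ideal_mult(1)[OF J])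
  also have "const c * (p - (\<Sum>g\<in>G. const (r g) * g)) = const c * p - (\<Sum>g\<in>G. const (c * r g) * g)"
    by (simp add: const_mult right_diff_distrib sum_distrib_left mult.assoc)
  finally show ?thesis unfolding kspan_def by (intro CollectI exI[of _ "\<lambda>g. c * r g"])
qed

lemma kspan_base:
  assumes "idl.subspace J" "finite G" "g \<in> G" shows "g \<in> kspan G J"
proof -
  have "(\<Sum>h\<in>G. const (if h = g then 1 else 0) * h) = (\<Sum>h\<in>G. if h = g then h else 0)"
    by (intro sum.cong) auto
  also have "\<dots> = g" using assms by simp
  finally show ?thesis using idl.subspace_0[OF assms(1)]
    unfolding kspan_def by (intro CollectI exI[of _ "\<lambda>h. if h = g then 1 else 0"]) simp
qed

lemma kspan_sum:
  "idl.subspace J \<Longrightarrow> (\<And>a. a \<in> A \<Longrightarrow> f a \<in> kspan G J) \<Longrightarrow> sum f A \<in> kspan G J"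
  by (induction A rule: infinite_finite_induct)
     (auto intro: kspan_add kspan_J idl.subspace_0)

lemma kspan_subset:
  assumes J: "idl.subspace J" and "\<And>g. g \<in> G \<Longrightarrow> x * g \<in> kspan H J" and p: "p \<in> kspan G J"
  shows "x * p \<in> kspan H J"
proof -
  obtain r where r: "p - (\<Sum>g\<in>G. const (r g) * g) \<in> J" using p by (auto simp: kspan_def)
  have "x * p = (\<Sum>g\<in>G. const (r g) * (x * g)) + x * (p - (\<Sum>g\<in>G. const (r g) * g))"
    by (simp add: right_diff_distrib sum_distrib_left mult.left_commute)
  also have "\<dots> \<in> kspan H J"
    by (intro kspan_add[OF J] kspan_sum[OF J] kspan_const[OF J] assms kspan_J ideal_mult(1)[OF J] r)
  finally show ?thesis .
qed

lemma kspan_mono: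
  assumes "idl.subspace J" "finite H" "G \<subseteq> H" shows "kspan G J \<subseteq> kspan H J"
  using kspan_subset[OF assms(1), of G 1 H] kspan_base[OF assms(1,2)] assms(3) by auto

lemma const_sum: "const (sum f A) = (\<Sum>a\<in>A. const (f a))"
  by (induction A rule: infinite_finite_induct) (auto simp: const_add)

lemma kspan_dependent:
  assumes J: "idl.subspace J" and "finite G" "finite A" "card G < card A"
    and v: "\<And>a. a \<in> A \<Longrightarrow> v a \<in> kspan G J"
  shows "\<exists>c. (\<exists>a\<in>A. c a \<noteq> 0) \<and> (\<Sum>a\<in>A. const (c a) * v a) \<in> J"
proof -
  have "\<forall>a\<in>A. \<exists>r. v a - (\<Sum>g\<in>G. const (r g) * g) \<in> J" using v by (auto simp: kspan_def)
  from bchoice[OF this] obtain r where r: "\<And>a. a \<in> A \<Longrightarrow> v a - (\<Sum>g\<in>G. const (r a g) * g) \<in> J" by auto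
  obtain c where c: "\<exists>a\<in>A. c a \<noteq> 0" "\<And>g. g \<in> G \<Longrightarrow> (\<Sum>a\<in>A. c a * r a g) = 0"
    using homogeneous_linear_system[OF assms(2-4), of r] by blast
  have "(\<Sum>a\<in>A. const (c a) * (\<Sum>g\<in>G. const (r a g) * g)) = (\<Sum>a\<in>A. \<Sum>g\<in>G. const (c a * r a g) * g)"
    by (simp add: sum_distrib_left const_mult mult.assoc)
  also have "\<dots> = (\<Sum>g\<in>G. \<Sum>a\<in>A. const (c a * r a g) * g)" by (rule sum.swap)
  also have "\<dots> = (\<Sum>g\<in>G. (\<Sum>a\<in>A. const (c a * r a g)) * g)" by (simp add: sum_distrib_right)
  also have "\<dots> = 0"
  proof (intro sum.neutral ballI)
    fix g assume "g \<in> G"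
    have "(\<Sum>a\<in>A. const (c a * r a g)) * g = const (\<Sum>a\<in>A. c a * r a g) * g" by (simp add: const_sum)
    then show "(\<Sum>a\<in>A. const (c a * r a g)) * g = 0" using c(2)[OF \<open>g \<in> G\<close>] by simp
  qed
  finally have "(\<Sum>a\<in>A. const (c a) * v a) = (\<Sum>a\<in>A. const (c a) * (v a - (\<Sum>g\<in>G. const (r a g) * g)))"
    by (simp add: right_diff_distrib sum_subtractf)
  also have "\<dots> \<in> J" by (intro idl.subspace_sum[OF J] ideal_mult(1)[OF J] r)
  finally show ?thesis using c(1) by blast
qed

lemma span_list:
  fixes J :: "'a::comm_ring_1 set"
  assumes "idl.subspace J" "p \<in> idl.span (J \<union> set qs)"
  shows "\<exists>c. p - (\<Sum>i<length qs. c i * qs ! i) \<in> J"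
  using assms(2)
proof (induction qs arbitrary: p)
  case Nil
  then show ?case using idl.span_eq_iff[THEN iffD2, OF assms(1)] by simp
next
  case (Cons q qs)
  then obtain k where "p - k * q \<in> idl.span (J \<union> set qs)" by (auto simp: idl.span_insert)
  then obtain c where c: "p - k * q - (\<Sum>i<length qs. c i * qs ! i) \<in> J" using Cons.IH by blast
  have "(\<Sum>i<length (q # qs). case_nat k c i * (q # qs) ! i) = k * q + (\<Sum>i<length qs. c i * qs ! i)"
    by (simp add: sum.lessThan_Suc_shift del: sum.lessThan_Suc)
  then show ?case using c by (intro exI[of _ "case_nat k c"]) (simp add: diff_diff_add)
qed

text \<open>Divide the relation by the least power of \<open>y 0\<close>, which is allowed since
  \<open>y 0\<close> is not in the prime \<open>P 0\<close>. Modulo \<open>P 1\<close> all terms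
  that still contain \<open>y 0\<close> vanish, and what remains is a relation in the later
  \<open>y i\<close> modulo \<open>P 1\<close>.\<close>

lemma lex_independent:
  fixes P :: "nat \<Rightarrow> ('n::finite, 'k::field) mpoly set" and ex :: "'b \<Rightarrow> nat \<Rightarrow> nat"
  assumes "\<And>i. i \<le> N \<Longrightarrow> prime_set (P i)"
    and "\<And>i. i < N \<Longrightarrow> P i \<subseteq> P (Suc i) \<and> y i \<in> P (Suc i) \<and> y i \<notin> P i"
    and "finite A" "A \<noteq> {}" "\<And>a b. a \<in> A \<Longrightarrow> b \<in> A \<Longrightarrow> (\<forall>i<N. ex a i = ex b i) \<Longrightarrow> a = b"
    and "\<And>a. a \<in> A \<Longrightarrow> c a \<noteq> 0"
  shows "(\<Sum>a\<in>A. const (c a) * (\<Prod>i<N. y i ^ ex a i)) \<notin> P 0"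
  using assms
proof (induction N arbitrary: P y ex A)
  case 0
  then obtain a where a: "A = {a}" by (metis all_not_in_conv bot_nat_0.extremum_strict insertCI is_singletonI' is_singleton_def)
  then show ?case using prime_const[of "P 0" "c a"] 0 by auto
next
  case (Suc N)
  define a0 where "a0 = Min ((\<lambda>a. ex a 0) ` A)"
  have "a0 \<in> (\<lambda>a. ex a 0) ` A" unfolding a0_def using Suc.prems(3,4) by (intro Min_in) auto
  then obtain b where b: "b \<in> A" "ex b 0 = a0" by auto
  have le: "a0 \<le> ex a 0" if "a \<in> A" for a unfolding a0_def using that Suc.prems(3) by simp
  define B where "B = {a \<in> A. ex a 0 = a0}"
  define T where "T a = const (c a) * (\<Prod>i<N. y (Suc i) ^ ex a (Suc i))" for a
  have p0: "prime_set (P 0)" "prime_set (P 1)" using Suc.prems(1)[of 0] Suc.prems(1)[of 1] by auto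
  have y0: "P 0 \<subseteq> P 1" "y 0 \<in> P 1" "y 0 \<notin> P 0" using Suc.prems(2)[of 0] by auto
  have "(\<Sum>a\<in>B. T a) \<notin> P (Suc 0)" unfolding T_def
  proof (rule Suc.IH)
    show "prime_set (P (Suc i))" if "i \<le> N" for i using Suc.prems(1) that by simp
    show "P (Suc i) \<subseteq> P (Suc (Suc i)) \<and> y (Suc i) \<in> P (Suc (Suc i)) \<and> y (Suc i) \<notin> P (Suc i)" if "i < N" for i
      using Suc.prems(2) that by simp
    show "a = a'" if "a \<in> B" "a' \<in> B" "\<forall>i<N. ex a (Suc i) = ex a' (Suc i)" for a a'
    proof (rule Suc.prems(5))
      show "\<forall>i<Suc N. ex a i = ex a' i" using that by (auto simp: B_def less_Suc_eq_0_disj)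
    qed (use that in \<open>auto simp: B_def\<close>)
  qed (use Suc.prems b in \<open>auto simp: B_def\<close>)
  show ?case
  proof
    assume *: "(\<Sum>a\<in>A. const (c a) * (\<Prod>i<Suc N. y i ^ ex a i)) \<in> P 0"
    have "const (c a) * (\<Prod>i<Suc N. y i ^ ex a i) = y 0 ^ a0 * (y 0 ^ (ex a 0 - a0) * T a)" if "a \<in> A" for a
    proof -
      have "y 0 ^ ex a 0 = y 0 ^ a0 * y 0 ^ (ex a 0 - a0)" using le[OF that] by (simp flip: power_add)
      then show ?thesis by (simp add: T_def prod.lessThan_Suc_shift mult_ac del: prod.lessThan_Suc)
    qed
    then have "y 0 ^ a0 * (\<Sum>a\<in>A. y 0 ^ (ex a 0 - a0) * T a) \<in> P 0"
      using * by (simp add: sum_distrib_left)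
    then have "(\<Sum>a\<in>A. y 0 ^ (ex a 0 - a0) * T a) \<in> P 1"
      using prime_setD(3)[OF p0(1)] prime_power[OF p0(1)] y0 by blast
    also have "(\<Sum>a\<in>A. y 0 ^ (ex a 0 - a0) * T a) =
        (\<Sum>a\<in>B. y 0 ^ (ex a 0 - a0) * T a) + (\<Sum>a\<in>A - B. y 0 ^ (ex a 0 - a0) * T a)"
      using Suc.prems(3) by (subst sum.subset_diff[of B A]) (auto simp: B_def add.commute)
    also have "(\<Sum>a\<in>B. y 0 ^ (ex a 0 - a0) * T a) = (\<Sum>a\<in>B. T a)" by (simp add: B_def)
    finally have 1: "(\<Sum>a\<in>B. T a) + (\<Sum>a\<in>A - B. y 0 ^ (ex a 0 - a0) * T a) \<in> P 1" .
    have "y 0 ^ (ex a 0 - a0) * T a \<in> P 1" if a: "a \<in> A - B" for a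
    proof -
      have "ex a 0 - a0 = Suc (ex a 0 - a0 - 1)" using le[of a] a by (auto simp: B_def)
      then have "y 0 ^ (ex a 0 - a0) * T a = y 0 * (y 0 ^ (ex a 0 - a0 - 1) * T a)"
        by (metis mult.assoc power_Suc)
      then show ?thesis using ideal_mult(2)[OF prime_setD(1)[OF p0(2)] y0(2)] by simp
    qed
    then have 2: "(\<Sum>a\<in>A - B. y 0 ^ (ex a 0 - a0) * T a) \<in> P 1"
      by (rule idl.subspace_sum[OF prime_setD(1)[OF p0(2)]])
    have "(\<Sum>a\<in>B. T a) \<in> P 1" using idl.subspace_diff[OF prime_setD(1)[OF p0(2)] 1 2] by simp
    then show False using \<open>(\<Sum>a\<in>B. T a) \<notin> P (Suc 0)\<close> by simp
  qed
qed

locale parameters =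
  fixes J :: "('n::finite, 'k::field) mpoly set" and qs :: "('n, 'k) mpoly list" and k :: nat and e :: "nat \<Rightarrow> nat"
  assumes J: "hideal J" and qs: "\<And>i. i < length qs \<Longrightarrow> homogeneous (e i) (qs ! i) \<and> e i > 0"
    and k: "k > 0" and rad: "\<And>j. var j ^ k \<in> idl.span (J \<union> set qs)"
begin

lemma Jid: "idl.subspace J"
  using J by (simp add: hideal_def)

text \<open>Over the subring generated by \<open>qs\<close>, the monomials with exponents in
  \<open>B\<close> generate the polynomial ring modulo \<open>J\<close>, as in graded Noether
  normalization.\<close>

definition B :: "('n \<Rightarrow>\<^sub>0 nat) set" where
  "B = {b. \<forall>j. lookup b j < k}"

definition gen :: "('n \<Rightarrow>\<^sub>0 nat) \<times> (nat \<Rightarrow> nat) \<Rightarrow> ('n, 'k) mpoly" where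
  "gen = (\<lambda>(b, \<alpha>). monomial b * (\<Prod>i<length qs. (qs ! i) ^ \<alpha> i))"

text \<open>The exponents of the \<open>qs\<close> are bounded one by one, which gives the
  polynomial bound of degree \<open>length qs\<close> in \<open>card_gens\<close>.\<close>

definition gens :: "nat \<Rightarrow> ('n, 'k) mpoly set" where
  "gens t = gen ` (B \<times> PiE {..<length qs} (\<lambda>_. {..t}))"

lemma finite_B: "finite B"
proof (rule finite_subset[OF _ finite_mdeg_le[of "CARD('n) * k"]])
  show "B \<subseteq> {m. mdeg m \<le> CARD('n) * k}"
  proof clarify
    fix m assume "m \<in> B"
    then have "(\<Sum>j\<in>UNIV. lookup m j) \<le> of_nat (CARD('n)) * k"
      by (intro sum_bounded_above) (auto simp: B_def less_imp_le)
    then show "mdeg m \<le> CARD('n) * k" by (simp add: mdeg_def)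
  qed
qed

lemma finite_gens: "finite (gens t)"
  unfolding gens_def by (intro finite_imageI finite_SigmaI finite_B finite_PiE) auto

lemma card_gens: "card (gens t) \<le> card B * (t + 1) ^ length qs"
proof -
  have "card (gens t) \<le> card (B \<times> PiE {..<length qs} (\<lambda>_. {..t}))"
    unfolding gens_def by (intro card_image_le finite_SigmaI finite_B finite_PiE) auto
  then show ?thesis by (simp add: card_cartesian_product card_PiE)
qed

lemma gens_mono: "s \<le> t \<Longrightarrow> gens s \<subseteq> gens t"
  unfolding gens_def by (intro image_mono Sigma_mono PiE_mono) auto

lemma gens_mult:
  assumes i: "i < length qs" and g: "g \<in> gens t" shows "qs ! i * g \<in> gens (Suc t)"
proof -
  obtain b \<alpha> where b: "b \<in> B" and al: "\<alpha> \<in> PiE {..<length qs} (\<lambda>_. {..t})"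
    and g: "g = monomial b * (\<Prod>i<length qs. (qs ! i) ^ \<alpha> i)"
    using g by (auto simp: gens_def gen_def)
  define \<beta> where "\<beta> = \<alpha>(i := Suc (\<alpha> i))"
  have "(\<Prod>l<length qs. (qs ! l) ^ \<beta> l) = (qs ! i) ^ \<beta> i * (\<Prod>l\<in>{..<length qs} - {i}. (qs ! l) ^ \<beta> l)"
    using i by (intro prod.remove) auto
  also have "(\<Prod>l\<in>{..<length qs} - {i}. (qs ! l) ^ \<beta> l) = (\<Prod>l\<in>{..<length qs} - {i}. (qs ! l) ^ \<alpha> l)"
    by (intro prod.cong) (auto simp: \<beta>_def)
  also have "(qs ! i) ^ \<beta> i * \<dots> = qs ! i * ((qs ! i) ^ \<alpha> i * (\<Prod>l\<in>{..<length qs} - {i}. (qs ! l) ^ \<alpha> l))"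
    by (simp add: \<beta>_def mult.assoc)
  also have "(qs ! i) ^ \<alpha> i * (\<Prod>l\<in>{..<length qs} - {i}. (qs ! l) ^ \<alpha> l) = (\<Prod>l<length qs. (qs ! l) ^ \<alpha> l)"
    using i by (intro prod.remove[symmetric]) auto
  finally have "qs ! i * g = gen (b, \<beta>)" by (simp add: g gen_def mult_ac)
  moreover have "\<beta> \<in> PiE {..<length qs} (\<lambda>_. {..Suc t})"
    using al i unfolding \<beta>_def PiE_iff extensional_def by (auto intro: le_SucI)
  ultimately show ?thesis using b unfolding gens_def by blast
qed

text \<open>A monomial outside \<open>B\<close> contains some \<open>var j ^ k\<close>, which modulo
  \<open>J\<close> is a combination of the \<open>qs\<close>. Since the \<open>qs\<close> have
  positive degree, their cofactors have degree below \<open>t\<close>, and the induction hypothesis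
  applies to them.\<close>

lemma homogeneous_in_kspan: "homogeneous t p \<Longrightarrow> p \<in> kspan (gens t) J"
proof (induction t arbitrary: p rule: less_induct)
  case (less t)
  have mon: "monomial m \<in> kspan (gens t) J" if m: "mdeg m = t" for m
  proof (cases "m \<in> B")
    case True
    have "monomial m = gen (m, \<lambda>i\<in>{..<length qs}. 0)" by (simp add: gen_def)
    then have "monomial m \<in> gens t" unfolding gens_def using True by (intro image_eqI[of _ _ "(m, \<lambda>i\<in>{..<length qs}. 0)"]) auto
    then show ?thesis by (rule kspan_base[OF Jid finite_gens])
  next
    case False
    then obtain j where j: "k \<le> lookup m j" by (auto simp: B_def not_less)
    define m' where "m' = m - Poly_Mapping.single j k"
    have mm: "m = m' + Poly_Mapping.single j k" unfolding m'_def
      by (rule poly_mapping_eqI) (use j in \<open>auto simp: lookup_add lookup_minus lookup_single when_def\<close>)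
    have t: "t = mdeg m' + k" using m by (simp add: mm mdeg_add)
    have vk: "var j ^ r = (monomial (Poly_Mapping.single j r) :: ('n, 'k) mpoly)" for r
      by (induction r) (simp_all add: var_def flip: monomial_add single_add)
    obtain c where c: "var j ^ k - (\<Sum>i<length qs. c i * qs ! i) \<in> J"
      using span_list[OF Jid rad] by blast
    \<comment> \<open>Only the component of degree \<open>k\<close> of the relation is kept, so the
      cofactors become homogeneous; a \<open>qs ! i\<close> of degree above \<open>k\<close>
      contributes nothing.\<close>
    define c' where "c' i = (if e i \<le> k then hcomp (k - e i) (c i) else 0)" for i
    have "hcomp k (var j ^ k - (\<Sum>i<length qs. c i * qs ! i)) \<in> J" using c J by (auto simp: hideal_def)
    also have "hcomp k (var j ^ k - (\<Sum>i<length qs. c i * qs ! i)) = var j ^ k - (\<Sum>i<length qs. hcomp k (c i * qs ! i))"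
      using hcomp_homogeneous[OF homogeneous_power[OF homogeneous_var[of j], of k], of k] by (simp add: hcomp_diff hcomp_sum)
    also have "(\<Sum>i<length qs. hcomp k (c i * qs ! i)) = (\<Sum>i<length qs. c' i * qs ! i)"
    proof (intro sum.cong refl)
      fix i assume "i \<in> {..<length qs}"
      then have "homogeneous (e i) (qs ! i)" using qs by simp
      from hcomp_mult_homogeneous[OF this] show "hcomp k (c i * qs ! i) = c' i * qs ! i"
        by (simp add: c'_def)
    qed
    finally have c2: "var j ^ k - (\<Sum>i<length qs. c' i * qs ! i) \<in> J" .
    have "monomial m = (\<Sum>i<length qs. qs ! i * (monomial m' * c' i)) + monomial m' * (var j ^ k - (\<Sum>i<length qs. c' i * qs ! i))"
      by (simp add: mm monomial_add vk right_diff_distrib sum_distrib_left mult_ac)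
    also have "\<dots> \<in> kspan (gens t) J"
    proof (rule kspan_add[OF Jid kspan_sum[OF Jid] kspan_J[OF ideal_mult(1)[OF Jid c2]]])
      fix i assume "i \<in> {..<length qs}"
      then have i: "i < length qs" by simp
      show "qs ! i * (monomial m' * c' i) \<in> kspan (gens t) J"
      proof (cases "e i \<le> k")
        case True
        define s where "s = mdeg m' + (k - e i)"
        have s: "Suc s \<le> t" using qs[OF i] True t by (auto simp: s_def)
        have "homogeneous s (monomial m' * c' i)"
          using homogeneous_mult[OF homogeneous_monomial homogeneous_hcomp] True by (simp only: s_def c'_def if_True)
        then have "monomial m' * c' i \<in> kspan (gens s) J" using less.IH s by simp
        from kspan_subset[OF Jid _ this] show ?thesis
          using gens_mult[OF i] gens_mono[OF s] kspan_base[OF Jid finite_gens] by blast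
      next
        case False
        then show ?thesis using kspan_J[OF idl.subspace_0[OF Jid]] by (simp add: c'_def)
      qed
    qed
    finally show ?thesis .
  qed
  have "(\<Sum>m\<in>keys p. const (lookup p m) * monomial m) \<in> kspan (gens t) J"
    using less.prems by (intro kspan_sum[OF Jid] kspan_const[OF Jid] mon) (auto simp: homogeneous_iff)
  then show ?case using poly_expand[of p] by simp
qed

lemma dlt_in_kspan: assumes "dlt (Suc t) p" shows "p \<in> kspan (gens t) J"
proof -
  have "hcomp s p \<in> kspan (gens t) J" if "s < Suc t" for s
    using homogeneous_in_kspan[OF homogeneous_hcomp] kspan_mono[OF Jid finite_gens gens_mono] that
    by (metis less_Suc_eq_le subsetD)
  then have "(\<Sum>s<Suc t. hcomp s p) \<in> kspan (gens t) J" by (intro kspan_sum[OF Jid]) auto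
  then show ?thesis using sum_hcomp[OF assms] by simp
qed

lemma dlt_power: "dlt (Suc d) p \<Longrightarrow> dlt (Suc (r * d)) (p ^ r)" for p :: "('n, 'k) mpoly"
proof (induction r)
  case 0 then show ?case using dlt_homogeneous[OF homogeneous_one] by simp
next
  case (Suc r)
  then show ?case using dlt_mult[of d p "Suc (r * d)" "p ^ r"] by simp
qed

lemma dlt_prod: "(\<And>i. i < N \<Longrightarrow> dlt (Suc d) (f i)) \<Longrightarrow> dlt (Suc (N * d)) (\<Prod>i<N. f i)" for f :: "nat \<Rightarrow> ('n, 'k) mpoly"
proof (induction N)
  case 0 then show ?case using dlt_homogeneous[OF homogeneous_one] by simp
next
  case (Suc N)
  then show ?case using dlt_mult[of d "f N" "Suc (N * d)" "prod f {..<N}"] by (simp add: mult.commute add.commute)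
qed

theorem prime_chain_bound:
  assumes chain: "prime_chain P l" "J \<subseteq> P 0" shows "l \<le> length qs"
proof (rule ccontr)
  assume "\<not> l \<le> length qs"
  define D where "D = length qs"
  have l: "Suc D \<le> l" using \<open>\<not> l \<le> length qs\<close> by (simp add: D_def)
  have "\<forall>i<Suc D. \<exists>x. x \<in> P (Suc i) \<and> x \<notin> P i"
    using chain(1) l unfolding prime_chain_def by (metis dual_order.strict_trans1 psubset_imp_ex_mem DiffD1 DiffD2)
  then obtain y where y: "\<And>i. i < Suc D \<Longrightarrow> y i \<in> P (Suc i) \<and> y i \<notin> P i" by metis
  have "\<exists>d. \<forall>i<Suc D. dlt (Suc d) (y i)"
  proof -
    have "\<forall>i. \<exists>t. dlt t (y i)" using dlt_exists by blast
    then obtain d where d: "\<And>i. dlt (d i) (y i)" by metis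
    have "dlt (Suc (\<Sum>i<Suc D. d i)) (y i)" if "i < Suc D" for i
      using dlt_mono[OF d[of i]] member_le_sum[of i "{..<Suc D}" d] that by (auto intro: le_SucI)
    then show ?thesis by blast
  qed
  then obtain d where d: "\<And>i. i < Suc D \<Longrightarrow> dlt (Suc d) (y i)" by blast
  \<comment> \<open>All products with exponents up to \<open>s\<close> have degree at most
    \<open>T\<close>, and \<open>T + 1 \<le> (Suc D * d + 1) * (s + 1)\<close>. This
    \<open>s\<close> makes the number of generators at most \<open>s * (s + 1) ^ D\<close>, fewer
    than the \<open>(s + 1) ^ Suc D\<close> exponent vectors in \<open>A\<close>.\<close>
  define s where "s = card B * (Suc D * d + 1) ^ D"
  define T where "T = Suc D * (s * d)"
  define A where "A = PiE {..<Suc D} (\<lambda>_. {..s})"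
  define v where "v \<alpha> = (\<Prod>i<Suc D. y i ^ \<alpha> i)" for \<alpha>
  have finA: "finite A" unfolding A_def by (intro finite_PiE) auto
  have "T + 1 \<le> (Suc D * d + 1) * (s + 1)" by (simp add: T_def algebra_simps)
  then have "(T + 1) ^ D \<le> (Suc D * d + 1) ^ D * (s + 1) ^ D" by (metis power_mono power_mult_distrib zero_le)
  then have "card B * (T + 1) ^ D \<le> s * (s + 1) ^ D" unfolding s_def by (metis mult.assoc mult_le_mono2)
  also have "\<dots> < (s + 1) ^ Suc D" by simp
  also have "\<dots> = card A" by (simp add: A_def card_PiE)
  finally have card: "card (gens T) < card A" using card_gens[of T] by (simp add: D_def)
  have "v \<alpha> \<in> kspan (gens T) J" if "\<alpha> \<in> A" for \<alpha>
  proof (rule dlt_in_kspan)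
    have "dlt (Suc (s * d)) (y i ^ \<alpha> i)" if i: "i < Suc D" for i
    proof (rule dlt_mono[OF dlt_power[OF d[OF i]]])
      have "\<alpha> i \<le> s" using \<open>\<alpha> \<in> A\<close> i by (auto simp: A_def PiE_iff)
      then show "Suc (\<alpha> i * d) \<le> Suc (s * d)" by simp
    qed
    then show "dlt (Suc T) (v \<alpha>)" unfolding v_def T_def by (rule dlt_prod)
  qed
  then obtain c where c: "\<exists>\<alpha>\<in>A. c \<alpha> \<noteq> 0" "(\<Sum>\<alpha>\<in>A. const (c \<alpha>) * v \<alpha>) \<in> J"
    using kspan_dependent[OF Jid finite_gens finA card, of v] by blast
  define A' where "A' = {\<alpha> \<in> A. c \<alpha> \<noteq> 0}"
  have "(\<Sum>\<alpha>\<in>A'. const (c \<alpha>) * v \<alpha>) = (\<Sum>\<alpha>\<in>A. const (c \<alpha>) * v \<alpha>)"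
    using finA by (intro sum.mono_neutral_left) (auto simp: A'_def)
  then have "(\<Sum>\<alpha>\<in>A'. const (c \<alpha>) * v \<alpha>) \<in> P 0" using c(2) chain(2) by auto
  moreover have "(\<Sum>\<alpha>\<in>A'. const (c \<alpha>) * (\<Prod>i<Suc D. y i ^ \<alpha> i)) \<notin> P 0"
  proof (rule lex_independent)
    show "prime_set (P i)" if "i \<le> Suc D" for i using chain(1) l that by (auto simp: prime_chain_def)
    show "P i \<subseteq> P (Suc i) \<and> y i \<in> P (Suc i) \<and> y i \<notin> P i" if "i < Suc D" for i
    proof -
      have "P i \<subset> P (Suc i)" using chain(1) l that by (simp add: prime_chain_def)
      then show ?thesis using y[OF that] by blast
    qed
    show "\<alpha> = \<beta>" if "\<alpha> \<in> A'" "\<beta> \<in> A'" "\<forall>i<Suc D. \<alpha> i = \<beta> i" for \<alpha> \<beta>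
      using that by (intro PiE_ext[of \<alpha> "{..<Suc D}" "\<lambda>_. {..s}" \<beta>]) (auto simp: A'_def A_def)
  qed (use c(1) finA in \<open>auto simp: A'_def\<close>)
  ultimately show False by (simp add: v_def)
qed

end

section \<open>Zariski's lemma\<close>

text \<open>The subring \<open>K[F]\<close> of polynomials in the variables of
  \<open>F\<close>.\<close>

definition VF :: "'n::finite set \<Rightarrow> ('n, 'k::field) mpoly set" where
  "VF F = {p. \<forall>m\<in>keys p. keys m \<subseteq> F}"

lemma VF_const: "const c \<in> VF F"
  by (simp add: VF_def const_def)

lemma VF_zero: "0 \<in> VF F" and VF_one: "1 \<in> VF F"
  by (simp_all add: VF_def)

lemma VF_add: "p \<in> VF F \<Longrightarrow> q \<in> VF F \<Longrightarrow> p + q \<in> VF F"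
  using keys_add[of p q] unfolding VF_def by blast

lemma VF_uminus: "p \<in> VF F \<Longrightarrow> - p \<in> VF F"
  by (auto simp: VF_def in_keys_iff)

lemma VF_diff: "p \<in> VF F \<Longrightarrow> q \<in> VF F \<Longrightarrow> p - q \<in> VF F"
  using VF_add[OF _ VF_uminus, of p F q] by simp

lemma VF_mult:
  assumes "p \<in> VF F" "q \<in> VF F" shows "p * q \<in> VF F"
  unfolding VF_def
proof safe
  fix m x assume "m \<in> keys (p * q)" "x \<in> keys m"
  then obtain a b where "a \<in> keys p" "b \<in> keys q" "m = a + b"
    using keys_mult[of p q] by blast
  then show "x \<in> F" using assms keys_add[of a b] \<open>x \<in> keys m\<close> unfolding VF_def by blast
qed

lemma VF_sum: "(\<And>a. a \<in> A \<Longrightarrow> f a \<in> VF F) \<Longrightarrow> sum f A \<in> VF F"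
  by (induction A rule: infinite_finite_induct) (auto simp: VF_zero VF_add)

lemma VF_prod: "(\<And>a. a \<in> A \<Longrightarrow> f a \<in> VF F) \<Longrightarrow> prod f A \<in> VF F"
  by (induction A rule: infinite_finite_induct) (auto simp: VF_one VF_mult)

lemma VF_power: "p \<in> VF F \<Longrightarrow> p ^ r \<in> VF F"
  by (induction r) (auto simp: VF_one VF_mult)

lemma VF_monomial: "monomial m \<in> VF F \<longleftrightarrow> keys m \<subseteq> F"
  by (simp add: VF_def)

lemma VF_var: "j \<in> F \<Longrightarrow> var j \<in> VF F"
  by (simp add: var_def VF_monomial)

lemma var_power: "var j ^ r = monomial (Poly_Mapping.single j r)"
  by (induction r) (simp_all add: var_def flip: monomial_add single_add)

lemma VF_insert_decomp:
  assumes g: "g \<in> VF (insert j F)" and j: "j \<notin> F"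
  shows "\<exists>N a. (\<forall>i. a i \<in> VF F) \<and> g = (\<Sum>i<N. a i * var j ^ i)"
proof -
  define T where "T m = const (lookup g m) * monomial (m - Poly_Mapping.single j (lookup m j))" for m
  define a where "a i = (\<Sum>m\<in>{m \<in> keys g. lookup m j = i}. T m)" for i
  obtain N where N: "\<forall>x\<in>(\<lambda>m. lookup m j) ` keys g. x < N"
    using finite_nat_set_iff_bounded[of "(\<lambda>m. lookup m j) ` keys g"] by auto
  have "T m \<in> VF F" if "m \<in> keys g" for m
  proof -
    have "x \<in> F" if "x \<in> keys (m - Poly_Mapping.single j (lookup m j))" for x
    proof -
      have "x \<noteq> j" "x \<in> keys m"
        using that by (auto simp: in_keys_iff lookup_minus lookup_single when_def split: if_splits)
      then show ?thesis using g \<open>m \<in> keys g\<close> by (auto simp: VF_def)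
    qed
    then show ?thesis unfolding T_def by (intro VF_mult VF_const) (auto simp: VF_monomial)
  qed
  then have "a i \<in> VF F" for i unfolding a_def by (intro VF_sum) auto
  moreover have "g = (\<Sum>i<N. a i * var j ^ i)"
  proof -
    have "const (lookup g m) * monomial m = T m * var j ^ lookup m j" for m
    proof -
      have "m = (m - Poly_Mapping.single j (lookup m j)) + Poly_Mapping.single j (lookup m j)"
        by (rule poly_mapping_eqI) (auto simp: lookup_add lookup_minus lookup_single when_def)
      then show ?thesis unfolding T_def var_power by (metis monomial_add mult.assoc)
    qed
    then have "g = (\<Sum>m\<in>keys g. T m * var j ^ lookup m j)" using poly_expand[of g] by simp
    also have "\<dots> = (\<Sum>i<N. \<Sum>m\<in>{m \<in> keys g. lookup m j = i}. T m * var j ^ lookup m j)"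
      by (rule sum.group[symmetric]) (use N in auto)
    also have "\<dots> = (\<Sum>i<N. a i * var j ^ i)"
      by (simp add: a_def sum_distrib_right)
    finally show ?thesis .
  qed
  ultimately show ?thesis by blast
qed

text \<open>\<open>k\<close> is the last index with a nonzero coefficient; were it \<open>0\<close>,
  a nonzero element of \<open>K[F]\<close> would lie in \<open>M\<close>.\<close>

lemma algebraic_var:
  assumes j: "j \<notin> F" and ind: "\<And>p. p \<in> VF F \<Longrightarrow> p \<in> M \<Longrightarrow> p = 0"
    and dep: "g \<in> VF (insert j F)" "g \<in> M" "g \<noteq> 0"
  shows "\<exists>k a. k > 0 \<and> (\<forall>i. a i \<in> VF F) \<and> a k \<noteq> 0 \<and> (\<Sum>i\<le>k. a i * var j ^ i) \<in> M"
proof -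
  obtain N a where a: "\<And>i. a i \<in> VF F" "g = (\<Sum>i<N. a i * var j ^ i)"
    using VF_insert_decomp[OF dep(1) j] by blast
  define A where "A = {i. i < N \<and> a i \<noteq> 0}"
  have "A \<noteq> {}"
  proof
    assume "A = {}"
    then have "a i * var j ^ i = 0" if "i < N" for i using that by (auto simp: A_def)
    then show False using a(2) dep(3) by simp
  qed
  moreover have "finite A" by (simp add: A_def)
  ultimately have k: "Max A \<in> A" "\<And>i. i \<in> A \<Longrightarrow> i \<le> Max A" by auto
  define k where "k = Max A"
  have kN: "k < N" "a k \<noteq> 0" using k(1) by (auto simp: A_def k_def)
  have "g = (\<Sum>i\<le>k. a i * var j ^ i)" unfolding a(2)
  proof (rule sum.mono_neutral_right)
    show "\<forall>i\<in>{..<N} - {..k}. a i * var j ^ i = 0"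
    proof
      fix i assume i: "i \<in> {..<N} - {..k}"
      then have "i \<notin> A" using k(2)[of i] by (auto simp: k_def)
      then show "a i * var j ^ i = 0" using i by (simp add: A_def)
    qed
  qed (use kN in auto)
  moreover have "k > 0"
  proof (rule ccontr)
    assume "\<not> k > 0"
    then have "a 0 \<in> M" using calculation dep(2) by simp
    then show False using ind[OF a(1)[of 0]] kN \<open>\<not> k > 0\<close> by simp
  qed
  ultimately show ?thesis using a(1) kN dep(2) by blast
qed

lemma mpoly_prod_nonzero: "finite A \<Longrightarrow> (\<And>a. a \<in> A \<Longrightarrow> f a \<noteq> 0) \<Longrightarrow> prod f A \<noteq> (0 :: ('n::finite, 'k::field) mpoly)"
  by (induction A rule: finite_induct) (auto simp: mpoly_no_zero_divisors)

text \<open>The \<open>K[F]\<close>-module generated by the monomials of \<open>B\<close>, modulo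
  \<open>M\<close>.\<close>

definition Fspan :: "'n::finite set \<Rightarrow> ('n \<Rightarrow>\<^sub>0 nat) set \<Rightarrow> ('n, 'k::field) mpoly set \<Rightarrow> ('n, 'k) mpoly set" where
  "Fspan F B M = {p. \<exists>e. (\<forall>b. e b \<in> VF F) \<and> p - (\<Sum>b\<in>B. e b * monomial b) \<in> M}"

lemma Fspan_M: "p \<in> M \<Longrightarrow> p \<in> Fspan F B M"
  unfolding Fspan_def by (intro CollectI exI[of _ "\<lambda>_. 0"]) (auto simp: VF_zero)

lemma Fspan_add:
  assumes M: "idl.subspace M" and "p \<in> Fspan F B M" "q \<in> Fspan F B M" shows "p + q \<in> Fspan F B M"
proof -
  obtain r s where r: "\<And>b. r b \<in> VF F" "p - (\<Sum>b\<in>B. r b * monomial b) \<in> M"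
    and s: "\<And>b. s b \<in> VF F" "q - (\<Sum>b\<in>B. s b * monomial b) \<in> M"
    using assms(2,3) unfolding Fspan_def by blast
  have "(p - (\<Sum>b\<in>B. r b * monomial b)) + (q - (\<Sum>b\<in>B. s b * monomial b)) \<in> M"
    by (rule idl.subspace_add[OF M r(2) s(2)])
  also have "(p - (\<Sum>b\<in>B. r b * monomial b)) + (q - (\<Sum>b\<in>B. s b * monomial b)) =
      p + q - (\<Sum>b\<in>B. (r b + s b) * monomial b)"
    by (simp add: distrib_right sum.distrib)
  finally show ?thesis unfolding Fspan_def
    by (intro CollectI exI[of _ "\<lambda>b. r b + s b"]) (auto intro: VF_add r s)
qed

lemma Fspan_scale:
  assumes M: "idl.subspace M" and "p \<in> Fspan F B M" "c \<in> VF F" shows "c * p \<in> Fspan F B M"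
proof -
  obtain r where r: "\<And>b. r b \<in> VF F" "p - (\<Sum>b\<in>B. r b * monomial b) \<in> M"
    using assms(2) unfolding Fspan_def by blast
  have "c * (p - (\<Sum>b\<in>B. r b * monomial b)) \<in> M" by (rule ideal_mult(1)[OF M r(2)])
  also have "c * (p - (\<Sum>b\<in>B. r b * monomial b)) = c * p - (\<Sum>b\<in>B. (c * r b) * monomial b)"
    by (simp add: right_diff_distrib sum_distrib_left mult.assoc)
  finally show ?thesis unfolding Fspan_def
    by (intro CollectI exI[of _ "\<lambda>b. c * r b"]) (auto intro: VF_mult r assms(3))
qed

lemma Fspan_base:
  fixes M :: "('n::finite, 'k::field) mpoly set"
  assumes "idl.subspace M" "finite B" "b \<in> B" shows "monomial b \<in> Fspan F B M"
proof -
  have "(\<Sum>h\<in>B. (if h = b then 1 else 0) * monomial h) = (\<Sum>h\<in>B. if h = b then monomial h else 0 :: ('n, 'k) mpoly)"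
    by (intro sum.cong) auto
  also have "\<dots> = monomial b" using assms by simp
  finally show ?thesis using idl.subspace_0[OF assms(1)]
    unfolding Fspan_def by (intro CollectI exI[of _ "\<lambda>h. if h = b then 1 else 0"]) (auto simp: VF_zero VF_one)
qed

lemma Fspan_sum:
  "idl.subspace M \<Longrightarrow> (\<And>a. a \<in> A \<Longrightarrow> f a \<in> Fspan F B M) \<Longrightarrow> sum f A \<in> Fspan F B M"
  by (induction A rule: infinite_finite_induct)
     (auto intro: Fspan_add Fspan_M idl.subspace_0)

lemma Fspan_mult:
  assumes M: "idl.subspace M" and "\<And>b. b \<in> B \<Longrightarrow> x * monomial b \<in> Fspan F B M" and "p \<in> Fspan F B M"
  shows "x * p \<in> Fspan F B M"
proof -
  obtain r where r: "\<And>b. r b \<in> VF F" "p - (\<Sum>b\<in>B. r b * monomial b) \<in> M"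
    using assms(3) unfolding Fspan_def by blast
  have "x * p = (\<Sum>b\<in>B. r b * (x * monomial b)) + x * (p - (\<Sum>b\<in>B. r b * monomial b))"
    by (simp add: right_diff_distrib sum_distrib_left mult.left_commute)
  moreover have "(\<Sum>b\<in>B. r b * (x * monomial b)) \<in> Fspan F B M"
    by (intro Fspan_sum[OF M]) (rule Fspan_scale[OF M assms(2) r(1)])
  ultimately show ?thesis using Fspan_add[OF M _ Fspan_M[OF ideal_mult(1)[OF M r(2), of x]]] by simp
qed

lemma mpoly_induct_var:
  assumes add: "\<And>p q. p \<in> Y \<Longrightarrow> q \<in> Y \<Longrightarrow> p + q \<in> Y" and const: "\<And>c p. p \<in> Y \<Longrightarrow> const c * p \<in> Y"
    and var: "\<And>j p. p \<in> Y \<Longrightarrow> var j * p \<in> Y" and one: "1 \<in> Y"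
  shows "(p :: ('n::finite, 'k::field) mpoly) \<in> Y"
proof -
  have mon: "monomial m \<in> Y" for m
  proof (induction "mdeg m" arbitrary: m rule: less_induct)
    case (less m)
    show ?case
    proof (cases "m = 0")
      case True then show ?thesis using one by simp
    next
      case False
      then obtain j where j: "lookup m j > 0"
        by (metis bot_nat_0.not_eq_extremum lookup_zero poly_mapping_eqI)
      have "mdeg m = mdeg (m - Poly_Mapping.single j 1) + 1"
      proof -
        have "m = (m - Poly_Mapping.single j 1) + Poly_Mapping.single j 1"
          by (rule poly_mapping_eqI) (use j in \<open>auto simp: lookup_add lookup_minus lookup_single when_def\<close>)
        then show ?thesis by (metis mdeg_add mdeg_single)
      qed
      then have "monomial (m - Poly_Mapping.single j 1) \<in> Y" using less by simp
      then show ?thesis using var[of _ j] monomial_var_split[OF j] by (metis mult.commute)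
    qed
  qed
  have zero: "0 \<in> Y" using const[OF one, of 0] by simp
  have "(\<Sum>m\<in>A. const (lookup p m) * monomial m) \<in> Y" for A
    by (induction A rule: infinite_finite_induct) (auto intro: zero add const mon)
  then show ?thesis using poly_expand[of p] by metis
qed

text \<open>Over \<open>K[F][1/a]\<close>, with \<open>a\<close> the product of the leading
  coefficients, every variable outside \<open>F\<close> is integral modulo \<open>M\<close>, so
  finitely many monomials generate. The fractions are cleared by powers of \<open>a\<close>.\<close>

lemma localized_finite:
  fixes M :: "('n::finite, 'k::field) mpoly set"
  assumes M: "idl.subspace M"
    and alg: "\<And>j. j \<notin> F \<Longrightarrow> \<exists>k a. k > 0 \<and> (\<forall>i. a i \<in> VF F) \<and> a k \<noteq> 0 \<and> (\<Sum>i\<le>k. a i * var j ^ i) \<in> M"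
  shows "\<exists>a B. a \<in> VF F \<and> a \<noteq> 0 \<and> finite B \<and> (\<forall>p. \<exists>N. a ^ N * p \<in> Fspan F B M)"
proof -
  have "\<forall>j. \<exists>k a. j \<notin> F \<longrightarrow> k > 0 \<and> (\<forall>i. a i \<in> VF F) \<and> a k \<noteq> 0 \<and> (\<Sum>i\<le>k. a i * var j ^ i) \<in> M"
    using alg by blast
  from choice[OF this] obtain k where
    "\<forall>j. \<exists>a. j \<notin> F \<longrightarrow> k j > 0 \<and> (\<forall>i. a i \<in> VF F) \<and> a (k j) \<noteq> 0 \<and> (\<Sum>i\<le>k j. a i * var j ^ i) \<in> M"
    by auto
  from choice[OF this] obtain c where c: "\<And>j. j \<notin> F \<Longrightarrow> k j > 0" "\<And>j i. j \<notin> F \<Longrightarrow> c j i \<in> VF F"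
    "\<And>j. j \<notin> F \<Longrightarrow> c j (k j) \<noteq> 0" "\<And>j. j \<notin> F \<Longrightarrow> (\<Sum>i\<le>k j. c j i * var j ^ i) \<in> M" by auto
  define a where "a = (\<Prod>j\<in>-F. c j (k j))"
  define B where "B = {b. keys b \<subseteq> -F \<and> (\<forall>j\<in>-F. lookup b j < k j)}"
  have aF: "a \<in> VF F" unfolding a_def using c(2) by (intro VF_prod) auto
  have "a \<noteq> 0" unfolding a_def using c(3) by (intro mpoly_prod_nonzero) auto
  have finB: "finite B"
  proof (rule finite_subset[OF _ finite_mdeg_le[of "\<Sum>j\<in>UNIV. k j"]], clarify)
    fix b assume b: "b \<in> B"
    have "lookup b j \<le> k j" for j
    proof (cases "j \<in> F")
      case True
      then have "j \<notin> keys b" using b by (auto simp: B_def)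
      then show ?thesis by (simp add: in_keys_iff)
    qed (use b in \<open>auto simp: B_def less_imp_le\<close>)
    then show "mdeg b \<le> (\<Sum>j\<in>UNIV. k j)" unfolding mdeg_def by (rule sum_mono)
  qed
  note W = Fspan_add[OF M] Fspan_scale[OF M] Fspan_base[OF M finB]
  have base: "a * var j * monomial b \<in> Fspan F B M" if b: "b \<in> B" for j b
  proof (cases "j \<in> F")
    case True
    then show ?thesis using b by (intro W(2,3) VF_mult aF VF_var)
  next
    case j: False
    show ?thesis
    proof (cases "Suc (lookup b j) < k j")
      case True
      have "b + Poly_Mapping.single j 1 \<in> B"
        using b j True keys_add[of b "Poly_Mapping.single j 1"]
        by (auto simp: B_def lookup_add lookup_single when_def)
      then have "a * monomial (b + Poly_Mapping.single j 1) \<in> Fspan F B M" by (intro W(2,3) aF)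
      then show ?thesis by (simp add: monomial_add var_def mult_ac)
    next
      case False
      moreover have "lookup b j < k j" using b j by (auto simp: B_def)
      ultimately have bj: "Suc (lookup b j) = k j" by simp
      define b' where "b' = b - Poly_Mapping.single j (lookup b j)"
      have bb: "b = b' + Poly_Mapping.single j (lookup b j)" unfolding b'_def
        by (rule poly_mapping_eqI) (auto simp: lookup_add lookup_minus lookup_single when_def)
      have b'j: "lookup b' j = 0" by (simp add: b'_def lookup_minus)
      have inB: "b' + Poly_Mapping.single j i \<in> B" if "i < k j" for i
      proof -
        have "lookup (b' + Poly_Mapping.single j i) l = (if l = j then i else lookup b l)" for l
          by (simp add: b'_def lookup_add lookup_minus lookup_single when_def)
        moreover have "lookup b l = 0" if "l \<in> F" for l
        proof -
          have "l \<notin> keys b" using b that by (auto simp: B_def)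
          then show ?thesis by (simp add: in_keys_iff)
        qed
        ultimately show ?thesis using b j that unfolding B_def by (auto simp: in_keys_iff split: if_splits)
      qed
      \<comment> \<open>\<open>a\<close> without the factor belonging to \<open>j\<close>:
        multiplied by \<open>a'\<close>, the relation for \<open>var j\<close> has leading
        coefficient \<open>a\<close> and rewrites \<open>a * var j ^ k j\<close> into lower
        powers.\<close>
      define a' where "a' = (\<Prod>j\<in>-F - {j}. c j (k j))"
      have a: "a = a' * c j (k j)" unfolding a_def a'_def using j by (subst prod.remove[of _ j]) (auto simp: mult.commute)
      have a'F: "a' \<in> VF F" unfolding a'_def using c(2) by (intro VF_prod) auto
      have vb: "var j * monomial b = monomial b' * var j ^ k j"
        by (subst bb) (simp add: monomial_add var_power[symmetric] bj[symmetric] mult_ac)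
      have split: "(\<Sum>i\<le>k j. c j i * var j ^ i) = (\<Sum>i<k j. c j i * var j ^ i) + c j (k j) * var j ^ k j"
        by (simp add: lessThan_Suc_atMost[symmetric])
      have "a * var j * monomial b = a' * c j (k j) * (var j * monomial b)" by (simp add: a mult_ac)
      also have "\<dots> = a' * monomial b' * (\<Sum>i\<le>k j. c j i * var j ^ i) + (\<Sum>i<k j. - (a' * c j i) * (monomial b' * var j ^ i))"
        unfolding vb split by (simp add: sum_distrib_left sum_negf algebra_simps)
      finally have eq: "a * var j * monomial b =
          a' * monomial b' * (\<Sum>i\<le>k j. c j i * var j ^ i) + (\<Sum>i<k j. - (a' * c j i) * (monomial b' * var j ^ i))" .
      have inW: "monomial b' * var j ^ i \<in> Fspan F B M" if "i < k j" for i
        using W(3)[OF inB[OF that], of F] by (simp add: monomial_add var_power)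
      have f2: "(\<Sum>i<k j. - (a' * c j i) * (monomial b' * var j ^ i)) \<in> Fspan F B M"
        using VF_uminus[OF VF_mult[OF a'F c(2)[OF j]]] by (intro Fspan_sum[OF M]) (rule W(2), simp_all add: inW)
      have f1: "a' * monomial b' * (\<Sum>i\<le>k j. c j i * var j ^ i) \<in> Fspan F B M"
        by (rule Fspan_M[OF ideal_mult(1)[OF M c(4)[OF j]]])
      show ?thesis unfolding eq by (rule W(1)[OF f1 f2])
    qed
  qed
  have "p \<in> {p. \<exists>N. a ^ N * p \<in> Fspan F B M}" for p
  proof (rule mpoly_induct_var)
    fix p q assume "p \<in> {p. \<exists>N. a ^ N * p \<in> Fspan F B M}" "q \<in> {p. \<exists>N. a ^ N * p \<in> Fspan F B M}"
    then obtain N N' where "a ^ N * p \<in> Fspan F B M" "a ^ N' * q \<in> Fspan F B M" by blast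
    then have "a ^ N' * (a ^ N * p) + a ^ N * (a ^ N' * q) \<in> Fspan F B M"
      using W(1)[OF W(2)[OF _ VF_power[OF aF]] W(2)[OF _ VF_power[OF aF]]] by blast
    moreover have "a ^ (N + N') * (p + q) = a ^ N' * (a ^ N * p) + a ^ N * (a ^ N' * q)"
      by (simp add: power_add algebra_simps)
    ultimately have "a ^ (N + N') * (p + q) \<in> Fspan F B M" by (simp only:)
    then show "p + q \<in> {p. \<exists>N. a ^ N * p \<in> Fspan F B M}" by blast
  next
    fix d p assume "p \<in> {p. \<exists>N. a ^ N * p \<in> Fspan F B M}"
    then obtain N where "a ^ N * p \<in> Fspan F B M" by blast
    then have "const d * (a ^ N * p) \<in> Fspan F B M" by (rule W(2)[OF _ VF_const])
    moreover have "a ^ N * (const d * p) = const d * (a ^ N * p)" by (rule mult.left_commute)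
    ultimately have "a ^ N * (const d * p) \<in> Fspan F B M" by (simp only:)
    then show "const d * p \<in> {p. \<exists>N. a ^ N * p \<in> Fspan F B M}" by blast
  next
    fix j p assume "p \<in> {p. \<exists>N. a ^ N * p \<in> Fspan F B M}"
    then obtain N where "a ^ N * p \<in> Fspan F B M" by blast
    with base have "a * var j * (a ^ N * p) \<in> Fspan F B M" by (rule Fspan_mult[OF M])
    moreover have "a ^ Suc N * (var j * p) = a * var j * (a ^ N * p)" by (simp add: mult_ac)
    ultimately have "a ^ Suc N * (var j * p) \<in> Fspan F B M" by (simp only:)
    then show "var j * p \<in> {p. \<exists>N. a ^ N * p \<in> Fspan F B M}" by blast
  next
    have "0 \<in> B" using c(1) by (simp add: B_def)
    then have "a ^ 0 * 1 \<in> Fspan F B M" using W(3)[of 0] by simp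
    then show "1 \<in> {p. \<exists>N. a ^ N * p \<in> Fspan F B M}" by blast
  qed
  then show ?thesis using aF \<open>a \<noteq> 0\<close> finB by blast
qed

text \<open>Nakayama's lemma for the module generated by the \<open>monomial b\<close>, one generator at a time.\<close>

lemma eliminate_generators:
  fixes M :: "('n::finite, 'k::field) mpoly set"
  assumes M: "idl.subspace M" and aF: "a \<in> VF F" and hF: "h \<in> VF F" and h: "h * h' - 1 \<in> M"
    and T: "T = {c \<in> VF F. \<exists>N. \<exists>g\<in>VF F. c = a ^ N + h * g}"
    and "finite B" "\<And>p. \<exists>c\<in>T. c * p \<in> Fspan F B M"
  shows "\<exists>c\<in>T. c \<in> M"
  using assms(6,7)
proof (induction B rule: finite_induct)
  case empty
  then obtain c where "c \<in> T" "c * 1 \<in> Fspan F {} M" by blast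
  then show ?case by (auto simp: Fspan_def)
next
  case (insert b B)
  have TF: "c \<in> VF F" if "c \<in> T" for c using that T by simp
  have T_mult: "c * d \<in> T" if cd: "c \<in> T" "d \<in> T" for c d
  proof -
    obtain N g N' g' where g: "g \<in> VF F" "c = a ^ N + h * g" "g' \<in> VF F" "d = a ^ N' + h * g'"
      using cd unfolding T by blast
    have "c * d = a ^ (N + N') + h * (g * d + a ^ N * g')"
      by (simp add: g(2,4) power_add algebra_simps)
    moreover have "g * d + a ^ N * g' \<in> VF F" by (intro VF_add VF_mult VF_power aF g TF cd)
    ultimately show ?thesis using TF cd VF_mult unfolding T by blast
  qed
  have Fs: "p - e b * monomial b \<in> Fspan F B M"
    if "\<And>b. e b \<in> VF F" "p - (\<Sum>b\<in>insert b B. e b * monomial b) \<in> M" for p e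
    using that insert.hyps unfolding Fspan_def by (intro CollectI exI[of _ e]) (simp add: diff_diff_add)
  obtain c e where c: "c \<in> T" "\<And>b. e b \<in> VF F" "c * (h' * monomial b) - (\<Sum>b\<in>insert b B. e b * monomial b) \<in> M"
    using insert.prems[of "h' * monomial b"] unfolding Fspan_def by blast
  \<comment> \<open>The relation for \<open>h' * monomial b\<close>, multiplied by \<open>h\<close>
    and simplified by \<open>h * h' = 1\<close> modulo \<open>M\<close>, expresses
    \<open>(c - h * e b) * monomial b\<close> through the remaining generators. The new factor stays
    in \<open>T\<close>, whose elements are congruent to powers of \<open>a\<close> modulo
    \<open>h\<close>.\<close>
  define c' where "c' = c - h * e b"
  have c'T: "c' \<in> T"
  proof -
    obtain N g where g: "g \<in> VF F" "c = a ^ N + h * g" using c(1) unfolding T by blast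
    have "c' = a ^ N + h * (g - e b)" by (simp add: c'_def g(2) algebra_simps)
    moreover have "c' \<in> VF F" unfolding c'_def by (intro VF_diff VF_mult TF[OF c(1)] hF c(2))
    ultimately show ?thesis using VF_diff[OF g(1) c(2)] unfolding T by blast
  qed
  have "- (c * monomial b) * (h * h' - 1) + h * (c * (h' * monomial b) - e b * monomial b) \<in> Fspan F B M"
    by (rule Fspan_add[OF M Fspan_M[OF ideal_mult(1)[OF M h]] Fspan_scale[OF M Fs[OF c(2,3)] hF]])
  also have "- (c * monomial b) * (h * h' - 1) + h * (c * (h' * monomial b) - e b * monomial b) = c' * monomial b"
    by (simp add: c'_def algebra_simps)
  finally have c'b: "c' * monomial b \<in> Fspan F B M" .
  show ?case
  proof (rule insert.IH)
    fix p
    obtain d f where d: "d \<in> T" "\<And>b. f b \<in> VF F" "d * p - (\<Sum>b\<in>insert b B. f b * monomial b) \<in> M"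
      using insert.prems[of p] unfolding Fspan_def by blast
    have "c' * (d * p - f b * monomial b) + f b * (c' * monomial b) \<in> Fspan F B M"
      by (intro Fspan_add[OF M] Fspan_scale[OF M] Fs[OF d(2,3)] c'b TF c'T d(2))
    also have "c' * (d * p - f b * monomial b) + f b * (c' * monomial b) = (c' * d) * p"
      by (simp add: algebra_simps)
    finally show "\<exists>c\<in>T. c * p \<in> Fspan F B M" using T_mult[OF c'T d(1)] by blast
  qed
qed

lemma top_degree:
  assumes "p \<noteq> (0 :: ('n::finite, 'k::field) mpoly)"
  obtains s where "dlt (Suc s) p" "hcomp s p \<noteq> 0"
proof -
  define s where "s = (LEAST s. dlt s p)"
  have s: "dlt s p" unfolding s_def using dlt_exists by (rule LeastI_ex)
  then have "s \<noteq> 0" using assms dlt_0_iff by metis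
  then have "\<not> dlt (s - 1) p" unfolding s_def using not_less_Least[of "(LEAST s. dlt s p) - 1" "\<lambda>s. dlt s p"] by simp
  moreover have "dlt (Suc (s - 1)) p" using s \<open>s \<noteq> 0\<close> by simp
  ultimately show ?thesis using that[of "s - 1"] dlt_Suc_iff by blast
qed

text \<open>The top component of the product is the product of the top components, and it has
  positive degree because of the factor \<open>var j\<close>.\<close>

lemma one_plus_not_unit:
  fixes a :: "('n::finite, 'k::field) mpoly"
  assumes "a \<noteq> 0" shows "(1 + a * var j) * u \<noteq> 1"
proof
  assume u: "(1 + a * var j) * u = 1"
  then have "u \<noteq> 0" by auto
  obtain s where s: "dlt (Suc s) a" "hcomp s a \<noteq> 0" using top_degree[OF assms] .
  obtain t where t: "dlt (Suc t) u" "hcomp t u \<noteq> 0" using top_degree[OF \<open>u \<noteq> 0\<close>] .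
  define h where "h = 1 + a * var j"
  have "hcomp (Suc s) (a * var j) = hcomp s a * var j"
    using hcomp_mult_homogeneous[OF homogeneous_var, of "Suc s" a j] by simp
  moreover have "hcomp (Suc s) (1 :: ('n, 'k) mpoly) = 0" by (simp add: hcomp_homogeneous[OF homogeneous_one])
  ultimately have h1: "hcomp (Suc s) h = hcomp s a * var j" by (simp add: h_def hcomp_add)
  have var0: "var j \<noteq> (0 :: ('n, 'k) mpoly)" using keys_monomial[of "Poly_Mapping.single j 1"] by (metis var_def keys_zero insert_not_empty)
  have h2: "dlt (Suc (Suc s)) h" unfolding h_def
    using dlt_mult[OF s(1) dlt_homogeneous[OF homogeneous_var[of j]]] dlt_homogeneous[OF homogeneous_one]
    by (intro dlt_add) (auto intro: dlt_mono)
  have "hcomp (Suc s + t) (h * u) = (\<Sum>i\<le>Suc s + t. hcomp i h * hcomp (Suc s + t - i) u)" by (rule hcomp_mult)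
  also have "\<dots> = (\<Sum>i\<le>Suc s + t. if i = Suc s then hcomp (Suc s) h * hcomp t u else 0)"
  proof (intro sum.cong refl)
    fix i assume "i \<in> {..Suc s + t}"
    show "hcomp i h * hcomp (Suc s + t - i) u = (if i = Suc s then hcomp (Suc s) h * hcomp t u else 0)"
    proof (cases i "Suc s" rule: linorder_cases)
      case less
      then have "hcomp (Suc s + t - i) u = 0" by (intro hcomp_dlt[OF t(1)]) simp
      then show ?thesis using less by simp
    next
      case greater
      then have "hcomp i h = 0" by (intro hcomp_dlt[OF h2]) simp
      then show ?thesis using greater by simp
    qed simp
  qed
  also have "\<dots> = hcomp (Suc s) h * hcomp t u" by simp
  finally have "hcomp (Suc s + t) 1 = hcomp s a * var j * hcomp t u" using u h1 by (simp add: h_def)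
  moreover have "hcomp (Suc s + t) (1 :: ('n, 'k) mpoly) = 0" by (simp add: hcomp_homogeneous[OF homogeneous_one])
  ultimately show False using s(2) t(2) var0 mpoly_no_zero_divisors by metis
qed

text \<open>Modulo \<open>h\<close> the element \<open>h - 1\<close> is \<open>-1\<close>, a
  unit.\<close>

lemma dvd_power_diff_one:
  fixes h :: "'a::comm_ring_1" assumes "h dvd (h - 1) ^ N" shows "h dvd 1"
  using assms
proof (induction N)
  case (Suc N)
  have "h * (h - 1) ^ N - (h - 1) ^ Suc N = (h - 1) ^ N" by (simp add: algebra_simps)
  then show ?case using Suc by (metis dvd_diff dvd_triv_left)
qed simp

lemma lookup_var_0: "lookup (var (j :: 'n::finite)) 0 = 0"
  using var_in_mm[of j] by (simp add: mm_def)

theorem zariski: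
  fixes M :: "('n::finite, 'k::field) mpoly set"
  assumes prime: "prime_set M" and mx: "\<And>p. p \<notin> M \<Longrightarrow> \<exists>q. p * q - 1 \<in> M"
  shows "\<exists>N c. (\<exists>i\<le>N. c i \<noteq> 0) \<and> (\<Sum>i\<le>N. const (c i) * f ^ i) \<in> M"
proof -
  note Mid = prime_setD(1)[OF prime]
  define ind where "ind F \<longleftrightarrow> (\<forall>p\<in>VF F. p \<in> M \<longrightarrow> p = 0)" for F
  have const_VF: "\<exists>c. p = const c" if p: "p \<in> VF {}" for p :: "('n, 'k) mpoly"
  proof -
    have "lookup p m = lookup (const (lookup p 0)) m" for m
      using p by (cases "m = 0") (auto simp: VF_def const_def lookup_single when_def in_keys_iff)
    then show ?thesis using poly_mapping_eqI by blast
  qed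
  have "ind {}" unfolding ind_def using const_VF prime_const[OF prime] const_simps(1) by metis
  then have "{F. ind F} \<noteq> {}" by blast
  \<comment> \<open>A maximal set of variables that are algebraically independent modulo
    \<open>M\<close>.\<close>
  then obtain F where F: "ind F" "\<And>F'. ind F' \<Longrightarrow> F \<subseteq> F' \<Longrightarrow> F = F'"
    using finite_has_maximal[of "{F. ind F}"] by auto
  have "\<exists>k a. k > 0 \<and> (\<forall>i. a i \<in> VF F) \<and> a k \<noteq> 0 \<and> (\<Sum>i\<le>k. a i * var j ^ i) \<in> M" if j: "j \<notin> F" for j
  proof -
    have "\<not> ind (insert j F)" using F(2)[of "insert j F"] j by blast
    then obtain g where "g \<in> VF (insert j F)" "g \<in> M" "g \<noteq> 0" by (auto simp: ind_def)
    then show ?thesis using F(1) by (intro algebraic_var[OF j]) (auto simp: ind_def)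
  qed
  then obtain a B where a: "a \<in> VF F" "a \<noteq> 0" "finite B" "\<And>p. \<exists>N. a ^ N * p \<in> Fspan F B M"
    using localized_finite[OF Mid, of F] by blast
  have "F = {}"
  proof (rule ccontr)
    assume "F \<noteq> {}"
    then obtain j where j: "j \<in> F" by blast
    \<comment> \<open>\<open>h\<close> is a nonzero element of \<open>K[F]\<close>, hence invertible
      modulo \<open>M\<close>, and \<open>eliminate_generators\<close> makes it divide a power of
      \<open>a\<close>. As \<open>h - 1\<close> is \<open>a * var j\<close>, it divides a power of
      \<open>h - 1\<close> and therefore \<open>1\<close>, against its degree.\<close>
    define h where "h = 1 + a * var j"
    have hF: "h \<in> VF F" unfolding h_def by (intro VF_add VF_one VF_mult a VF_var j)
    have "lookup h 0 = 1" by (simp add: h_def lookup_add lookup_mult_0 lookup_var_0 lookup_one)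
    then have "h \<noteq> 0" by auto
    then have "h \<notin> M" using F(1) hF by (auto simp: ind_def)
    then obtain h' where h': "h * h' - 1 \<in> M" using mx by blast
    define T where "T = {c \<in> VF F. \<exists>N. \<exists>g\<in>VF F. c = a ^ N + h * g}"
    have "\<exists>c\<in>T. c * p \<in> Fspan F B M" for p
    proof -
      obtain N where "a ^ N * p \<in> Fspan F B M" using a(4) by blast
      moreover have "a ^ N = a ^ N + h * 0" by simp
      then have "a ^ N \<in> T" unfolding T_def using VF_power[OF a(1)] VF_zero by blast
      ultimately show ?thesis by blast
    qed
    then obtain c where c: "c \<in> T" "c \<in> M"
      using eliminate_generators[OF Mid a(1) hF h' T_def a(3)] by blast
    then have "c = 0" using F(1) by (auto simp: T_def ind_def)
    then obtain N g where "a ^ N + h * g = 0" using c(1) by (auto simp: T_def)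
    then have "a ^ N = h * (- g)" by (simp add: eq_neg_iff_add_eq_0)
    then have "(h - 1) ^ N = h * (- g * var j ^ N)" by (simp add: h_def power_mult_distrib mult.assoc)
    then have "h dvd 1" using dvd_power_diff_one by (metis dvd_triv_left)
    then show False using one_plus_not_unit[OF a(2), of j] by (metis dvdE h_def)
  qed
  then obtain c0 where c0: "a = const c0" using const_VF a(1) by blast
  have "p \<in> kspan (monomial ` B) M" for p
  proof -
    obtain N where "a ^ N * p \<in> Fspan F B M" using a(4) by blast
    then obtain e where e: "\<And>b. e b \<in> VF {}" "a ^ N * p - (\<Sum>b\<in>B. e b * monomial b) \<in> M"
      using \<open>F = {}\<close> by (auto simp: Fspan_def)
    have "e b * monomial b \<in> kspan (monomial ` B) M" if "b \<in> B" for b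
      using const_VF[OF e(1)[of b]] kspan_const[OF Mid kspan_base[OF Mid, of "monomial ` B" "monomial b"]] that a(3)
      by auto
    then have "(a ^ N * p - (\<Sum>b\<in>B. e b * monomial b)) + (\<Sum>b\<in>B. e b * monomial b) \<in> kspan (monomial ` B) M"
      by (intro kspan_add[OF Mid kspan_J[OF e(2)] kspan_sum[OF Mid]])
    then have "const (c0 ^ N) * p \<in> kspan (monomial ` B) M" by (simp add: c0 const_power)
    then have 1: "const (inverse (c0 ^ N)) * (const (c0 ^ N) * p) \<in> kspan (monomial ` B) M"
      by (rule kspan_const[OF Mid])
    have "c0 ^ N \<noteq> 0" using a(2) c0 const_eq_0[of c0] by auto
    then have "const (inverse (c0 ^ N)) * (const (c0 ^ N) * p) = p"
      by (simp add: mult.assoc[symmetric] const_inverse del: inverse_eq_divide power_inverse)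
    then show ?thesis using 1 by metis
  qed
  \<comment> \<open>The exponents up to the number of generators give one more power of
    \<open>f\<close> than there are generators.\<close>
  moreover have "card (monomial ` B :: ('n, 'k) mpoly set) < card {..card (monomial ` B :: ('n, 'k) mpoly set)}" by simp
  ultimately show ?thesis
    using kspan_dependent[OF Mid, of "monomial ` B" "{..card (monomial ` B :: ('n, 'k) mpoly set)}" "\<lambda>i. f ^ i"] a(3)
    by auto
qed

section \<open>Regularity of homogeneous systems of parameters\<close>

lemma at_prime_mpoly: "prime_set M \<Longrightarrow> at_prime (M :: ('n::finite, 'k::field) mpoly set)"
  by (simp add: at_prime_def noeth_mpoly)

lemma span_Un_span: "idl.span (idl.span A \<union> C) = idl.span (A \<union> C)"
  for A :: "'a::comm_ring_1 set"
proof (rule subset_antisym)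
  have "idl.span A \<subseteq> idl.span (A \<union> C)" "C \<subseteq> idl.span (A \<union> C)"
    using idl.span_mono[of A "A \<union> C"] idl.span_superset[of "A \<union> C"] by auto
  then show "idl.span (idl.span A \<union> C) \<subseteq> idl.span (A \<union> C)"
    by (intro idl.span_minimal) auto
  show "idl.span (A \<union> C) \<subseteq> idl.span (idl.span A \<union> C)"
    using idl.span_superset[of A] by (intro idl.span_mono) auto
qed

lemma ext_hideal: "hideal J \<Longrightarrow> homogeneous e q \<Longrightarrow> ext mm J q = idl.span (insert q J)"
  unfolding ext_def by (intro sat_hideal hideal_insert)

lemma sid_hideal: "hideal J \<Longrightarrow> at_prime.sid mm J"
  using at_prime.sid_sat[OF at_prime_mpoly[OF prime_mm], of J] sat_hideal[of J]
  by (simp add: hideal_def)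

lemma parameters_chain_bound:
  fixes J :: "('n::finite, 'k::field) mpoly set"
  assumes J: "hideal J" and qs: "\<And>q. q \<in> set qs \<Longrightarrow> \<exists>e>0. homogeneous e q"
    and rad: "\<And>j. \<exists>k. var j ^ k \<in> idl.span (J \<union> set qs)"
    and chain: "prime_chain P l" "J \<subseteq> P 0"
  shows "l \<le> length qs"
proof -
  have "\<forall>j. \<exists>k. var j ^ k \<in> idl.span (J \<union> set qs)" using rad by blast
  from choice[OF this] obtain k where k: "\<And>j. var j ^ k j \<in> idl.span (J \<union> set qs)" by auto
  \<comment> \<open>The sum dominates every single exponent, and the successor makes the common
    exponent positive.\<close>
  define K where "K = Suc (\<Sum>j\<in>UNIV. k j)"
  have "K > 0" by (simp add: K_def)
  have K: "var j ^ K \<in> idl.span (J \<union> set qs)" for j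
  proof -
    have "k j \<le> K" unfolding K_def using member_le_sum[of j UNIV k] by simp
    then have "var j ^ K = var j ^ (K - k j) * var j ^ k j" by (simp flip: power_add)
    then show ?thesis using k[of j] idl.span_scale by metis
  qed
  have "\<forall>i. \<exists>e. i < length qs \<longrightarrow> homogeneous e (qs ! i) \<and> e > 0" using qs nth_mem by blast
  from choice[OF this] obtain e where "\<And>i. i < length qs \<Longrightarrow> homogeneous (e i) (qs ! i) \<and> e i > 0" by auto
  then interpret parameters J qs K e using J K \<open>K > 0\<close> by unfold_locales auto
  show ?thesis by (rule prime_chain_bound[OF chain])
qed

lemma homogeneous_rseq:
  fixes J :: "('n::finite, 'k::field) mpoly set"
  assumes "hideal J" "\<And>q. q \<in> set qs \<Longrightarrow> \<exists>e>0. homogeneous e q"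
    and "\<And>j. \<exists>k. var j ^ k \<in> idl.span (J \<union> set qs)"
    and "dep mm (length qs) J"
  shows "rseq J qs"
  using assms
proof (induction qs arbitrary: J)
  case Nil
  then show ?case by simp
next
  case (Cons q qs)
  interpret at_prime mm by (rule at_prime_mpoly[OF prime_mm])
  obtain e where e: "e > 0" "homogeneous e q" using Cons.prems(2)[of q] by auto
  have sidJ: "sid J" by (rule sid_hideal[OF Cons.prems(1)])
  have h': "hideal (idl.span (insert q J))" by (rule hideal_insert[OF Cons.prems(1) e(2)])
  have rad': "\<exists>k. var j ^ k \<in> idl.span (idl.span (insert q J) \<union> set qs)" for j
    using Cons.prems(3)[of j] by (simp add: span_Un_span)
  have r: "reg J q"
  proof (rule ccontr)
    assume "\<not> reg J q"
    then obtain s where s: "q * s \<in> J" "s \<notin> J" by (auto simp: reg_def)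
    have "\<exists>Q. prime_chain Q (length (q # qs)) \<and> {q} \<union> J \<subseteq> Q 0 \<and> Q (length (q # qs)) \<subseteq> mm"
      by (rule dep_assoc_chain[OF sidJ Cons.prems(4) s(2)]) (use s(1) in simp)
    then obtain Q where Q: "prime_chain Q (length (q # qs))" "{q} \<union> J \<subseteq> Q 0" by blast
    have "idl.subspace (Q 0)" using Q(1) by (simp add: prime_chain_def prime_set_def)
    then have "idl.span (insert q J) \<subseteq> Q 0" using Q(2) by (intro idl.span_minimal) auto
    \<comment> \<open>Modulo \<open>q\<close> the remaining \<open>qs\<close> are still parameters,
      one fewer than the length of the chain.\<close>
    then have "length (q # qs) \<le> length qs"
      using Cons.prems(2) by (intro parameters_chain_bound[OF h' _ rad' Q(1)]) auto
    then show False by simp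
  qed
  have "q \<in> mm" using homogeneous_in_mm[OF e(2,1)] .
  then have "dep mm (length qs) (idl.span (insert q J))"
    using dep_ext[OF sidJ _ _ r, of "length qs"] Cons.prems(4) by (simp add: ext_hideal[OF Cons.prems(1) e(2)])
  then have "rseq (idl.span (insert q J)) qs" using Cons.prems(2) by (intro Cons.IH[OF h' _ rad']) auto
  then show ?case using r by simp
qed

text \<open>Regularity survives localization, since a denominator can be moved onto the other
  factor. Saturating before \<open>x\<close> is adjoined gives the same result as saturating only
  afterwards.\<close>

lemma (in at_prime) rseq_imp_dep:
  assumes "idl.subspace J" "rseq J xs" "set xs \<subseteq> M"
  shows "dep M (length xs) (sat M J)"
  using assms
proof (induction xs arbitrary: J)
  case Nil
  then show ?case by simp
next
  case (Cons x xs)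
  have "reg (sat M J) x" unfolding reg_def
  proof (intro allI impI)
    fix s assume "x * s \<in> sat M J"
    then obtain u where "u \<notin> M" "x * (u * s) \<in> J" by (auto simp: sat_def mult.left_commute)
    then show "s \<in> sat M J" using Cons.prems(2) by (auto simp: sat_def reg_def)
  qed
  moreover have "ext M (sat M J) x = sat M (idl.span (insert x J))"
  proof (rule subset_antisym)
    show "ext M (sat M J) x \<subseteq> sat M (idl.span (insert x J))"
    proof (rule ext_least)
      have "J \<subseteq> idl.span (insert x J)" using idl.span_superset by blast
      then show "sat M J \<subseteq> sat M (idl.span (insert x J))" by (rule sat_mono)
      show "x \<in> sat M (idl.span (insert x J))" using sat_superset idl.span_base[of x "insert x J"] by blast
    qed (simp add: sid_sat)
    show "sat M (idl.span (insert x J)) \<subseteq> ext M (sat M J) x"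
      unfolding ext_def using sat_superset[of J] by (intro sat_mono idl.span_mono) auto
  qed
  moreover have "dep M (length xs) (sat M (idl.span (insert x J)))" using Cons by simp
  ultimately show ?case using Cons.prems(3) by auto
qed

lemma dlt_sum_powers: "homogeneous 1 f \<Longrightarrow> dlt e (\<Sum>i<e. const (c i) * f ^ i)"
proof (intro dlt_sum)
  fix i assume f: "homogeneous 1 f" and i: "i \<in> {..<e}"
  have "homogeneous (0 + i * 1) (const (c i) * f ^ i)"
    by (intro homogeneous_mult homogeneous_const homogeneous_power f)
  then have "dlt (Suc i) (const (c i) * f ^ i)" using dlt_homogeneous by simp
  then show "dlt e (const (c i) * f ^ i)" using i by (auto intro: dlt_mono)
qed

text \<open>The relation from \<open>zariski\<close> is cut off and normalized at its last nonzero
  coefficient; exponent zero would put a nonzero constant into \<open>M\<close>.\<close>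

lemma monic_in_maximal:
  fixes M :: "('n::finite, 'k::field) mpoly set"
  assumes prime: "prime_set M" and mx: "\<And>p. p \<notin> M \<Longrightarrow> \<exists>q. p * q - 1 \<in> M" and f: "homogeneous 1 f"
  shows "\<exists>e g. e > 0 \<and> g \<in> M \<and> dlt e (g - f ^ e)"
proof -
  note Mid = prime_setD(1)[OF prime]
  obtain N c where c: "\<exists>i\<le>N. c i \<noteq> 0" "(\<Sum>i\<le>N. const (c i) * f ^ i) \<in> M"
    using zariski[OF prime mx, of f] by blast
  define A where "A = {i. i \<le> N \<and> c i \<noteq> 0}"
  have "A \<noteq> {}" "finite A" using c(1) by (auto simp: A_def)
  then have e: "Max A \<in> A" "\<And>i. i \<in> A \<Longrightarrow> i \<le> Max A" by auto
  define e where "e = Max A"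
  have ce: "e \<le> N" "c e \<noteq> 0" using e(1) by (auto simp: A_def e_def)
  have "(\<Sum>i\<le>N. const (c i) * f ^ i) = (\<Sum>i\<le>e. const (c i) * f ^ i)"
  proof (rule sum.mono_neutral_right)
    show "\<forall>i\<in>{..N} - {..e}. const (c i) * f ^ i = 0"
    proof
      fix i assume i: "i \<in> {..N} - {..e}"
      then have "i \<notin> A" using e(2)[of i] by (auto simp: e_def)
      then show "const (c i) * f ^ i = 0" using i by (simp add: A_def)
    qed
  qed (use ce in auto)
  also have "\<dots> = (\<Sum>i<e. const (c i) * f ^ i) + const (c e) * f ^ e"
    by (simp add: lessThan_Suc_atMost[symmetric])
  finally have inM: "(\<Sum>i<e. const (c i) * f ^ i) + const (c e) * f ^ e \<in> M" using c(2) by simp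
  define g where "g = const (inverse (c e)) * ((\<Sum>i<e. const (c i) * f ^ i) + const (c e) * f ^ e)"
  have "g \<in> M" unfolding g_def by (rule ideal_mult(1)[OF Mid inM])
  moreover have "e > 0"
  proof (rule ccontr)
    assume "\<not> e > 0"
    then have "const (c e) \<in> M" using inM by simp
    then show False using prime_const[OF prime] ce by blast
  qed
  moreover have "dlt e (g - f ^ e)"
  proof -
    have "g = (\<Sum>i<e. const (inverse (c e) * c i) * f ^ i) + (const (inverse (c e)) * const (c e)) * f ^ e"
      by (simp add: g_def distrib_left sum_distrib_left const_mult mult.assoc del: inverse_eq_divide)
    then have "g - f ^ e = (\<Sum>i<e. const (inverse (c e) * c i) * f ^ i)"
      by (simp add: const_inverse[OF ce(2)] del: inverse_eq_divide)
    then show ?thesis by (simp only: dlt_sum_powers[OF f])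
  qed
  ultimately show ?thesis by (intro exI[of _ e] exI[of _ g] conjI)
qed

lemma dep_at_maximal:
  fixes I :: "('n::finite, 'k::field) mpoly set"
  assumes I: "hideal I" and f: "\<And>f. f \<in> set fs \<Longrightarrow> homogeneous 1 f"
    and rad: "\<And>j. \<exists>k. var j ^ k \<in> idl.span (I \<union> set fs)" and r: "rseq I fs"
    and prime: "prime_set M" and mx: "\<And>p. p \<notin> M \<Longrightarrow> \<exists>q. p * q - 1 \<in> M"
  shows "dep M (length fs) (sat M I)"
proof -
  have Iid: "idl.subspace I" using I by (simp add: hideal_def)
  have "\<forall>f. \<exists>e. f \<in> set fs \<longrightarrow> (\<exists>g. e > 0 \<and> g \<in> M \<and> dlt e (g - f ^ e))"
    using monic_in_maximal[OF prime mx] f by blast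
  from choice[OF this] obtain e where "\<forall>f. \<exists>g. f \<in> set fs \<longrightarrow> e f > 0 \<and> g \<in> M \<and> dlt (e f) (g - f ^ e f)" by auto
  from choice[OF this] obtain g where
    g: "\<And>f. f \<in> set fs \<Longrightarrow> e f > 0 \<and> g f \<in> M \<and> dlt (e f) (g f - f ^ e f)" by auto
  define fs0 where "fs0 = map (\<lambda>f. f ^ e f) fs"
  have hom: "homogeneous (e f) (f ^ e f)" if "f \<in> set fs" for f
    using homogeneous_power[OF assms(2)[OF that], of "e f"] by simp
  have "set fs \<subseteq> mm" using homogeneous_in_mm[OF f] by auto
  \<comment> \<open>The regular sequence \<open>fs\<close> certifies the depth at \<open>mm\<close>,
    and this depth is what makes the powers in \<open>fs0\<close> a regular sequence as
    well.\<close>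
  then have "dep mm (length fs) (sat mm I)"
    by (rule at_prime.rseq_imp_dep[OF at_prime_mpoly[OF prime_mm] Iid r])
  then have dep: "dep mm (length fs0) I" by (simp add: sat_hideal[OF I] fs0_def)
  have "rseq I fs0"
  proof (rule homogeneous_rseq[OF I _ _ dep])
    show "\<exists>d>0. homogeneous d q" if "q \<in> set fs0" for q
      using that hom g by (auto simp: fs0_def)
    fix j
    show "\<exists>k. var j ^ k \<in> idl.span (I \<union> set fs0)"
    proof (rule radical_via_primes[OF noeth_mpoly])
      fix P assume P: "prime_set P" "idl.span (I \<union> set fs0) \<subseteq> P"
      then have "I \<union> set fs0 \<subseteq> P" using idl.span_superset by blast
      \<comment> \<open>A prime contains the powers exactly when it contains the forms, so passing
        to powers leaves the radical unchanged.\<close>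
      then have "I \<union> set fs \<subseteq> P" using prime_power[OF P(1)] by (auto simp: fs0_def)
      then have "idl.span (I \<union> set fs) \<subseteq> P" using prime_setD(1)[OF P(1)] by (rule idl.span_minimal)
      then show "var j \<in> P" using rad[of j] prime_power[OF P(1)] by blast
    qed simp
  qed
  then have "rseq I (map g fs)"
  proof (rule rseq_leading_forms[OF toprel_refl[OF I]])
    show "list_all2 (\<lambda>x x0. \<exists>e. homogeneous e x0 \<and> dlt e (x - x0)) (map g fs) fs0"
      unfolding list_all2_conv_all_nth
    proof (intro conjI allI impI)
      fix i assume "i < length (map g fs)"
      then have i: "fs ! i \<in> set fs" "i < length fs" by auto
      show "\<exists>e. homogeneous e (fs0 ! i) \<and> dlt e (map g fs ! i - fs0 ! i)"
        using hom[OF i(1)] g[OF i(1)] i(2) by (intro exI[of _ "e (fs ! i)"]) (simp add: fs0_def)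
    qed (simp add: fs0_def)
  qed
  moreover have "set (map g fs) \<subseteq> M" using g by auto
  ultimately show ?thesis using at_prime.rseq_imp_dep[OF at_prime_mpoly[OF prime] Iid, of "map g fs"] by simp
qed


section \<open>Monomial ideals\<close>

text \<open>The ideal generated by the variables outside \<open>F\<close>, described through
  exponents; it is a complement of \<open>K[F]\<close>, and the quotient by it is the domain
  \<open>K[F]\<close>.\<close>

definition PF :: "'n::finite set \<Rightarrow> ('n, 'k::field) mpoly set" where
  "PF F = {p. \<forall>m\<in>keys p. \<not> keys m \<subseteq> F}"

lemma PF_add: "p \<in> PF F \<Longrightarrow> q \<in> PF F \<Longrightarrow> p + q \<in> PF F"
  using keys_add[of p q] unfolding PF_def by blast

lemma keys_add_nat: "keys (a + b) = keys a \<union> keys b" for a b :: "'n \<Rightarrow>\<^sub>0 nat"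
  by (auto simp: in_keys_iff lookup_add)

lemma PF_mult: "p \<in> PF F \<Longrightarrow> c * p \<in> PF F"
proof -
  assume p: "p \<in> PF F"
  show "c * p \<in> PF F" unfolding PF_def
  proof clarify
    fix m assume "m \<in> keys (c * p)" "keys m \<subseteq> F"
    then obtain a b where "a \<in> keys c" "b \<in> keys p" "m = a + b" using keys_mult[of c p] by blast
    then show False using p \<open>keys m \<subseteq> F\<close> by (auto simp: PF_def keys_add_nat)
  qed
qed

lemma ideal_PF: "idl.subspace (PF F)"
  by (rule idl.subspaceI) (auto simp: PF_add PF_mult, simp add: PF_def)

lemma VF_PF_split: "\<exists>a b. p = a + b \<and> a \<in> VF F \<and> b \<in> PF F"
proof -
  define T where "T m = const (lookup p m) * monomial m" for m
  have "p = (\<Sum>m\<in>{m \<in> keys p. keys m \<subseteq> F}. T m) + (\<Sum>m\<in>{m \<in> keys p. \<not> keys m \<subseteq> F}. T m)"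
  proof -
    have "p = (\<Sum>m\<in>keys p. T m)" unfolding T_def by (rule poly_expand)
    also have "\<dots> = (\<Sum>m\<in>{m \<in> keys p. keys m \<subseteq> F} \<union> {m \<in> keys p. \<not> keys m \<subseteq> F}. T m)"
      by (intro sum.cong) auto
    also have "\<dots> = (\<Sum>m\<in>{m \<in> keys p. keys m \<subseteq> F}. T m) + (\<Sum>m\<in>{m \<in> keys p. \<not> keys m \<subseteq> F}. T m)"
      by (rule sum.union_disjoint) auto
    finally show ?thesis .
  qed
  moreover have "(\<Sum>m\<in>{m \<in> keys p. keys m \<subseteq> F}. T m) \<in> VF F"
    unfolding T_def by (intro VF_sum VF_mult VF_const) (simp add: VF_monomial)
  moreover have "(\<Sum>m\<in>{m \<in> keys p. \<not> keys m \<subseteq> F}. T m) \<in> PF F"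
    unfolding T_def by (intro idl.subspace_sum[OF ideal_PF] PF_mult) (simp add: PF_def)
  ultimately show ?thesis by blast
qed

lemma VF_PF_zero: "p \<in> VF F \<Longrightarrow> p \<in> PF F \<Longrightarrow> p = 0"
  unfolding VF_def PF_def using keys_eq_empty by blast

lemma prime_PF: "prime_set (PF F :: ('n::finite, 'k::field) mpoly set)"
  unfolding prime_set_def
proof (intro conjI allI impI ideal_PF)
  show "1 \<notin> PF F" by (simp add: PF_def)
  fix p q :: "('n, 'k) mpoly" assume pq: "p * q \<in> PF F"
  obtain a b where p: "p = a + b" "a \<in> VF F" "b \<in> PF F" using VF_PF_split by blast
  obtain c d where q: "q = c + d" "c \<in> VF F" "d \<in> PF F" using VF_PF_split by blast
  have "a * c = p * q - (q * b + a * d)" by (simp add: p q algebra_simps)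
  also have "\<dots> \<in> PF F" by (intro idl.subspace_diff[OF ideal_PF pq PF_add] PF_mult p q)
  finally have "a * c = 0" using VF_PF_zero VF_mult[OF p(2) q(2)] by blast
  then have "a = 0 \<or> c = 0" using mpoly_no_zero_divisors by blast
  then show "p \<in> PF F \<or> q \<in> PF F" using p q by auto
qed

lemma var_in_PF: "var j \<in> PF F \<longleftrightarrow> j \<notin> F"
  by (simp add: PF_def var_def)

lemma PF_strict: "F \<subset> F' \<Longrightarrow> PF F' \<subset> (PF F :: ('n::finite, 'k::field) mpoly set)"
proof
  assume F: "F \<subset> F'"
  show "PF F' \<subseteq> (PF F :: ('n, 'k) mpoly set)" using F unfolding PF_def by blast
  obtain j where "j \<in> F'" "j \<notin> F" using F by blast
  then show "PF F' \<noteq> (PF F :: ('n, 'k) mpoly set)" using var_in_PF by blast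
qed

lemma PF_sub_mm: "PF F \<subseteq> mm"
proof
  fix p assume "p \<in> PF F"
  then have "0 \<notin> keys p" by (auto simp: PF_def)
  then show "p \<in> mm" by (simp add: mm_def in_keys_iff)
qed

text \<open>The Stanley-Reisner complex of the radical of \<open>I\<close>: since \<open>m\<close>
  ranges over all exponents supported in \<open>F\<close>, no power of the product of these
  variables lies in \<open>I\<close>.\<close>

definition face :: "('n::finite, 'k::field) mpoly set \<Rightarrow> 'n set \<Rightarrow> bool" where
  "face I F \<longleftrightarrow> (\<forall>m. keys m \<subseteq> F \<longrightarrow> monomial m \<notin> I)"

locale monomial_id =
  fixes I :: "('n::finite, 'k::field) mpoly set" and E
  assumes I: "I = idl.span (monomial ` E)" and proper: "1 \<notin> I"
begin

lemma Iid: "idl.subspace I" by (simp add: I)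

lemma hideal_I: "hideal I"
  unfolding I by (rule hideal_span) (auto intro: homogeneous_monomial)

lemma face_sub_PF: "face I F \<Longrightarrow> I \<subseteq> PF F"
proof -
  assume F: "face I F"
  have "monomial m \<in> PF F" if "m \<in> E" for m
  proof -
    have "monomial m \<in> I" unfolding I using that by (intro idl.span_base) auto
    then show ?thesis using F by (auto simp: face_def PF_def)
  qed
  then show ?thesis unfolding I by (intro idl.span_minimal ideal_PF) auto
qed

lemma prime_face: "prime_set P \<Longrightarrow> I \<subseteq> P \<Longrightarrow> face I {j. var j \<notin> P}"
  unfolding face_def using monomial_in_prime by blast

lemma face_empty: "face I {}"
  unfolding face_def using proper by auto

lemma I_sub_mm: "I \<subseteq> mm"
  using face_sub_PF[OF face_empty] PF_sub_mm by blast

text \<open>Removing the elements of \<open>F\<close> one at a time enlarges \<open>PF\<close>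
  strictly, from \<open>PF F\<close> above \<open>I\<close> up to \<open>PF {}\<close>.\<close>

lemma face_chain:
  assumes "face I F"
  shows "\<exists>P. prime_chain P (card F) \<and> I \<subseteq> P 0 \<and> P (card F) \<subseteq> mm"
proof -
  obtain xs where xs: "set xs = F" "distinct xs" using finite_distinct_list[of F] by auto
  have len: "length xs = card F" using xs distinct_card by metis
  define P where "P i = (PF (set (drop i xs)) :: ('n, 'k) mpoly set)" for i
  have "set (drop (Suc i) xs) \<subset> set (drop i xs)" if "i < length xs" for i
  proof -
    have d: "drop i xs = xs ! i # drop (Suc i) xs" using that by (rule Cons_nth_drop_Suc[symmetric])
    have "distinct (drop i xs)" using xs(2) by simp
    then have "xs ! i \<notin> set (drop (Suc i) xs)" by (simp add: d)
    then show ?thesis by (auto simp: d)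
  qed
  then have "P i \<subset> P (Suc i)" if "i < card F" for i
    unfolding P_def using that len by (intro PF_strict) simp
  then have "prime_chain P (card F)" unfolding prime_chain_def by (simp add: P_def prime_PF)
  moreover have "I \<subseteq> P 0" using face_sub_PF[OF assms] xs by (simp add: P_def)
  moreover have "P (card F) \<subseteq> mm" unfolding P_def by (rule PF_sub_mm)
  ultimately show ?thesis by blast
qed

end

section \<open>The Vandermonde forms\<close>

lemma homogeneous_vandermonde: "homogeneous 1 (vandermonde_form lam i)"
proof -
  have "homogeneous (0 + 1) (const (lam j ^ (i - 1)) * var j)" for j
    by (intro homogeneous_mult homogeneous_const homogeneous_var)
  then show ?thesis unfolding vandermonde_form_def by (intro homogeneous_sum) simp
qed

text \<open>Lagrange interpolation: a combination of the forms isolates any single variable outside \<open>P\<close>.\<close>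

lemma vandermonde_prime:
  fixes P :: "('n::finite, 'k::field) mpoly set"
  assumes P: "prime_set P" and lam: "inj lam" and f: "\<And>i. i \<in> {1..D} \<Longrightarrow> vandermonde_form lam i \<in> P"
    and card: "card {j. var j \<notin> P} \<le> D"
  shows "var j \<in> P"
proof (rule ccontr)
  assume j: "var j \<notin> P"
  note Pid = prime_setD(1)[OF P]
  define F where "F = {j. var j \<notin> P}"
  \<comment> \<open>\<open>g\<close> vanishes at \<open>lam l\<close> for every
    \<open>l \<in> F\<close> other than \<open>j\<close>. Since \<open>j\<close> itself is in
    \<open>F\<close>, its degree is below \<open>card F\<close>, hence below
    \<open>D\<close>.\<close>
  define g where "g = (\<Prod>l\<in>F - {j}. [:- lam l, 1:])"
  have gpoly: "poly g x = (\<Prod>l\<in>F - {j}. x - lam l)" for x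
    by (simp add: g_def poly_prod algebra_simps)
  have "degree g \<le> (\<Sum>l\<in>F - {j}. degree [:- lam l, 1:])"
    using degree_prod_sum_le[of "F - {j}" "\<lambda>l. [:- lam l, 1:]"] by (simp add: g_def o_def)
  also have "\<dots> = card (F - {j})" by simp
  also have "\<dots> < D" using card j card_Diff1_less[of F j] by (auto simp: F_def)
  finally have deg: "degree g < D" .
  \<comment> \<open>The coefficient of \<open>x ^ i\<close> in \<open>g\<close> goes with the form
    of index \<open>Suc i\<close>, whose exponents are \<open>i\<close>. The combination has
    coefficient \<open>poly g (lam l)\<close> at \<open>var l\<close>, and the bound on the degree
    keeps the indices within \<open>{1..D}\<close>.\<close>
  have "(\<Sum>i\<le>degree g. const (coeff g i) * vandermonde_form lam (Suc i)) =
      (\<Sum>i\<le>degree g. \<Sum>l\<in>UNIV. const (coeff g i * lam l ^ i) * var l)"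
    by (simp add: vandermonde_form_def sum_distrib_left const_mult mult.assoc)
  also have "\<dots> = (\<Sum>l\<in>UNIV. \<Sum>i\<le>degree g. const (coeff g i * lam l ^ i) * var l)" by (rule sum.swap)
  also have "\<dots> = (\<Sum>l\<in>UNIV. const (poly g (lam l)) * var l)"
    by (simp add: poly_altdef const_sum sum_distrib_right)
  also have "\<dots> = const (poly g (lam j)) * var j + (\<Sum>l\<in>UNIV - {j}. const (poly g (lam l)) * var l)"
    by (rule sum.remove) auto
  finally have eq: "const (poly g (lam j)) * var j =
      (\<Sum>i\<le>degree g. const (coeff g i) * vandermonde_form lam (Suc i)) -
      (\<Sum>l\<in>UNIV - {j}. const (poly g (lam l)) * var l)" by (simp add: algebra_simps)
  have "const (poly g (lam l)) * var l \<in> P" if "l \<in> UNIV - {j}" for l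
  proof (cases "l \<in> F")
    case True
    then have "poly g (lam l) = 0" using that by (auto simp: gpoly prod_zero_iff)
    then show ?thesis by (simp add: idl.subspace_0[OF Pid])
  next
    case False
    then show ?thesis by (auto simp: F_def intro: ideal_mult(1)[OF Pid])
  qed
  moreover have "const (coeff g i) * vandermonde_form lam (Suc i) \<in> P" if "i \<le> degree g" for i
    using f[of "Suc i"] that deg by (intro ideal_mult(1)[OF Pid]) auto
  ultimately have "const (poly g (lam j)) * var j \<in> P" unfolding eq
    by (intro idl.subspace_diff[OF Pid] idl.subspace_sum[OF Pid]) auto
  then have "poly g (lam j) = 0" using j prime_setD(3)[OF P] prime_const[OF P] by blast
  then show False using lam by (auto simp: gpoly prod_zero_iff inj_eq)
qed

abbreviation forms :: "('n::finite \<Rightarrow> 'k::field) \<Rightarrow> nat \<Rightarrow> ('n, 'k) mpoly list" where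
  "forms lam d \<equiv> map (vandermonde_form lam) [1..<Suc d]"

lemma set_forms: "set (forms lam d) = vandermonde_form lam ` {1..d}"
  by (simp add: atLeastLessThanSuc_atLeastAtMost del: upt_Suc)

lemma Sup_enat_attained:
  assumes "A \<noteq> {}" "Sup A = enat d" shows "enat d \<in> A"
proof -
  have "finite A" by (rule ccontr) (use assms in \<open>simp add: Sup_enat_def\<close>)
  then show ?thesis using assms Max_in[of A] by (simp add: Sup_enat_def)
qed

section \<open>Dimension and depth for a monomial ideal\<close>

context monomial_id
begin

text \<open>The variables outside a prime above \<open>I\<close> form a face, so
  \<open>vandermonde_prime\<close> applies to each such prime. The bound \<open>D\<close> is
  arbitrary because \<open>exists_face\<close> uses the lemma before faces and dimension are
  compared.\<close>

lemma forms_radical: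
  assumes lam: "inj lam" and D: "\<And>F. face I F \<Longrightarrow> card F \<le> D"
  shows "\<exists>k. var j ^ k \<in> idl.span (I \<union> set (forms lam D))"
proof (rule radical_via_primes[OF noeth_mpoly])
  fix P assume P: "prime_set P" "idl.span (I \<union> set (forms lam D)) \<subseteq> P"
  then have I: "I \<subseteq> P" and f: "set (forms lam D) \<subseteq> P" using idl.span_superset by blast+
  show "var j \<in> P"
  proof (rule vandermonde_prime[OF P(1) lam])
    show "vandermonde_form lam i \<in> P" if "i \<in> {1..D}" for i using f that unfolding set_forms by blast
    show "card {j. var j \<notin> P} \<le> D" by (rule D[OF prime_face[OF P(1) I]])
  qed
qed simp

text \<open>If all faces had fewer than \<open>l\<close> elements, \<open>l - 1\<close> of the forms
  would be parameters, and the growth bound would limit chains to length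
  \<open>l - 1\<close>.\<close>

lemma exists_face:
  assumes lam: "inj (lam :: 'n \<Rightarrow> 'k)" and chain: "prime_chain P l" "I \<subseteq> P 0"
  shows "\<exists>F. face I F \<and> l \<le> card F"
proof (rule ccontr)
  assume *: "\<not> ?thesis"
  \<comment> \<open>The subtraction in \<open>l - 1\<close> is truncated; the empty face settles
    \<open>l = 0\<close>.\<close>
  then have "l > 0" using face_empty by auto
  have "card F \<le> l - 1" if "face I F" for F using * that by force
  then have rad: "\<exists>k. var j ^ k \<in> idl.span (I \<union> set (forms lam (l - 1)))" for j
    by (rule forms_radical[OF lam])
  have "\<exists>e>0. homogeneous e q" if "q \<in> set (forms lam (l - 1))" for q
    using that homogeneous_vandermonde[of lam] by fastforce
  then have "l \<le> length (forms lam (l - 1))"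
    by (rule parameters_chain_bound[OF hideal_I _ rad chain])
  then show False using \<open>l > 0\<close> by simp
qed

text \<open>The suprema of \<open>depths M\<close> and \<open>chains M\<close> are depth and Krull
  dimension of the localization of the residue ring at \<open>M\<close>, by
  \<open>local_depth_krull_dim_Quot\<close>.\<close>

definition depths :: "('n, 'k) mpoly set \<Rightarrow> enat set" where
  "depths M = {enat r | r. dep M r (sat M I)}"

definition chains :: "('n, 'k) mpoly set \<Rightarrow> enat set" where
  "chains M = {enat l | l. \<exists>P. prime_chain P l \<and> I \<subseteq> P 0 \<and> P l \<subseteq> M}"

context
  fixes d :: nat and lam :: "'n \<Rightarrow> 'k"
  assumes dim: "Sup {enat l | l. \<exists>P :: nat \<Rightarrow> ('n, 'k) mpoly set. prime_chain P l \<and> I \<subseteq> P 0} = enat d"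
    and lam: "inj lam"
begin

lemma chain_le: "prime_chain P l \<Longrightarrow> I \<subseteq> P 0 \<Longrightarrow> l \<le> d"
  for P :: "nat \<Rightarrow> ('n, 'k) mpoly set"
proof -
  assume "prime_chain P l" "I \<subseteq> P 0"
  then have "enat l \<le> Sup {enat l | l. \<exists>P :: nat \<Rightarrow> ('n, 'k) mpoly set. prime_chain P l \<and> I \<subseteq> P 0}"
    by (intro Sup_upper) blast
  then show "l \<le> d" by (simp add: dim)
qed

lemma face_le: "face I F \<Longrightarrow> card F \<le> d"
  using face_chain chain_le by blast

lemmas radical = forms_radical[OF lam face_le]

lemma big_face: "\<exists>F. face I F \<and> d = card F"
proof -
  let ?A = "{enat l | l. \<exists>P :: nat \<Rightarrow> ('n, 'k) mpoly set. prime_chain P l \<and> I \<subseteq> P 0}"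
  have "enat 0 \<in> ?A" using face_chain[OF face_empty] by auto
  then have "?A \<noteq> {}" by blast
  then have "enat d \<in> ?A" using dim by (rule Sup_enat_attained)
  then obtain P :: "nat \<Rightarrow> ('n, 'k) mpoly set" where "prime_chain P d" "I \<subseteq> P 0" by blast
  then obtain F where "face I F" "d \<le> card F" using exists_face[OF lam] by blast
  then show ?thesis using face_le by (metis le_antisym)
qed

lemma cm_imp_regular:
  assumes "Sup (depths mm) = Sup (chains mm)" shows "rseq I (forms lam d)"
proof (rule homogeneous_rseq[OF hideal_I _ radical])
  show "\<exists>e>0. homogeneous e q" if "q \<in> set (forms lam d)" for q
    using that homogeneous_vandermonde[of lam] by fastforce
  obtain F where "face I F" "d = card F" using big_face by blast
  then have "enat d \<in> chains mm" using face_chain by (auto simp: chains_def)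
  then have le: "enat d \<le> Sup (depths mm)" unfolding assms by (rule Sup_upper)
  have "dep mm d I"
  proof (cases "d = 0")
    case False
    \<comment> \<open>A member of \<open>depths mm\<close> above \<open>d - 1\<close> is at least
      \<open>d\<close>, and a longer regular sequence can be truncated; so it does not matter
      whether the supremum is attained.\<close>
    then have "enat (d - 1) < enat d" by simp
    then have "enat (d - 1) < Sup (depths mm)" using le by (rule less_le_trans)
    then obtain a where "a \<in> depths mm" "enat (d - 1) < a" by (auto simp: less_Sup_iff)
    then obtain r where "dep mm r (sat mm I)" "d - 1 < r" by (auto simp: depths_def)
    then have "dep mm (d + (r - d)) I" by (simp add: sat_hideal[OF hideal_I])
    then show ?thesis by (rule at_prime.dep_mono[OF at_prime_mpoly[OF prime_mm]])
  qed simp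
  then show "dep mm (length (forms lam d)) I" by simp
qed

lemma regular_imp_cm:
  assumes r: "rseq I (forms lam d)" and M: "prime_set M" "\<And>p. p \<notin> M \<Longrightarrow> \<exists>q. p * q - 1 \<in> M" "I \<subseteq> M"
  shows "Sup (depths M) = Sup (chains M)"
proof (rule antisym)
  interpret at_prime M by (rule at_prime_mpoly[OF M(1)])
  have one: "1 \<notin> sat M I" using M(3) by (auto simp: sat_def)
  show "Sup (depths M) \<le> Sup (chains M)"
  proof (rule Sup_mono)
    fix a assume "a \<in> depths M"
    then obtain r where r: "a = enat r" "dep M r (sat M I)" by (auto simp: depths_def)
    obtain Q where "prime_chain Q r" "sat M I \<subseteq> Q 0" "Q r \<subseteq> M"
      using dep_le_dim[OF sid_sat[OF Iid] one r(2)] by blast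
    then have "enat r \<in> chains M" using sat_superset[of I] unfolding chains_def by blast
    then show "\<exists>b\<in>chains M. a \<le> b" using r(1) by auto
  qed
  have "dep M (length (forms lam d)) (sat M I)"
    using homogeneous_vandermonde[of lam] by (intro dep_at_maximal[OF hideal_I _ radical r M(1,2)]) auto
  moreover have "length (forms lam d) = d" by (simp del: upt_Suc)
  ultimately have "enat d \<in> depths M" by (auto simp: depths_def simp del: upt_Suc)
  then have "enat d \<le> Sup (depths M)" by (rule Sup_upper)
  moreover have "Sup (chains M) \<le> enat d"
    by (rule Sup_least) (auto simp: chains_def intro: chain_le)
  ultimately show "Sup (chains M) \<le> Sup (depths M)" by simp
qed

end

end

lemma maximal_mm:
  fixes p :: "('n::finite, 'k::field) mpoly"
  assumes "p \<notin> mm" shows "\<exists>q. p * q - 1 \<in> mm"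
proof -
  have "lookup p 0 \<noteq> 0" using assms by (simp add: mm_def)
  then have "p * const (inverse (lookup p 0)) - 1 \<in> mm"
    by (simp add: mm_def lookup_minus lookup_mult_0 const_def lookup_one)
  then show ?thesis by blast
qed

section \<open>Rings of fractions\<close>

lemma (in cring) ideal_intro:
  assumes "K \<subseteq> carrier R" "\<zero> \<in> K" "\<And>a b. a \<in> K \<Longrightarrow> b \<in> K \<Longrightarrow> a \<oplus> b \<in> K"
    and mult: "\<And>a c. a \<in> K \<Longrightarrow> c \<in> carrier R \<Longrightarrow> a \<otimes> c \<in> K"
  shows "ideal K R"
proof (rule idealI[OF ring_axioms])
  show "subgroup K (add_monoid R)"
  proof (rule add.subgroupI)
    show "\<ominus> a \<in> K" if a: "a \<in> K" for a
    proof -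
      have "a \<in> carrier R" using a assms(1) by blast
      then have "a \<otimes> (\<ominus> \<one>) = \<ominus> a" by (simp add: r_minus)
      then show ?thesis using mult[OF a, of "\<ominus> \<one>"] by simp
    qed
  qed (use assms in auto)
  show "a \<otimes> x \<in> K" if "a \<in> K" "x \<in> carrier R" for a x using mult that .
  show "x \<otimes> a \<in> K" if "a \<in> K" "x \<in> carrier R" for a x
    using mult[OF that] that assms(1) m_comm[of x a] by auto
qed

text \<open>\<open>A\<close> is the localization of the ring of type \<open>'a\<close> modulo \<open>I\<close> at the multiplicative set \<open>T\<close>;
  \<open>T = {1}\<close> gives residue class rings.\<close>

locale fraction_ring = cring A for A :: "('b, 'c) ring_scheme" (structure) +
  fixes \<phi> :: "'a::comm_ring_1 \<Rightarrow> 'b" and I T :: "'a set"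
  assumes I: "idl.subspace I" and T_one: "1 \<in> T" and T_mult: "\<And>u v. u \<in> T \<Longrightarrow> v \<in> T \<Longrightarrow> u * v \<in> T"
    and phi_closed [simp]: "\<And>s. \<phi> s \<in> carrier A"
    and phi_mult: "\<And>s t. \<phi> (s * t) = \<phi> s \<otimes> \<phi> t" and phi_add: "\<And>s t. \<phi> (s + t) = \<phi> s \<oplus> \<phi> t"
    and phi_one: "\<phi> 1 = \<one>"
    and phi_unit: "\<And>u. u \<in> T \<Longrightarrow> \<phi> u \<in> Units A"
    and phi_surj: "\<And>a. a \<in> carrier A \<Longrightarrow> \<exists>s u. u \<in> T \<and> a \<otimes> \<phi> u = \<phi> s"
    and phi_ker: "\<And>s. \<phi> s = \<zero> \<longleftrightarrow> (\<exists>u\<in>T. u * s \<in> I)"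
begin

lemma phi_zero: "\<phi> 0 = \<zero>"
  unfolding phi_ker using T_one idl.subspace_0[OF I] by force

lemma phi_minus: "\<phi> (- s) = \<ominus> \<phi> s"
proof -
  have "\<phi> (- s) \<oplus> \<phi> s = \<zero>" by (simp flip: phi_add add: phi_zero)
  then show ?thesis by (metis minus_equality phi_closed)
qed

lemma phi_eq_iff: "\<phi> s = \<phi> t \<longleftrightarrow> (\<exists>u\<in>T. u * (s - t) \<in> I)"
proof -
  have "\<phi> s = \<phi> t \<longleftrightarrow> \<phi> (s - t) = \<zero>"
    using phi_add[of s "- t"] phi_minus[of t] r_right_minus_eq[of "\<phi> s" "\<phi> t"] by (simp add: a_minus_def)
  then show ?thesis by (simp add: phi_ker)
qed

section \<open>Contraction and extension of ideals\<close>

definition pre :: "'b set \<Rightarrow> 'a set" where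
  "pre K = {s. \<phi> s \<in> K}"

text \<open>The contracted ideals: \<open>pre\<close> and \<open>extn\<close> are inverse bijections
  between the ideals of \<open>A\<close> and these.\<close>

definition tsat :: "'a set \<Rightarrow> bool" where
  "tsat J \<longleftrightarrow> idl.subspace J \<and> I \<subseteq> J \<and> (\<forall>u s. u \<in> T \<longrightarrow> u * s \<in> J \<longrightarrow> s \<in> J)"

definition extn :: "'a set \<Rightarrow> 'b set" where
  "extn J = {a \<in> carrier A. \<exists>s\<in>J. \<exists>u\<in>T. a \<otimes> \<phi> u = \<phi> s}"

lemma extnI: "a \<in> carrier A \<Longrightarrow> s \<in> J \<Longrightarrow> u \<in> T \<Longrightarrow> a \<otimes> \<phi> u = \<phi> s \<Longrightarrow> a \<in> extn J"
  unfolding extn_def by blast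

lemma extnE:
  assumes "a \<in> extn J"
  obtains s u where "a \<in> carrier A" "s \<in> J" "u \<in> T" "a \<otimes> \<phi> u = \<phi> s"
  using assms unfolding extn_def by blast

lemma unit_cancel:
  assumes K: "ideal K A" and "a \<in> carrier A" "u \<in> T" "a \<otimes> \<phi> u \<in> K" shows "a \<in> K"
proof -
  have u: "\<phi> u \<in> Units A" using phi_unit assms(3) .
  have "a \<otimes> \<phi> u \<otimes> inv (\<phi> u) \<in> K" using ideal.I_r_closed[OF K assms(4)] u by simp
  moreover have "a \<otimes> \<phi> u \<otimes> inv (\<phi> u) = a" using u assms(2) by (simp add: m_assoc)
  ultimately show ?thesis by simp
qed

lemma mem_ideal_iff:
  assumes K: "ideal K A" and "a \<in> carrier A" "u \<in> T" "a \<otimes> \<phi> u = \<phi> s"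
  shows "a \<in> K \<longleftrightarrow> s \<in> pre K"
  using unit_cancel[OF assms(1-3)] ideal.I_r_closed[OF K, of a "\<phi> u"] assms(4) by (auto simp: pre_def)

lemma tsat_pre:
  assumes K: "ideal K A" shows "tsat (pre K)"
  unfolding tsat_def
proof (intro conjI allI impI)
  interpret K: ideal K A by (rule K)
  show "idl.subspace (pre K)"
    by (rule idl.subspaceI) (auto simp: pre_def phi_zero phi_add phi_mult intro: K.I_l_closed)
  have "\<phi> s = \<zero>" if "s \<in> I" for s unfolding phi_ker using that T_one by force
  then show "I \<subseteq> pre K" by (auto simp: pre_def)
  show "s \<in> pre K" if "u \<in> T" "u * s \<in> pre K" for u s
    using unit_cancel[OF K phi_closed that(1), of s] that(2) by (simp add: pre_def phi_mult m_comm)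
qed

lemma ideal_extn:
  assumes J: "idl.subspace J" shows "ideal (extn J) A"
proof (rule ideal_intro)
  show "extn J \<subseteq> carrier A" by (auto simp: extn_def)
  have "\<zero> \<otimes> \<phi> 1 = \<phi> 0" by (simp add: phi_zero)
  then show "\<zero> \<in> extn J" by (rule extnI[OF zero_closed idl.subspace_0[OF J] T_one])
  show "a \<oplus> b \<in> extn J" if ab: "a \<in> extn J" "b \<in> extn J" for a b
  proof -
    obtain s u where s: "a \<in> carrier A" "s \<in> J" "u \<in> T" "a \<otimes> \<phi> u = \<phi> s" using extnE[OF ab(1)] .
    obtain t v where t: "b \<in> carrier A" "t \<in> J" "v \<in> T" "b \<otimes> \<phi> v = \<phi> t" using extnE[OF ab(2)] .
    have "(a \<oplus> b) \<otimes> \<phi> (u * v) = (a \<otimes> \<phi> u) \<otimes> \<phi> v \<oplus> (b \<otimes> \<phi> v) \<otimes> \<phi> u"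
      using s(1) t(1) by (simp add: phi_mult l_distr r_distr m_ac)
    also have "\<dots> = \<phi> (s * v + t * u)" by (simp add: s(4) t(4) phi_add phi_mult)
    finally have "(a \<oplus> b) \<otimes> \<phi> (u * v) = \<phi> (s * v + t * u)" .
    moreover have "s * v + t * u \<in> J"
      by (rule idl.subspace_add[OF J ideal_mult(2)[OF J s(2)] ideal_mult(2)[OF J t(2)]])
    ultimately show ?thesis using extnI[OF a_closed[OF s(1) t(1)] _ T_mult[OF s(3) t(3)]] by simp
  qed
  show "a \<otimes> c \<in> extn J" if ac: "a \<in> extn J" "c \<in> carrier A" for a c
  proof -
    obtain s u where st: "a \<in> carrier A" "s \<in> J" "u \<in> T" "a \<otimes> \<phi> u = \<phi> s" using extnE[OF ac(1)] .
    obtain t v where tv: "v \<in> T" "c \<otimes> \<phi> v = \<phi> t" using phi_surj[OF ac(2)] by blast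
    have "(a \<otimes> c) \<otimes> \<phi> (u * v) = (a \<otimes> \<phi> u) \<otimes> (c \<otimes> \<phi> v)"
      using st(1) ac(2) by (simp add: phi_mult m_ac)
    also have "\<dots> = \<phi> (s * t)" by (simp add: st(4) tv(2) phi_mult)
    finally have "(a \<otimes> c) \<otimes> \<phi> (u * v) = \<phi> (s * t)" .
    then show ?thesis by (rule extnI[OF m_closed[OF st(1) ac(2)] ideal_mult(2)[OF J st(2)] T_mult[OF st(3) tv(1)]])
  qed
qed

lemma pre_extn:
  assumes J: "tsat J" shows "pre (extn J) = J"
proof
  have Jid: "idl.subspace J" and IJ: "I \<subseteq> J" and cancel: "\<And>u s. u \<in> T \<Longrightarrow> u * s \<in> J \<Longrightarrow> s \<in> J"
    using J by (auto simp: tsat_def)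
  show "J \<subseteq> pre (extn J)"
  proof
    fix s assume s: "s \<in> J"
    have "\<phi> s \<otimes> \<phi> 1 = \<phi> s" by (simp add: phi_one)
    then show "s \<in> pre (extn J)" unfolding pre_def using extnI[OF phi_closed s T_one] by simp
  qed
  show "pre (extn J) \<subseteq> J"
  proof
    fix s assume "s \<in> pre (extn J)"
    then have "\<phi> s \<in> extn J" by (simp add: pre_def)
    then obtain t u where t: "t \<in> J" "u \<in> T" "\<phi> (s * u) = \<phi> t" by (rule extnE) (simp add: phi_mult)
    then obtain v where v: "v \<in> T" "v * (s * u - t) \<in> I" using phi_eq_iff by blast
    have "(v * u) * s = v * (s * u - t) + v * t" by (simp add: algebra_simps)
    also have "\<dots> \<in> J" using v(2) IJ by (intro idl.subspace_add[OF Jid] ideal_mult(1)[OF Jid t(1)]) auto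
    finally show "s \<in> J" using cancel T_mult v(1) t(2) by blast
  qed
qed

lemma extn_pre:
  assumes K: "ideal K A" shows "extn (pre K) = K"
proof
  show "extn (pre K) \<subseteq> K" using mem_ideal_iff[OF K] by (auto simp: extn_def)
  show "K \<subseteq> extn (pre K)"
  proof
    fix a assume a: "a \<in> K"
    then have ac: "a \<in> carrier A" by (rule ideal.Icarr[OF K])
    then obtain s u where s: "u \<in> T" "a \<otimes> \<phi> u = \<phi> s" using phi_surj by blast
    then have "s \<in> pre K" using mem_ideal_iff[OF K ac s] a by simp
    then show "a \<in> extn (pre K)" by (rule extnI[OF ac _ s])
  qed
qed

lemma pre_mono_iff: "ideal K A \<Longrightarrow> ideal L A \<Longrightarrow> pre K \<subseteq> pre L \<longleftrightarrow> K \<subseteq> L"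
proof
  assume K: "ideal K A" and L: "ideal L A"
  show "K \<subseteq> L" if "pre K \<subseteq> pre L"
  proof -
    have "extn (pre K) \<subseteq> extn (pre L)" using that unfolding extn_def by blast
    then show ?thesis using extn_pre K L by simp
  qed
qed (auto simp: pre_def)

lemma pre_psubset_iff: "ideal K A \<Longrightarrow> ideal L A \<Longrightarrow> pre K \<subset> pre L \<longleftrightarrow> K \<subset> L"
  using pre_mono_iff[of K L] pre_mono_iff[of L K] by (simp add: less_le_not_le)

lemma one_in_pre: "ideal K A \<Longrightarrow> 1 \<in> pre K \<longleftrightarrow> K = carrier A"
  using ideal.one_imp_carrier by (auto simp: pre_def phi_one)

lemma prime_pre:
  assumes "primeideal K A" shows "prime_set (pre K)" "pre K \<inter> T = {}"
proof -
  interpret K: primeideal K A by (rule assms)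
  have Kid: "ideal K A" by (rule K.is_ideal)
  have one: "1 \<notin> pre K" using one_in_pre[OF Kid] K.I_notcarr by blast
  then show "prime_set (pre K)" using tsat_pre[OF Kid]
    unfolding prime_set_def tsat_def using K.I_prime by (auto simp: pre_def phi_mult)
  show "pre K \<inter> T = {}"
  proof (rule ccontr)
    assume "pre K \<inter> T \<noteq> {}"
    then obtain u where "u \<in> T" "u * 1 \<in> pre K" by auto
    then show False using tsat_pre[OF Kid] one unfolding tsat_def by blast
  qed
qed

lemma prime_tsat: "prime_set P \<Longrightarrow> I \<subseteq> P \<Longrightarrow> P \<inter> T = {} \<Longrightarrow> tsat P"
  unfolding tsat_def prime_set_def by blast

lemma prime_extn:
  assumes P: "prime_set P" "I \<subseteq> P" "P \<inter> T = {}" shows "primeideal (extn P) A"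
proof (rule primeidealI)
  have ts: "tsat P" using prime_tsat[OF P] .
  note pe = pre_extn[OF ts]
  show id: "ideal (extn P) A" using ideal_extn prime_setD(1)[OF P(1)] .
  show "cring A" by (rule is_cring)
  show "carrier A \<noteq> extn P" using one_in_pre[OF id] pe prime_setD(2)[OF P(1)] by auto
  fix a b assume ab: "a \<in> carrier A" "b \<in> carrier A" "a \<otimes> b \<in> extn P"
  obtain s u where s: "u \<in> T" "a \<otimes> \<phi> u = \<phi> s" using phi_surj[OF ab(1)] by blast
  obtain t v where t: "v \<in> T" "b \<otimes> \<phi> v = \<phi> t" using phi_surj[OF ab(2)] by blast
  have "(a \<otimes> b) \<otimes> \<phi> (u * v) = (a \<otimes> \<phi> u) \<otimes> (b \<otimes> \<phi> v)" using ab by (simp add: phi_mult m_ac)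
  then have "(a \<otimes> b) \<otimes> \<phi> (u * v) = \<phi> (s * t)" by (simp add: s t phi_mult)
  then have "s * t \<in> P" using mem_ideal_iff[OF id _ T_mult[OF s(1) t(1)]] ab pe by auto
  then have "s \<in> P \<or> t \<in> P" using prime_setD(3)[OF P(1)] by blast
  then show "a \<in> extn P \<or> b \<in> extn P" using mem_ideal_iff[OF id ab(1) s] mem_ideal_iff[OF id ab(2) t] pe by simp
qed

text \<open>Primes of \<open>A\<close> correspond to primes above \<open>I\<close> that miss
  \<open>T\<close>; along a chain it suffices to test the smallest member against \<open>I\<close>
  and the largest against \<open>T\<close>.\<close>

lemma krull_dim_eq:
  "krull_dim A = Sup {enat l | l. \<exists>P. prime_chain P l \<and> I \<subseteq> P 0 \<and> P l \<inter> T = {}}"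
proof -
  have "(\<exists>P. (\<forall>i\<le>l. primeideal (P i) A) \<and> (\<forall>i<l. P i \<subset> P (Suc i))) \<longleftrightarrow>
    (\<exists>P. prime_chain P l \<and> I \<subseteq> P 0 \<and> P l \<inter> T = {})" for l
  proof
    assume "\<exists>P. (\<forall>i\<le>l. primeideal (P i) A) \<and> (\<forall>i<l. P i \<subset> P (Suc i))"
    then obtain P where P: "\<And>i. i \<le> l \<Longrightarrow> primeideal (P i) A" "\<And>i. i < l \<Longrightarrow> P i \<subset> P (Suc i)" by blast
    have id: "ideal (P i) A" if "i \<le> l" for i by (rule primeideal.axioms(1)[OF P(1)[OF that]])
    have "prime_chain (\<lambda>i. pre (P i)) l" unfolding prime_chain_def
      using prime_pre(1)[OF P(1)] P(2) pre_psubset_iff[OF id id] by auto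
    moreover have "I \<subseteq> pre (P 0)" using tsat_pre[OF id] by (auto simp: tsat_def)
    moreover have "pre (P l) \<inter> T = {}" using prime_pre(2)[OF P(1)] by simp
    ultimately show "\<exists>P. prime_chain P l \<and> I \<subseteq> P 0 \<and> P l \<inter> T = {}" by blast
  next
    assume "\<exists>P. prime_chain P l \<and> I \<subseteq> P 0 \<and> P l \<inter> T = {}"
    then obtain P where P: "\<And>i. i \<le> l \<Longrightarrow> prime_set (P i)" "\<And>i. i < l \<Longrightarrow> P i \<subset> P (Suc i)"
      "I \<subseteq> P 0" "P l \<inter> T = {}" by (auto simp: prime_chain_def)
    have 1: "I \<subseteq> P i" if "i \<le> l" for i using that
      by (induction i) (use P(2,3) in \<open>auto simp: Suc_le_eq\<close>)
    have "i \<le> l \<Longrightarrow> P (l - i) \<inter> T = {}" for i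
    proof (induction i)
      case (Suc i)
      then have "P (l - Suc i) \<subset> P (Suc (l - Suc i))" "Suc (l - Suc i) = l - i" using P(2)[of "l - Suc i"] by auto
      then show ?case using Suc by auto
    qed (use P(4) in simp)
    then have 2: "P i \<inter> T = {}" if "i \<le> l" for i using that by (metis diff_diff_cancel diff_le_self)
    have "primeideal (extn (P i)) A" if "i \<le> l" for i using prime_extn P(1) 1 2 that by blast
    moreover have "extn (P i) \<subset> extn (P (Suc i))" if "i < l" for i
    proof -
      have "tsat (P i)" "tsat (P (Suc i))" using prime_tsat P(1) 1 2 that by auto
      moreover from this have "ideal (extn (P i)) A" "ideal (extn (P (Suc i))) A"
        by (auto simp: tsat_def intro: ideal_extn)
      ultimately show ?thesis
        using pre_psubset_iff[of "extn (P i)" "extn (P (Suc i))"] pre_extn[of "P i"] pre_extn[of "P (Suc i)"] P(2)[OF that]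
        by simp
    qed
    ultimately show "\<exists>P. (\<forall>i\<le>l. primeideal (P i) A) \<and> (\<forall>i<l. P i \<subset> P (Suc i))"
      by (intro exI[of _ "\<lambda>i. extn (P i)"]) blast
  qed
  then show ?thesis unfolding krull_dim_def by simp
qed

text \<open>Finitely many generators of the contraction of \<open>K\<close> are mapped to generators
  of \<open>K\<close>, because \<open>pre\<close> reflects inclusions.\<close>

lemma noetherian:
  assumes "noeth TYPE('a)" shows "noetherian_ring A"
proof (rule noetherian_ringI)
  fix K assume K: "ideal K A"
  obtain G where G: "finite G" "pre K = idl.span G"
    using assms tsat_pre[OF K] unfolding noeth_def tsat_def by blast
  have sub: "\<phi> ` G \<subseteq> K" using G(2) idl.span_superset by (auto simp: pre_def)
  have id: "ideal (Idl (\<phi> ` G)) A" by (intro genideal_ideal) auto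
  have "\<phi> ` G \<subseteq> Idl (\<phi> ` G)" by (rule genideal_self) auto
  then have "G \<subseteq> pre (Idl (\<phi> ` G))" by (auto simp: pre_def)
  then have "pre K \<subseteq> pre (Idl (\<phi> ` G))" unfolding G(2)
    using tsat_pre[OF id] by (intro idl.span_minimal) (auto simp: tsat_def)
  then have "K = Idl (\<phi> ` G)"
    using pre_mono_iff[OF K id] genideal_minimal[OF K sub] by blast
  then show "\<exists>G\<subseteq>carrier A. finite G \<and> K = Idl G" using G(1) by (intro exI[of _ "\<phi> ` G"]) auto
qed

lemma maximal_extn:
  assumes P: "tsat P" "1 \<notin> P" and mx: "\<And>J. tsat J \<Longrightarrow> P \<subset> J \<Longrightarrow> 1 \<in> J"
  shows "maximalideal (extn P) A"
proof (rule maximalidealI)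
  show id: "ideal (extn P) A" using ideal_extn P(1) by (simp add: tsat_def)
  show "carrier A \<noteq> extn P" using one_in_pre[OF id] pre_extn[OF P(1)] P(2) by auto
  fix J assume J: "ideal J A" "extn P \<subseteq> J" "J \<subseteq> carrier A"
  show "J = extn P \<or> J = carrier A"
  proof (cases "extn P = J")
    case False
    then have "P \<subset> pre J" using pre_psubset_iff[OF id J(1)] J(2) pre_extn[OF P(1)] by auto
    then show ?thesis using mx[OF tsat_pre[OF J(1)]] one_in_pre[OF J(1)] by blast
  qed simp
qed

text \<open>The denominator is a unit, so \<open>x\<close> may be replaced by its numerator
  \<open>s\<close>.\<close>

lemma pre_colon:
  assumes K: "ideal K A" and x: "x \<in> carrier A" "u \<in> T" "x \<otimes> \<phi> u = \<phi> s"
  shows "colon_ideal A K x = K \<longleftrightarrow> reg (pre K) s"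
proof -
  have xt: "\<phi> t \<otimes> x \<in> K \<longleftrightarrow> s * t \<in> pre K" for t
  proof (rule mem_ideal_iff[OF K _ x(2)])
    have "\<phi> t \<otimes> x \<otimes> \<phi> u = \<phi> t \<otimes> (x \<otimes> \<phi> u)" using x(1) by (simp add: m_assoc)
    also have "\<dots> = \<phi> (s * t)" by (simp add: x(3) mult.commute flip: phi_mult)
    finally show "\<phi> t \<otimes> x \<otimes> \<phi> u = \<phi> (s * t)" .
  qed (use x in simp)
  show ?thesis
  proof
    assume *: "colon_ideal A K x = K"
    show "reg (pre K) s" unfolding reg_def
    proof (intro allI impI)
      fix t assume "s * t \<in> pre K"
      then have "\<phi> t \<in> colon_ideal A K x" using xt by (simp add: colon_ideal_def)
      then show "t \<in> pre K" using * by (simp add: pre_def)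
    qed
  next
    assume *: "reg (pre K) s"
    show "colon_ideal A K x = K"
    proof
      show "K \<subseteq> colon_ideal A K x"
        using ideal.I_r_closed[OF K _ x(1)] ideal.Icarr[OF K] by (auto simp: colon_ideal_def)
      show "colon_ideal A K x \<subseteq> K"
      proof
        fix a assume a: "a \<in> colon_ideal A K x"
        then have ac: "a \<in> carrier A" and ax: "a \<otimes> x \<in> K" by (auto simp: colon_ideal_def)
        obtain t v where t: "v \<in> T" "a \<otimes> \<phi> v = \<phi> t" using phi_surj[OF ac] by blast
        have "\<phi> t \<otimes> x = a \<otimes> x \<otimes> \<phi> v" using ac x(1) by (simp add: t(2)[symmetric] m_ac)
        also have "\<dots> \<in> K" using ideal.I_r_closed[OF K ax] by simp
        finally have "t \<in> pre K" using * xt unfolding reg_def by blast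
        then show "a \<in> K" using mem_ideal_iff[OF K ac t] by blast
      qed
    qed
  qed
qed

end

lemma regular_seq_Nil: "regular_seq R G []"
  by (simp add: regular_seq_def)

lemma regular_seq_Cons:
  "regular_seq R G (x # xs) \<longleftrightarrow> x \<in> carrier R \<and> colon_ideal R (Idl\<^bsub>R\<^esub> G) x = Idl\<^bsub>R\<^esub> G \<and>
     regular_seq R (insert x G) xs"
  unfolding regular_seq_def by (auto simp: less_Suc_eq_0_disj all_conj_distrib)

section \<open>Depth of a localization at a prime\<close>

locale localization_at = fraction_ring A \<phi> I "- M" + at_prime M
  for A :: "('b, 'c) ring_scheme" (structure) and \<phi> :: "'a::comm_ring_1 \<Rightarrow> 'b" and I M +
  assumes IM: "I \<subseteq> M"
begin

lemma tsat_sid: "tsat J \<longleftrightarrow> sid J \<and> I \<subseteq> J"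
  by (auto simp: tsat_def sid_def)

lemma pre_zero: "pre {\<zero>} = sat M I"
  by (auto simp: pre_def sat_def phi_ker)

text \<open>What makes \<open>dep\<close> mirror \<open>regular_seq\<close>: adjoining
  \<open>x\<close> to an ideal of the localization becomes \<open>ext\<close> with the numerator of
  \<open>x\<close>.\<close>

lemma pre_insert:
  assumes G: "G \<subseteq> carrier A" and x: "x \<in> carrier A" "u \<notin> M" "x \<otimes> \<phi> u = \<phi> s"
  shows "pre (Idl (insert x G)) = ext M (pre (Idl G)) s"
proof
  have id: "ideal (Idl G) A" "ideal (Idl (insert x G)) A" using G x(1) by (auto intro: genideal_ideal)
  have sub: "Idl G \<subseteq> Idl (insert x G)"
    using genideal_self[of "insert x G"] G x(1) by (intro genideal_minimal[OF id(2)]) auto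
  have xin: "x \<in> Idl (insert x G)" using genideal_self[of "insert x G"] G x(1) by auto
  show "ext M (pre (Idl G)) s \<subseteq> pre (Idl (insert x G))"
  proof (rule ext_least)
    show "sid (pre (Idl (insert x G)))" using tsat_pre[OF id(2)] tsat_sid by blast
    show "pre (Idl G) \<subseteq> pre (Idl (insert x G))" using sub by (auto simp: pre_def)
    show "s \<in> pre (Idl (insert x G))" using mem_ideal_iff[OF id(2) x(1) _ x(3)] xin x(2) by simp
  qed
  define E where "E = ext M (pre (Idl G)) s"
  have sE: "pre (Idl G) \<subseteq> E" "s \<in> E" "sid E" unfolding E_def using ext_superset sid_ext by auto
  moreover have "I \<subseteq> pre (Idl G)" using tsat_pre[OF id(1)] by (simp add: tsat_def)
  ultimately have tE: "tsat E" using tsat_sid by blast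
  have idE: "ideal (extn E) A" using ideal_extn tE by (simp add: tsat_def)
  have "Idl G \<subseteq> extn E" using pre_mono_iff[OF id(1) idE] pre_extn[OF tE] sE by simp
  moreover have "G \<subseteq> Idl G" using G by (rule genideal_self)
  moreover have "x \<in> extn E" using mem_ideal_iff[OF idE x(1) _ x(3)] x(2) pre_extn[OF tE] sE by simp
  ultimately have "Idl (insert x G) \<subseteq> extn E" by (intro genideal_minimal[OF idE]) auto
  then show "pre (Idl (insert x G)) \<subseteq> ext M (pre (Idl G)) s"
    using pre_mono_iff[OF id(2) idE] pre_extn[OF tE] by (simp add: E_def)
qed

text \<open>Any proper ideal \<open>N\<close> will do here, since every proper ideal of the
  localization contracts into \<open>M\<close> and so places the numerators there.\<close>

lemma regular_seq_imp_dep: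
  assumes "G \<subseteq> carrier A" "regular_seq A G xs" "ideal N A" "N \<noteq> carrier A" "set xs \<subseteq> N"
  shows "dep M (length xs) (pre (Idl G))"
  using assms(1,2,5)
proof (induction xs arbitrary: G)
  case (Cons x xs)
  have x: "x \<in> carrier A" "colon_ideal A (Idl G) x = Idl G" "regular_seq A (insert x G) xs"
    using Cons.prems(2) by (auto simp: regular_seq_Cons)
  obtain s u where s: "u \<in> - M" "x \<otimes> \<phi> u = \<phi> s" using phi_surj[OF x(1)] by blast
  have id: "ideal (Idl G) A" using Cons.prems(1) by (rule genideal_ideal)
  have "reg (pre (Idl G)) s" using pre_colon[OF id x(1) s] x(2) by blast
  moreover have "s \<in> M"
  proof -
    have "s \<in> pre N" using mem_ideal_iff[OF assms(3) x(1) s] Cons.prems(3) by simp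
    moreover have "1 \<notin> pre N" using one_in_pre[OF assms(3)] assms(4) by blast
    ultimately show ?thesis using sid_sub_M[of "pre N"] tsat_pre[OF assms(3)] tsat_sid by blast
  qed
  moreover have "dep M (length xs) (ext M (pre (Idl G)) s)"
    using Cons.IH[of "insert x G"] Cons.prems x pre_insert[OF Cons.prems(1) x(1) _ s(2)] s(1) by auto
  ultimately show ?case by auto
qed simp

lemma dep_imp_regular_seq:
  assumes "G \<subseteq> carrier A" "dep M r (pre (Idl G))"
  shows "\<exists>xs. length xs = r \<and> set xs \<subseteq> extn M \<and> regular_seq A G xs"
  using assms
proof (induction r arbitrary: G)
  case 0
  then show ?case using regular_seq_Nil by auto
next
  case (Suc r)
  obtain x where x: "x \<in> M" "reg (pre (Idl G)) x" "dep M r (ext M (pre (Idl G)) x)" using Suc.prems(2) by auto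
  have id: "ideal (Idl G) A" using Suc.prems(1) by (rule genideal_ideal)
  have px: "\<phi> x \<otimes> \<phi> 1 = \<phi> x" by (simp add: phi_one)
  have "colon_ideal A (Idl G) (\<phi> x) = Idl G" using pre_colon[OF id phi_closed _ px] x(2) one_notin by simp
  moreover have "pre (Idl (insert (\<phi> x) G)) = ext M (pre (Idl G)) x"
    using pre_insert[OF Suc.prems(1) phi_closed one_notin px] .
  then obtain xs where "length xs = r" "set xs \<subseteq> extn M" "regular_seq A (insert (\<phi> x) G) xs"
    using Suc.IH[of "insert (\<phi> x) G"] Suc.prems(1) x(3) by auto
  moreover have "\<phi> x \<in> extn M" using extnI[OF phi_closed x(1) _ px] one_notin by simp
  ultimately show ?case by (intro exI[of _ "\<phi> x # xs"]) (simp add: regular_seq_Cons)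
qed

lemma maximal_extn_M: "maximalideal (extn M) A"
proof (rule maximal_extn)
  have "sid M" using ideal_M prime_M by (auto simp: sid_def prime_set_def)
  then show "tsat M" using IM by (simp add: tsat_sid)
  show "1 \<in> J" if J: "tsat J" "M \<subset> J" for J
    using sid_sub_M[of J] J tsat_sid by blast
qed (rule one_notin)

lemma local_depth_eq: "local_depth A = Sup {enat r | r. dep M r (sat M I)}"
proof -
  have z: "pre (Idl {\<zero>}) = sat M I" by (simp add: genideal_zero pre_zero)
  have "(\<exists>xs. r = length xs \<and> (\<exists>\<mm>. maximalideal \<mm> A \<and> set xs \<subseteq> \<mm> \<and> regular_seq A {\<zero>} xs)) \<longleftrightarrow>
    dep M r (sat M I)" for r
  proof
    assume "\<exists>xs. r = length xs \<and> (\<exists>\<mm>. maximalideal \<mm> A \<and> set xs \<subseteq> \<mm> \<and> regular_seq A {\<zero>} xs)"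
    then obtain xs N where xs: "r = length xs" "maximalideal N A" "set xs \<subseteq> N" "regular_seq A {\<zero>} xs" by blast
    interpret N: maximalideal N A by (rule xs(2))
    show "dep M r (sat M I)"
      using regular_seq_imp_dep[of "{\<zero>}" xs N] xs N.is_ideal N.I_notcarr z by auto
  next
    assume "dep M r (sat M I)"
    then obtain xs where "length xs = r" "set xs \<subseteq> extn M" "regular_seq A {\<zero>} xs"
      using dep_imp_regular_seq[of "{\<zero>}" r] z by auto
    then show "\<exists>xs. r = length xs \<and> (\<exists>\<mm>. maximalideal \<mm> A \<and> set xs \<subseteq> \<mm> \<and> regular_seq A {\<zero>} xs)"
      using maximal_extn_M by blast
  qed
  then have "{enat (length xs) | xs. \<exists>\<mm>. maximalideal \<mm> A \<and> set xs \<subseteq> \<mm> \<and> regular_seq A {\<zero>} xs} =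
    {enat r | r. dep M r (sat M I)}" by blast
  then show ?thesis unfolding local_depth_def by simp
qed

end

section \<open>The localization as a commutative ring\<close>

context primeideal
begin

lemma one_notin_prime: "\<one> \<in> carrier R - I"
  using I_notcarr one_imp_carrier by blast

lemma prime_mult_closed: "x \<in> carrier R - I \<Longrightarrow> y \<in> carrier R - I \<Longrightarrow> x \<otimes> y \<in> carrier R - I"
  using I_prime by blast

lemma frac_at_eqI:
  assumes "a \<in> carrier R" "s \<in> carrier R - I" "b \<in> carrier R" "t \<in> carrier R - I" "a \<otimes> t = b \<otimes> s"
  shows "frac_at R I a s = frac_at R I b t"
proof -
  have "\<one> \<otimes> (a \<otimes> t) = \<one> \<otimes> (b \<otimes> s)" using assms(5) by simp
  then show ?thesis using frac_at_eq_iff[OF assms(1-4)] one_notin_prime by blast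
qed

lemma localization_simps:
  "carrier (localization R I) = {frac_at R I a s | a s. a \<in> carrier R \<and> s \<in> carrier R - I}"
  "\<one>\<^bsub>localization R I\<^esub> = frac_at R I \<one> \<one>" "\<zero>\<^bsub>localization R I\<^esub> = frac_at R I \<zero> \<one>"
  by (simp_all add: localization_def)

lemma frac_at_carrier: "a \<in> carrier R \<Longrightarrow> s \<in> carrier R - I \<Longrightarrow> frac_at R I a s \<in> carrier (localization R I)"
  by (auto simp: localization_simps)

lemma cring_localization: "cring (localization R I)"
proof (rule cringI)
  let ?L = "localization R I"
  note fm = frac_at_mult and fa = frac_at_add and cl = prime_mult_closed one_notin_prime
  have ex: "\<exists>a s. x = frac_at R I a s \<and> a \<in> carrier R \<and> s \<in> carrier R \<and> s \<in> carrier R - I"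
    if "x \<in> carrier ?L" for x
    using that by (auto simp: localization_simps)
  show "abelian_group ?L"
  proof (rule abelian_groupI)
    fix x y assume xy: "x \<in> carrier ?L" "y \<in> carrier ?L"
    obtain a s where a: "x = frac_at R I a s" "a \<in> carrier R" "s \<in> carrier R" "s \<in> carrier R - I" using ex[OF xy(1)] by blast
    obtain b t where b: "y = frac_at R I b t" "b \<in> carrier R" "t \<in> carrier R" "t \<in> carrier R - I" using ex[OF xy(2)] by blast
    have st: "s \<otimes> t \<in> carrier R - I" "t \<otimes> s \<in> carrier R - I" using cl a b by blast+
    show "x \<oplus>\<^bsub>?L\<^esub> y \<in> carrier ?L"
      unfolding a(1) b(1) fa[OF a(2,4) b(2,4)] using a b st by (intro frac_at_carrier) auto
    show "x \<oplus>\<^bsub>?L\<^esub> y = y \<oplus>\<^bsub>?L\<^esub> x"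
      unfolding a(1) b(1) fa[OF a(2,4) b(2,4)] fa[OF b(2,4) a(2,4)]
      using a b by (simp add: m_comm a_comm)
    fix z assume z: "z \<in> carrier ?L"
    obtain c r where c: "z = frac_at R I c r" "c \<in> carrier R" "r \<in> carrier R" "r \<in> carrier R - I" using ex[OF z] by blast
    have tr: "t \<otimes> r \<in> carrier R - I" using cl c b by blast
    have 1: "a \<otimes> t \<oplus> b \<otimes> s \<in> carrier R" "b \<otimes> r \<oplus> c \<otimes> t \<in> carrier R" using a b c by auto
    show "x \<oplus>\<^bsub>?L\<^esub> y \<oplus>\<^bsub>?L\<^esub> z = x \<oplus>\<^bsub>?L\<^esub> (y \<oplus>\<^bsub>?L\<^esub> z)"
      unfolding a(1) b(1) c(1) fa[OF a(2,4) b(2,4)] fa[OF b(2,4) c(2,4)] fa[OF 1(1) st(1) c(2,4)] fa[OF a(2,4) 1(2) tr]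
      using a b c by (simp add: l_distr r_distr m_ac a_ac)
  next
    show "\<zero>\<^bsub>?L\<^esub> \<in> carrier ?L" unfolding localization_simps(3) using one_notin_prime by (intro frac_at_carrier) auto
  next
    fix x assume x: "x \<in> carrier ?L"
    obtain a s where a: "x = frac_at R I a s" "a \<in> carrier R" "s \<in> carrier R" "s \<in> carrier R - I" using ex[OF x] by blast
    show "\<zero>\<^bsub>?L\<^esub> \<oplus>\<^bsub>?L\<^esub> x = x"
      unfolding a(1) localization_simps(3) fa[OF zero_closed one_notin_prime a(2,4)] using a by simp
    have ss: "s \<otimes> s \<in> carrier R - I" using cl a by blast
    have "frac_at R I (\<ominus> a) s \<oplus>\<^bsub>?L\<^esub> x = frac_at R I ((\<ominus> a) \<otimes> s \<oplus> a \<otimes> s) (s \<otimes> s)"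
      unfolding a(1) by (rule fa) (use a in auto)
    also have "(\<ominus> a) \<otimes> s \<oplus> a \<otimes> s = \<zero>" using a by (simp add: l_minus l_neg)
    also have "frac_at R I \<zero> (s \<otimes> s) = frac_at R I \<zero> \<one>"
      by (rule frac_at_eqI) (use ss one_notin_prime in auto)
    finally have "frac_at R I (\<ominus> a) s \<oplus>\<^bsub>?L\<^esub> x = \<zero>\<^bsub>?L\<^esub>" by (simp add: localization_simps)
    moreover have "frac_at R I (\<ominus> a) s \<in> carrier ?L" using a by (intro frac_at_carrier) auto
    ultimately show "\<exists>y\<in>carrier ?L. y \<oplus>\<^bsub>?L\<^esub> x = \<zero>\<^bsub>?L\<^esub>" by blast
  qed
  show "comm_monoid ?L"
  proof (rule comm_monoidI)
    show "\<one>\<^bsub>?L\<^esub> \<in> carrier ?L" unfolding localization_simps(2) using one_notin_prime by (intro frac_at_carrier) auto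
  next
    fix x y assume xy: "x \<in> carrier ?L" "y \<in> carrier ?L"
    obtain a s where a: "x = frac_at R I a s" "a \<in> carrier R" "s \<in> carrier R" "s \<in> carrier R - I" using ex[OF xy(1)] by blast
    obtain b t where b: "y = frac_at R I b t" "b \<in> carrier R" "t \<in> carrier R" "t \<in> carrier R - I" using ex[OF xy(2)] by blast
    have st: "s \<otimes> t \<in> carrier R - I" using cl a b by blast
    show "x \<otimes>\<^bsub>?L\<^esub> y \<in> carrier ?L"
      unfolding a(1) b(1) fm[OF a(2,4) b(2,4)] using a b st by (intro frac_at_carrier) auto
    show "x \<otimes>\<^bsub>?L\<^esub> y = y \<otimes>\<^bsub>?L\<^esub> x"
      unfolding a(1) b(1) fm[OF a(2,4) b(2,4)] fm[OF b(2,4) a(2,4)] using a b by (simp add: m_comm)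
    show "\<one>\<^bsub>?L\<^esub> \<otimes>\<^bsub>?L\<^esub> x = x"
      unfolding a(1) localization_simps(2) fm[OF one_closed one_notin_prime a(2,4)] using a by simp
    fix z assume z: "z \<in> carrier ?L"
    obtain c r where c: "z = frac_at R I c r" "c \<in> carrier R" "r \<in> carrier R" "r \<in> carrier R - I" using ex[OF z] by blast
    have tr: "t \<otimes> r \<in> carrier R - I" using cl c b by blast
    show "x \<otimes>\<^bsub>?L\<^esub> y \<otimes>\<^bsub>?L\<^esub> z = x \<otimes>\<^bsub>?L\<^esub> (y \<otimes>\<^bsub>?L\<^esub> z)"
      unfolding a(1) b(1) c(1) fm[OF a(2,4) b(2,4)] fm[OF b(2,4) c(2,4)]
        fm[OF m_closed[OF a(2) b(2)] st c(2,4)] fm[OF a(2,4) m_closed[OF b(2) c(2)] tr]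
      using a b c by (simp add: m_assoc)
  qed
  fix x y z assume xyz: "x \<in> carrier ?L" "y \<in> carrier ?L" "z \<in> carrier ?L"
  obtain a s where a: "x = frac_at R I a s" "a \<in> carrier R" "s \<in> carrier R" "s \<in> carrier R - I" using ex[OF xyz(1)] by blast
  obtain b t where b: "y = frac_at R I b t" "b \<in> carrier R" "t \<in> carrier R" "t \<in> carrier R - I" using ex[OF xyz(2)] by blast
  obtain c r where c: "z = frac_at R I c r" "c \<in> carrier R" "r \<in> carrier R" "r \<in> carrier R - I" using ex[OF xyz(3)] by blast
  have st: "s \<otimes> t \<in> carrier R - I" "s \<otimes> r \<in> carrier R - I" "t \<otimes> r \<in> carrier R - I" using cl a b c by blast+
  have 1: "a \<otimes> t \<oplus> b \<otimes> s \<in> carrier R" using a b by auto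
  show "(x \<oplus>\<^bsub>?L\<^esub> y) \<otimes>\<^bsub>?L\<^esub> z = x \<otimes>\<^bsub>?L\<^esub> z \<oplus>\<^bsub>?L\<^esub> y \<otimes>\<^bsub>?L\<^esub> z"
    unfolding a(1) b(1) c(1) fa[OF a(2,4) b(2,4)] fm[OF a(2,4) c(2,4)] fm[OF b(2,4) c(2,4)] fm[OF 1 st(1) c(2,4)]
      fa[OF m_closed[OF a(2) c(2)] st(2) m_closed[OF b(2) c(2)] st(3)]
  proof (rule frac_at_eqI)
    show "s \<otimes> t \<otimes> r \<in> carrier R - I" "s \<otimes> r \<otimes> (t \<otimes> r) \<in> carrier R - I" using cl st c by blast+
    show "(a \<otimes> t \<oplus> b \<otimes> s) \<otimes> c \<otimes> (s \<otimes> r \<otimes> (t \<otimes> r)) = (a \<otimes> c \<otimes> (t \<otimes> r) \<oplus> b \<otimes> c \<otimes> (s \<otimes> r)) \<otimes> (s \<otimes> t \<otimes> r)"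
      using a b c by (simp add: l_distr r_distr m_ac)
  qed (use a b c in auto)
qed

end


section \<open>The polynomial ring as a HOL-Algebra ring\<close>

lemma type_ring_simps [simp]:
  "carrier ring_of_type_algebra = UNIV" "x \<otimes>\<^bsub>ring_of_type_algebra\<^esub> y = x * y"
  "\<one>\<^bsub>ring_of_type_algebra\<^esub> = 1" "\<zero>\<^bsub>ring_of_type_algebra\<^esub> = 0" "x \<oplus>\<^bsub>ring_of_type_algebra\<^esub> y = x + y"
  by (simp_all add: ring_of_type_algebra_def)

lemma ideal_type_ring_iff:
  "ideal J (ring_of_type_algebra :: 'a::comm_ring_1 ring) \<longleftrightarrow> idl.subspace J"
proof
  assume "ideal J (ring_of_type_algebra :: 'a ring)"
  then interpret J: ideal J "ring_of_type_algebra :: 'a ring" .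
  show "idl.subspace J"
  proof (rule idl.subspaceI)
    note J.is_additive_subgroup
    then show "0 \<in> J" using additive_subgroup.zero_closed by fastforce
    show "x + y \<in> J" if "x \<in> J" "y \<in> J" for x y
      using additive_subgroup.a_closed[OF J.is_additive_subgroup that] by simp
    show "c * x \<in> J" if "x \<in> J" for c x using J.I_l_closed[OF that, of c] by simp
  qed
next
  assume J: "idl.subspace J"
  show "ideal J (ring_of_type_algebra :: 'a ring)"
    by (rule cring.ideal_intro[OF cring_from_type_algebra])
       (use J in \<open>auto intro: idl.subspace_0 idl.subspace_add ideal_mult(2)\<close>)
qed

lemma genideal_type_ring:
  "Idl\<^bsub>ring_of_type_algebra\<^esub> G = idl.span (G :: 'a::comm_ring_1 set)"
  by (simp add: genideal_def ideal_type_ring_iff idl.span_def hull_def)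

lemma pow_type_ring: "x [^]\<^bsub>ring_of_type_algebra\<^esub> (k::nat) = (x :: 'a::comm_ring_1) ^ k"
proof -
  interpret cring "ring_of_type_algebra :: 'a ring" by (rule cring_from_type_algebra)
  show ?thesis by (induction k) (simp_all add: mult.commute)
qed

lemma colon_type_ring_iff:
  assumes J: "idl.subspace (J :: 'a::comm_ring_1 set)"
  shows "colon_ideal ring_of_type_algebra J x = J \<longleftrightarrow> reg J x"
proof -
  have "J \<subseteq> colon_ideal ring_of_type_algebra J x" using ideal_mult(2)[OF J] by (auto simp: colon_ideal_def)
  then have "colon_ideal ring_of_type_algebra J x = J \<longleftrightarrow> colon_ideal ring_of_type_algebra J x \<subseteq> J" by blast
  also have "\<dots> \<longleftrightarrow> reg J x" by (auto simp: colon_ideal_def reg_def mult.commute)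
  finally show ?thesis .
qed

lemma span_insert_span: "idl.span (insert x (idl.span G)) = idl.span (insert x G)"
  for G :: "'a::comm_ring_1 set"
  using span_Un_span[of G "{x}"] by simp

lemma regular_seq_type_ring_iff:
  "regular_seq ring_of_type_algebra G xs \<longleftrightarrow> rseq (idl.span (G :: 'a::comm_ring_1 set)) xs"
proof (induction xs arbitrary: G)
  case Nil
  show ?case by (simp add: regular_seq_Nil)
next
  case (Cons x xs)
  show ?case
    by (simp add: regular_seq_Cons genideal_type_ring colon_type_ring_iff Cons.IH span_insert_span)
qed

lemma fraction_ring_Quot:
  fixes I :: "'a::comm_ring_1 set"
  assumes I: "idl.subspace I"
  shows "fraction_ring (ring_of_type_algebra Quot I) ((+>\<^bsub>ring_of_type_algebra\<^esub>) I) I {1}"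
proof -
  let ?S = "ring_of_type_algebra :: 'a ring"
  interpret S: cring ?S by (rule cring_from_type_algebra)
  interpret I: ideal I ?S using I by (simp add: ideal_type_ring_iff)
  interpret Q: cring "?S Quot I" by (rule I.quotient_is_cring[OF cring_from_type_algebra])
  note hom = ring_hom_memE[OF I.rcos_ring_hom]
  show ?thesis
  proof (unfold_locales)
    show "idl.subspace I" by (rule I)
    show cl: "I +>\<^bsub>?S\<^esub> s \<in> carrier (?S Quot I)" for s using hom(1)[of s] by simp
    show "I +>\<^bsub>?S\<^esub> (s * t) = (I +>\<^bsub>?S\<^esub> s) \<otimes>\<^bsub>?S Quot I\<^esub> (I +>\<^bsub>?S\<^esub> t)" for s t using hom(2)[of s t] by simp
    show "I +>\<^bsub>?S\<^esub> (s + t) = (I +>\<^bsub>?S\<^esub> s) \<oplus>\<^bsub>?S Quot I\<^esub> (I +>\<^bsub>?S\<^esub> t)" for s t using hom(3)[of s t] by simp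
    show one: "I +>\<^bsub>?S\<^esub> 1 = \<one>\<^bsub>?S Quot I\<^esub>" using hom(4) by simp
    show "I +>\<^bsub>?S\<^esub> u \<in> Units (?S Quot I)" if "u \<in> {1}" for u using one that Q.Units_one_closed by simp
    show "\<exists>s u. u \<in> {1} \<and> a \<otimes>\<^bsub>?S Quot I\<^esub> (I +>\<^bsub>?S\<^esub> u) = I +>\<^bsub>?S\<^esub> s" if a: "a \<in> carrier (?S Quot I)" for a
    proof -
      obtain s where "a = I +>\<^bsub>?S\<^esub> s" using a by (auto simp: FactRing_def A_RCOSETS_def')
      then show ?thesis using a one by auto
    qed
    show "I +>\<^bsub>?S\<^esub> s = \<zero>\<^bsub>?S Quot I\<^esub> \<longleftrightarrow> (\<exists>u\<in>{1}. u * s \<in> I)" for s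
    proof -
      have "I +>\<^bsub>?S\<^esub> s = I \<longleftrightarrow> s \<in> I"
        using S.a_rcos_zero[OF I.is_ideal, of s] I.a_rcos_self[of s] by auto
      then show ?thesis by (simp add: FactRing_def)
    qed
  qed auto
qed

text \<open>Taking residues and then fractions presents the localization of the quotient as
  fractions over the original ring modulo \<open>I\<close>, with denominators outside the preimage
  \<open>M\<close> of \<open>N\<close>; all its ideals thus become ideals of that ring.\<close>

lemma localization_at_Quot:
  fixes I :: "'a::comm_ring_1 set"
  assumes noeth: "noeth TYPE('a)" and I: "idl.subspace I"
    and N: "primeideal N (ring_of_type_algebra Quot I)"
  defines "\<psi> \<equiv> \<lambda>s. frac_at (ring_of_type_algebra Quot I) N (I +>\<^bsub>ring_of_type_algebra\<^esub> s) \<one>\<^bsub>ring_of_type_algebra Quot I\<^esub>"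
    and "M \<equiv> {s. I +>\<^bsub>ring_of_type_algebra\<^esub> s \<in> N}"
  shows "localization_at (localization (ring_of_type_algebra Quot I) N) \<psi> I M"
proof -
  let ?S = "ring_of_type_algebra :: 'a ring" and ?\<phi> = "(+>\<^bsub>ring_of_type_algebra\<^esub>) I"
  let ?L = "localization (?S Quot I) N"
  interpret Q: fraction_ring "?S Quot I" ?\<phi> I "{1}" using I by (rule fraction_ring_Quot)
  interpret N: primeideal N "?S Quot I" by (rule N)
  interpret L: cring ?L by (rule N.cring_localization)
  have M: "M = Q.pre N" by (simp add: M_def Q.pre_def)
  have prime: "prime_set M" unfolding M using Q.prime_pre(1)[OF N] .
  have IM: "I \<subseteq> M" unfolding M using Q.tsat_pre[OF N.is_ideal] by (simp add: Q.tsat_def)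
  have out: "?\<phi> u \<in> carrier (?S Quot I) - N" if "u \<notin> M" for u using that Q.phi_closed by (simp add: M_def)
  note one = N.one_notin_prime
  have psi_mult: "\<psi> (s * t) = \<psi> s \<otimes>\<^bsub>?L\<^esub> \<psi> t" for s t
    unfolding \<psi>_def N.frac_at_mult[OF Q.phi_closed one Q.phi_closed one] by (simp add: Q.phi_mult)
  show ?thesis
  proof (unfold_locales)
    show "idl.subspace I" by (rule I)
    show "1 \<in> - M" using prime_setD(2)[OF prime] by simp
    show "u * v \<in> - M" if "u \<in> - M" "v \<in> - M" for u v using prime_mult_notin[OF prime] that by simp
    show "\<psi> s \<in> carrier ?L" for s unfolding \<psi>_def by (rule N.frac_at_carrier[OF Q.phi_closed one])
    show "\<psi> (s * t) = \<psi> s \<otimes>\<^bsub>?L\<^esub> \<psi> t" for s t by (rule psi_mult)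
    show "\<psi> (s + t) = \<psi> s \<oplus>\<^bsub>?L\<^esub> \<psi> t" for s t
      unfolding \<psi>_def N.frac_at_add[OF Q.phi_closed one Q.phi_closed one] by (simp add: Q.phi_add)
    show "\<psi> 1 = \<one>\<^bsub>?L\<^esub>" by (simp add: \<psi>_def Q.phi_one N.localization_simps)
    show "\<psi> u \<in> Units ?L" if "u \<in> - M" for u
    proof -
      have u: "?\<phi> u \<in> carrier (?S Quot I) - N" using out that by simp
      have "\<psi> u \<otimes>\<^bsub>?L\<^esub> frac_at (?S Quot I) N \<one>\<^bsub>?S Quot I\<^esub> (?\<phi> u) =
          frac_at (?S Quot I) N (?\<phi> u \<otimes>\<^bsub>?S Quot I\<^esub> \<one>\<^bsub>?S Quot I\<^esub>) (\<one>\<^bsub>?S Quot I\<^esub> \<otimes>\<^bsub>?S Quot I\<^esub> ?\<phi> u)"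
        unfolding \<psi>_def by (rule N.frac_at_mult[OF Q.phi_closed one _ u]) simp
      also have "\<dots> = frac_at (?S Quot I) N \<one>\<^bsub>?S Quot I\<^esub> \<one>\<^bsub>?S Quot I\<^esub>"
        by (rule N.frac_at_eqI) (use u one in auto)
      also have "\<dots> = \<one>\<^bsub>?L\<^esub>" by (simp add: N.localization_simps)
      finally have 1: "\<psi> u \<otimes>\<^bsub>?L\<^esub> frac_at (?S Quot I) N \<one>\<^bsub>?S Quot I\<^esub> (?\<phi> u) = \<one>\<^bsub>?L\<^esub>" .
      have 2: "\<psi> u \<in> carrier ?L" unfolding \<psi>_def by (rule N.frac_at_carrier[OF Q.phi_closed one])
      have 3: "frac_at (?S Quot I) N \<one>\<^bsub>?S Quot I\<^esub> (?\<phi> u) \<in> carrier ?L"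
        by (rule N.frac_at_carrier[OF _ u]) simp
      show ?thesis using 1 2 3 L.m_comm[OF 2 3] unfolding Units_def by auto
    qed
    show "\<exists>s u. u \<in> - M \<and> a \<otimes>\<^bsub>?L\<^esub> \<psi> u = \<psi> s" if aL: "a \<in> carrier ?L" for a
    proof -
      obtain r q where a: "a = frac_at (?S Quot I) N r q" "r \<in> carrier (?S Quot I)" "q \<in> carrier (?S Quot I) - N"
        using aL unfolding N.localization_simps by blast
      obtain s where s: "r = ?\<phi> s" using Q.phi_surj[OF a(2)] a(2) by (auto simp: Q.phi_one)
      obtain u where u: "q = ?\<phi> u" using Q.phi_surj[of q] a(3) by (auto simp: Q.phi_one)
      have uM: "u \<in> - M" using a(3) u by (simp add: M_def)
      have "a \<otimes>\<^bsub>?L\<^esub> \<psi> u = frac_at (?S Quot I) N (r \<otimes>\<^bsub>?S Quot I\<^esub> q) (q \<otimes>\<^bsub>?S Quot I\<^esub> \<one>\<^bsub>?S Quot I\<^esub>)"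
        unfolding \<psi>_def a(1) u[symmetric] by (rule N.frac_at_mult[OF a(2,3) _ one]) (use a in simp)
      also have "\<dots> = \<psi> s" unfolding \<psi>_def s[symmetric]
        by (rule N.frac_at_eqI) (use a one in \<open>auto simp: Q.m_comm\<close>)
      finally show ?thesis using uM by blast
    qed
    show "\<psi> s = \<zero>\<^bsub>?L\<^esub> \<longleftrightarrow> (\<exists>u\<in>-M. u * s \<in> I)" for s
    proof -
      have "\<psi> s = \<zero>\<^bsub>?L\<^esub> \<longleftrightarrow> (\<exists>q\<in>carrier (?S Quot I) - N. q \<otimes>\<^bsub>?S Quot I\<^esub> ?\<phi> s = \<zero>\<^bsub>?S Quot I\<^esub>)"
        unfolding \<psi>_def N.localization_simps
        by (subst N.frac_at_eq_iff[OF Q.phi_closed one Q.zero_closed one]) auto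
      also have "\<dots> \<longleftrightarrow> (\<exists>u\<in>-M. ?\<phi> (u * s) = \<zero>\<^bsub>?S Quot I\<^esub>)"
      proof
        assume "\<exists>q\<in>carrier (?S Quot I) - N. q \<otimes>\<^bsub>?S Quot I\<^esub> ?\<phi> s = \<zero>\<^bsub>?S Quot I\<^esub>"
        then obtain q where q: "q \<in> carrier (?S Quot I)" "q \<notin> N" "q \<otimes>\<^bsub>?S Quot I\<^esub> ?\<phi> s = \<zero>\<^bsub>?S Quot I\<^esub>" by blast
        obtain u where u: "q = ?\<phi> u" using Q.phi_surj[OF q(1)] q(1) by (auto simp: Q.phi_one)
        show "\<exists>u\<in>-M. ?\<phi> (u * s) = \<zero>\<^bsub>?S Quot I\<^esub>"
          using q u by (intro bexI[of _ u]) (auto simp: Q.phi_mult M_def)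
      next
        assume "\<exists>u\<in>-M. ?\<phi> (u * s) = \<zero>\<^bsub>?S Quot I\<^esub>"
        then obtain u where "u \<in> - M" "?\<phi> u \<otimes>\<^bsub>?S Quot I\<^esub> ?\<phi> s = \<zero>\<^bsub>?S Quot I\<^esub>" by (auto simp: Q.phi_mult)
        then show "\<exists>q\<in>carrier (?S Quot I) - N. q \<otimes>\<^bsub>?S Quot I\<^esub> ?\<phi> s = \<zero>\<^bsub>?S Quot I\<^esub>"
          using out[of u] by (intro bexI[of _ "?\<phi> u"]) auto
      qed
      also have "\<dots> \<longleftrightarrow> (\<exists>u\<in>-M. u * s \<in> I)" by (simp add: Q.phi_ker)
      finally show ?thesis .
    qed
    show "noeth TYPE('a)" by (rule noeth)
    show "prime_set M" by (rule prime)
    show "I \<subseteq> M" by (rule IM)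
  qed
qed

lemma local_depth_krull_dim_Quot:
  fixes I :: "'a::comm_ring_1 set"
  assumes noeth: "noeth TYPE('a)" and I: "idl.subspace I"
    and N: "primeideal N (ring_of_type_algebra Quot I)"
  defines "M \<equiv> {s. I +>\<^bsub>ring_of_type_algebra\<^esub> s \<in> N}"
  shows "local_depth (localization (ring_of_type_algebra Quot I) N) = Sup {enat r | r. dep M r (sat M I)}"
    and "krull_dim (localization (ring_of_type_algebra Quot I) N) =
      Sup {enat l | l. \<exists>P. prime_chain P l \<and> I \<subseteq> P 0 \<and> P l \<subseteq> M}"
proof -
  interpret localization_at "localization (ring_of_type_algebra Quot I) N"
    "\<lambda>s. frac_at (ring_of_type_algebra Quot I) N (I +>\<^bsub>ring_of_type_algebra\<^esub> s) \<one>\<^bsub>ring_of_type_algebra Quot I\<^esub>" I M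
    unfolding M_def by (rule localization_at_Quot[OF noeth I N])
  show "local_depth (localization (ring_of_type_algebra Quot I) N) = Sup {enat r | r. dep M r (sat M I)}"
    by (rule local_depth_eq)
  have "P l \<inter> - M = {} \<longleftrightarrow> P l \<subseteq> M" for P :: "nat \<Rightarrow> 'a set" and l by blast
  then show "krull_dim (localization (ring_of_type_algebra Quot I) N) =
      Sup {enat l | l. \<exists>P. prime_chain P l \<and> I \<subseteq> P 0 \<and> P l \<subseteq> M}"
    unfolding krull_dim_eq by simp
qed

text \<open>Maximality is rendered as invertibility modulo \<open>M\<close> of everything outside
  \<open>M\<close>, the form in which \<open>zariski\<close> uses it.\<close>

lemma maximal_Quot_iff:
  fixes I :: "'a::comm_ring_1 set"
  assumes I: "idl.subspace I"
  shows "(\<forall>N. maximalideal N (ring_of_type_algebra Quot I) \<longrightarrow> Q {s. I +>\<^bsub>ring_of_type_algebra\<^esub> s \<in> N}) \<longleftrightarrow>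
    (\<forall>M. prime_set M \<and> (\<forall>p. p \<notin> M \<longrightarrow> (\<exists>q. p * q - 1 \<in> M)) \<and> I \<subseteq> M \<longrightarrow> Q M)"
proof -
  let ?S = "ring_of_type_algebra :: 'a ring" and ?\<phi> = "(+>\<^bsub>ring_of_type_algebra\<^esub>) I"
  interpret R: fraction_ring "?S Quot I" ?\<phi> I "{1}" using I by (rule fraction_ring_Quot)
  have ts: "R.tsat J \<longleftrightarrow> idl.subspace J \<and> I \<subseteq> J" for J by (auto simp: R.tsat_def)
  have 1: "prime_set (R.pre N) \<and> (\<forall>p. p \<notin> R.pre N \<longrightarrow> (\<exists>q. p * q - 1 \<in> R.pre N)) \<and> I \<subseteq> R.pre N"
    if N: "maximalideal N (?S Quot I)" for N
  proof (intro conjI allI impI)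
    interpret N: maximalideal N "?S Quot I" by (rule N)
    have pr: "primeideal N (?S Quot I)" by (rule R.maximalideal_prime[OF N])
    show prime: "prime_set (R.pre N)" by (rule R.prime_pre(1)[OF pr])
    have "R.tsat (R.pre N)" by (rule R.tsat_pre[OF N.is_ideal])
    then have Mid: "idl.subspace (R.pre N)" and IM: "I \<subseteq> R.pre N" by (simp_all add: ts)
    show "I \<subseteq> R.pre N" by (rule IM)
    fix p assume p: "p \<notin> R.pre N"
    define J where "J = idl.span (insert p (R.pre N))"
    have J: "R.pre N \<subseteq> J" "p \<in> J" unfolding J_def using idl.span_superset[of "insert p (R.pre N)"] by auto
    then have tJ: "R.tsat J" using IM by (auto simp: ts J_def)
    have idJ: "ideal (R.extn J) (?S Quot I)" unfolding J_def by (rule R.ideal_extn) simp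
    have pe: "R.pre (R.extn J) = J" by (rule R.pre_extn[OF tJ])
    have "N \<subseteq> R.extn J" using R.pre_mono_iff[OF N.is_ideal idJ] J pe by simp
    moreover have "R.extn J \<noteq> N" using pe J(2) p by auto
    moreover have "R.extn J \<subseteq> carrier (?S Quot I)" by (auto simp: R.extn_def)
    ultimately have "R.extn J = carrier (?S Quot I)" using N.I_maximal[OF idJ] by blast
    then have "1 \<in> J" using R.one_in_pre[OF idJ] pe by simp
    then obtain c where "1 - c * p \<in> R.pre N" unfolding J_def using span_insert_iff[OF Mid] by blast
    then have "- (1 - c * p) \<in> R.pre N" by (rule idl.subspace_neg[OF Mid])
    then have "p * c - 1 \<in> R.pre N" by (simp add: mult.commute)
    then show "\<exists>q. p * q - 1 \<in> R.pre N" by blast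
  qed
  have 2: "\<exists>N. maximalideal N (?S Quot I) \<and> R.pre N = M"
    if M: "prime_set M" "\<And>p. p \<notin> M \<Longrightarrow> \<exists>q. p * q - 1 \<in> M" "I \<subseteq> M" for M
  proof (intro exI conjI)
    have tM: "R.tsat M" using M prime_setD(1) by (auto simp: ts)
    then show "R.pre (R.extn M) = M" by (rule R.pre_extn)
    show "maximalideal (R.extn M) (?S Quot I)"
    proof (rule R.maximal_extn[OF tM prime_setD(2)[OF M(1)]])
      fix J assume J: "R.tsat J" "M \<subset> J"
      then have Jid: "idl.subspace J" by (simp add: ts)
      obtain p where p: "p \<in> J" "p \<notin> M" using J(2) by blast
      obtain q where q: "p * q - 1 \<in> M" using M(2)[OF p(2)] by blast
      have "p * q - 1 \<in> J" using J(2) q by blast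
      from idl.subspace_diff[OF Jid ideal_mult(2)[OF Jid p(1)] this, of q] show "1 \<in> J" by simp
    qed
  qed
  show ?thesis using 1 2 unfolding R.pre_def[symmetric] by metis
qed

lemma one_ideal_UNIV: "idl.subspace J \<Longrightarrow> 1 \<in> J \<Longrightarrow> J = UNIV" for J :: "'a::comm_ring_1 set"
  using ideal_mult(1)[of J 1] by auto

theorem theorem3p9:
  fixes I :: "('n::finite, 'k::field) mpoly set"
    and lam :: "'n \<Rightarrow> 'k"
    and d :: nat
  assumes "infinite (UNIV :: 'k set) \<or> CARD('n) \<le> CARD('k)"
    and "monomial_ideal I"
    and "I \<noteq> carrier poly_S"
    and "krull_dim (poly_S Quot I) = enat d"
    and "inj lam"
  shows "linear_system_of_parameters I (map (vandermonde_form lam) [1..<Suc d]) \<and>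
    (cohen_macaulay (poly_S Quot I) \<longleftrightarrow>
      regular_seq poly_S I (map (vandermonde_form lam) [1..<Suc d]))"
proof -
  obtain E where E: "I = idl.span (monomial ` E)"
    using assms(2) by (auto simp: monomial_ideal_def genideal_type_ring)
  have Iid: "idl.subspace I" by (simp add: E)
  have "1 \<notin> I" using one_ideal_UNIV[OF Iid] assms(3) by auto
  with E interpret monomial_id I E by unfold_locales
  interpret Q: fraction_ring "poly_S Quot I" "(+>\<^bsub>poly_S\<^esub>) I" I "{1}" using Iid by (rule fraction_ring_Quot)
  \<comment> \<open>For denominators \<open>{1}\<close> the disjointness condition in
    \<open>krull_dim_eq\<close> holds for every chain, as primes are proper.\<close>
  have disj: "P l \<inter> {1} = {}" if "prime_chain P l" for P :: "nat \<Rightarrow> ('n, 'k) mpoly set" and l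
    using that prime_setD(2)[of "P l"] by (auto simp: prime_chain_def)
  have "(\<exists>P. prime_chain P l \<and> I \<subseteq> P 0 \<and> P l \<inter> {1} = {}) \<longleftrightarrow>
      (\<exists>P :: nat \<Rightarrow> ('n, 'k) mpoly set. prime_chain P l \<and> I \<subseteq> P 0)" for l
    by (rule ex_cong1) (use disj in metis)
  then have dim: "Sup {enat l | l. \<exists>P :: nat \<Rightarrow> ('n, 'k) mpoly set. prime_chain P l \<and> I \<subseteq> P 0} = enat d"
    using assms(4) Q.krull_dim_eq by simp
  note rad = radical[OF dim assms(5)]
  have hom: "homogeneous 1 f" if "f \<in> set (forms lam d)" for f
    using that homogeneous_vandermonde[of lam] unfolding set_forms by blast
  have "radical poly_S (idl.span (I \<union> set (forms lam d))) = mm"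
  proof
    show "radical poly_S (idl.span (I \<union> set (forms lam d))) \<subseteq> mm"
    proof
      fix x assume "x \<in> radical poly_S (idl.span (I \<union> set (forms lam d)))"
      then obtain k where "x ^ k \<in> idl.span (I \<union> set (forms lam d))"
        by (auto simp: radical_def pow_type_ring simp del: upt_Suc)
      moreover have "idl.span (I \<union> set (forms lam d)) \<subseteq> mm"
        using I_sub_mm homogeneous_in_mm[OF hom] by (intro idl.span_minimal prime_setD(1)[OF prime_mm]) auto
      ultimately show "x \<in> mm" using prime_power[OF prime_mm] by blast
    qed
    show "mm \<subseteq> radical poly_S (idl.span (I \<union> set (forms lam d)))"
    proof
      fix x :: "('n, 'k) mpoly" assume x: "x \<in> mm"
      have "\<exists>k. x ^ k \<in> idl.span (I \<union> set (forms lam d))"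
      proof (rule radical_via_primes[OF noeth_mpoly])
        fix P assume P: "prime_set P" "idl.span (I \<union> set (forms lam d)) \<subseteq> P"
        \<comment> \<open>A prime above \<open>I\<close> and the forms contains all variables by
          \<open>rad\<close>, hence the whole ideal \<open>mm\<close>.\<close>
        have "range var \<subseteq> P" using rad P prime_power[OF P(1)] by blast
        then show "x \<in> P" using x idl.span_minimal[OF _ prime_setD(1)[OF P(1)]] unfolding mm_eq_span by blast
      qed simp
      then show "x \<in> radical poly_S (idl.span (I \<union> set (forms lam d)))"
        by (simp add: radical_def pow_type_ring del: upt_Suc)
    qed
  qed
  moreover have "length (forms lam d) = d" by (simp del: upt_Suc)
  moreover have "\<forall>f\<in>set (forms lam d). homogeneous 1 f" using hom by blast
  ultimately have sop: "linear_system_of_parameters I (forms lam d)"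
    unfolding linear_system_of_parameters_def system_of_parameters_def irrelevant_ideal_def genideal_type_ring
      mm_eq_span[symmetric] using assms(4) by auto
  have "cohen_macaulay (poly_S Quot I) \<longleftrightarrow> (\<forall>N. maximalideal N (poly_S Quot I) \<longrightarrow>
      Sup (depths {s. I +>\<^bsub>poly_S\<^esub> s \<in> N}) = Sup (chains {s. I +>\<^bsub>poly_S\<^esub> s \<in> N}))"
    unfolding cohen_macaulay_def depths_def chains_def
    using local_depth_krull_dim_Quot[OF noeth_mpoly Iid Q.maximalideal_prime] Q.is_cring Q.noetherian[OF noeth_mpoly]
    by auto
  also have "\<dots> \<longleftrightarrow> (\<forall>M. prime_set M \<and> (\<forall>p. p \<notin> M \<longrightarrow> (\<exists>q. p * q - 1 \<in> M)) \<and> I \<subseteq> M \<longrightarrow>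
      Sup (depths M) = Sup (chains M))"
    by (rule maximal_Quot_iff[OF Iid])
  also have "\<dots> \<longleftrightarrow> rseq I (forms lam d)"
  proof
    assume "\<forall>M. prime_set M \<and> (\<forall>p. p \<notin> M \<longrightarrow> (\<exists>q. p * q - 1 \<in> M)) \<and> I \<subseteq> M \<longrightarrow>
      Sup (depths M) = Sup (chains M)"
    \<comment> \<open>For this direction the Cohen-Macaulay condition is evaluated at the irrelevant
      ideal, where the dimension of the localization is the full \<open>d\<close> because a largest
      face gives a chain inside \<open>mm\<close>.\<close>
    then have "Sup (depths mm) = Sup (chains mm)" using prime_mm maximal_mm I_sub_mm by blast
    then show "rseq I (forms lam d)" by (rule cm_imp_regular[OF dim assms(5)])
  qed (use regular_imp_cm[OF dim assms(5)] in blast)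
  also have "\<dots> \<longleftrightarrow> regular_seq poly_S I (forms lam d)"
    unfolding regular_seq_type_ring_iff using Iid by (simp only: idl.span_eq_iff[THEN iffD2])
  finally show ?thesis using sop by blast
qed

end
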